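(* Let $L$ be a computable linear order with dense condensation-type and with no infinite, strongly $\eta$-like interval. Then there is a computable linear order $M$, isomorphic to $L$ (as a linear order), whose non-block relation $\neg B_M(x,y)$ is computably enumerable.
   Context: A computable linear order $L$ is a linear order with universe $\mathbb{N}$ whose order relation $<_L$ is computable. A computable copy of $L$ is a computable linear order isomorphic to $L$ (the isomorphism need not be computable). $\eta$ denotes the order-type of the rationals $(\mathbb{Q},<)$. The block relation $B_L(x,y)$ of a linear order $L$ holds of elements $x,y$ exactly when the closed $L$-interval between $x$ and $y$ is finite; it is an equivalence relation whose equivalence classes are called the blocks of $L$. The non-block relation is its complement $\neg B_L(x,y)$, i.e. the set of pairs $(x,y)$ not in the same block. The condensation-type of $L$ is the order-type of the linear order obtained by factoring $L$ by $B_L$ (collapsing each block to a single point). The condensation-type is dense if it is one of $\eta$, $1+\eta$, $\eta+1$, $1+\eta+1$. An interval of $L$ is a convex subset of $L$, with the induced order. An interval is strongly $\eta$-like if it has condensation-type $\eta$ and there is a fixed finite $k$ such that all of its blocks have size less than $k$. *)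

theory Defs
  imports Complex_Main
begin

text \<open>
  Partial recursive functions, given by program terms with a big-step semantics:
  \<open>eval p xs y\<close> says that \<open>p\<close> halts on the arguments \<open>xs\<close> with output \<open>y\<close>.
  Arities are not tracked in the syntax: \<open>Zero\<close> is the constant zero function of every arity.
\<close>

datatype prog =
    Zero
  | Succ
  | Proj nat
  | Comp prog "prog list"
  | PrimRec prog prog
  | Mu prog

inductive eval :: "prog \<Rightarrow> nat list \<Rightarrow> nat \<Rightarrow> bool" where
  eval_Zero: "eval Zero xs 0"
| eval_Succ: "eval Succ [x] (Suc x)"
| eval_Proj: "i < length xs \<Longrightarrow> eval (Proj i) xs (xs ! i)"
| eval_Comp: "list_all2 (\<lambda>q y. eval q xs y) qs ys \<Longrightarrow> eval p ys z \<Longrightarrow> eval (Comp p qs) xs z"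
| eval_PrimRec_0: "eval p xs y \<Longrightarrow> eval (PrimRec p q) (0 # xs) y"
| eval_PrimRec_Suc:
    "eval (PrimRec p q) (n # xs) y \<Longrightarrow> eval q (n # y # xs) z \<Longrightarrow> eval (PrimRec p q) (Suc n # xs) z"
| eval_Mu:
    "eval p (n # xs) 0 \<Longrightarrow> (\<forall>m<n. \<exists>y>0. eval p (m # xs) y) \<Longrightarrow> eval (Mu p) xs n"
monos list_all2_mono

inductive_cases eval_ZeroE: "eval Zero xs y"
inductive_cases eval_SuccE: "eval Succ xs y"
inductive_cases eval_ProjE: "eval (Proj i) xs y"
inductive_cases eval_CompE: "eval (Comp p qs) xs y"
inductive_cases eval_PrimRec_0E: "eval (PrimRec p q) (0 # xs) y"
inductive_cases eval_PrimRec_SucE: "eval (PrimRec p q) (Suc n # xs) y"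
inductive_cases eval_MuE: "eval (Mu p) xs y"

lemma eval_deterministic: "eval p xs y \<Longrightarrow> eval p xs z \<Longrightarrow> y = z"
proof (induction arbitrary: z rule: eval.induct)
  case (eval_Zero xs)
  then show ?case by (elim eval_ZeroE) simp
next
  case (eval_Succ x)
  then show ?case by (elim eval_SuccE) simp
next
  case (eval_Proj i xs)
  then show ?case by (elim eval_ProjE) simp
next
  case (eval_Comp xs qs ys p y)
  from eval_Comp.prems obtain ys' where
    ys': "list_all2 (\<lambda>q y. eval q xs y) qs ys'" "eval p ys' z"
    by (rule eval_CompE)
  have "ys = ys'"
  proof (rule nth_equalityI)
    show "length ys = length ys'"
      using list_all2_lengthD[OF eval_Comp.IH(1)] list_all2_lengthD[OF ys'(1)] by simp
  next
    fix i assume "i < length ys"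
    then have "i < length qs" using list_all2_lengthD[OF eval_Comp.IH(1)] by simp
    then show "ys ! i = ys' ! i"
      using list_all2_nthD[OF eval_Comp.IH(1), of i] list_all2_nthD[OF ys'(1), of i] by simp
  qed
  then show ?case using eval_Comp.IH(2) ys'(2) by blast
next
  case (eval_PrimRec_0 p xs y q)
  from eval_PrimRec_0.prems have "eval p xs z" by (rule eval_PrimRec_0E)
  then show ?case by (rule eval_PrimRec_0.IH)
next
  case (eval_PrimRec_Suc p q n xs y w)
  from eval_PrimRec_Suc.prems obtain y' where
    "eval (PrimRec p q) (n # xs) y'" "eval q (n # y' # xs) z"
    by (rule eval_PrimRec_SucE)
  then show ?case using eval_PrimRec_Suc.IH by blast
next
  case (eval_Mu p n xs)
  from eval_Mu.prems have z: "eval p (z # xs) 0" "\<forall>m<z. \<exists>y>0. eval p (m # xs) y"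
    by (auto elim!: eval_MuE)
  show ?case
  proof (rule linorder_cases[of n z])
    assume "n < z"
    then obtain y where "y > 0" "eval p (n # xs) y" using z(2) by blast
    then show ?thesis using eval_Mu.IH(1) by blast
  next
    assume "z < n"
    then show ?thesis using z(1) eval_Mu.IH(2) by blast
  qed
qed

definition computable_rel :: "nat rel \<Rightarrow> bool" where
  "computable_rel R \<longleftrightarrow> (\<exists>p. \<forall>x y. eval p [x, y] (if (x, y) \<in> R then 1 else 0))"

definition ce_rel :: "nat rel \<Rightarrow> bool" where
  "ce_rel R \<longleftrightarrow> (\<exists>p. \<forall>x y. (x, y) \<in> R \<longleftrightarrow> (\<exists>z. eval p [x, y] z))"

text \<open>
  Linear orders are reflexive relations with universe \<^term>\<open>Field r\<close>, as in
  \<^prop>\<open>Linear_order r\<close>; two of them have the same order-type if they are isomorphic.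
\<close>

definition same_order_type :: "'a rel \<Rightarrow> 'b rel \<Rightarrow> bool" where
  "same_order_type r s \<longleftrightarrow> (\<exists>f. iso r s f)"

definition order_sum :: "'a rel \<Rightarrow> 'b rel \<Rightarrow> ('a + 'b) rel" where
  "order_sum r s =
     {(Inl a, Inl b) | a b. (a, b) \<in> r} \<union>
     {(Inr a, Inr b) | a b. (a, b) \<in> s} \<union>
     {(Inl a, Inr b) | a b. a \<in> Field r \<and> b \<in> Field s}"

definition order_one :: "unit rel" where
  "order_one = {((), ())}"

definition eta :: "rat rel" where
  "eta = {(p, q). p \<le> q}"

text \<open>The endpoints may be given in either order.\<close>

definition closed_interval :: "'a rel \<Rightarrow> 'a \<Rightarrow> 'a \<Rightarrow> 'a set" where
  "closed_interval L x y =
     {z. (x, z) \<in> L \<and> (z, y) \<in> L} \<union> {z. (y, z) \<in> L \<and> (z, x) \<in> L}"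

definition block_rel :: "'a rel \<Rightarrow> 'a rel" where
  "block_rel L = {(x, y). x \<in> Field L \<and> y \<in> Field L \<and> finite (closed_interval L x y)}"

definition blocks :: "'a rel \<Rightarrow> 'a set set" where
  "blocks L = Field L // block_rel L"

definition nonblock_rel :: "'a rel \<Rightarrow> 'a rel" where
  "nonblock_rel L = Field L \<times> Field L - block_rel L"

definition condensation :: "'a rel \<Rightarrow> 'a set rel" where
  "condensation L =
     {(X, Y). X \<in> blocks L \<and> Y \<in> blocks L \<and> (\<exists>x\<in>X. \<exists>y\<in>Y. (x, y) \<in> L)}"

definition dense_condensation_type :: "'a rel \<Rightarrow> bool" where
  "dense_condensation_type L \<longleftrightarrow>
     same_order_type (condensation L) eta \<or>
     same_order_type (condensation L) (order_sum order_one eta) \<or>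
     same_order_type (condensation L) (order_sum eta order_one) \<or>
     same_order_type (condensation L) (order_sum (order_sum order_one eta) order_one)"

definition is_interval_of :: "'a set \<Rightarrow> 'a rel \<Rightarrow> bool" where
  "is_interval_of I L \<longleftrightarrow>
     I \<subseteq> Field L \<and> (\<forall>x\<in>I. \<forall>y\<in>I. \<forall>z. (x, z) \<in> L \<longrightarrow> (z, y) \<in> L \<longrightarrow> z \<in> I)"

text \<open>Finiteness of the blocks is stated separately because \<^const>\<open>card\<close> is 0 on infinite sets.\<close>

definition strongly_eta_like :: "'a rel \<Rightarrow> bool" where
  "strongly_eta_like L \<longleftrightarrow>
     same_order_type (condensation L) eta \<and>
     (\<exists>k. \<forall>X\<in>blocks L. finite X \<and> card X < k)"

definition computable_linear_order :: "nat rel \<Rightarrow> bool" where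
  "computable_linear_order L \<longleftrightarrow> linear_order L \<and> computable_rel (L - Id)"

end

theory Submission
  imports Defs "HOL-Library.Nat_Bijection" "HOL-Library.Infinite_Set"
begin

text \<open>
  Two elements of the given order \<open>L\<close> are seen to lie in one block at stage \<open>t\<close> if the interval
  between them consists of numbers below \<open>t\<close>. This relation is limit computable, so that relative
  to the halting problem the blocks of \<open>L\<close> may merge but never split. A finite injury
  construction on this level yields a limit computable copy with a limit computable block relation:
  its blocks grow as their images do, and if the images of two of them merge, the one of lower
  priority is moved into another block of \<open>L\<close> that is at least as large as it has become. Such
  blocks exist, since an open interval between two blocks of \<open>L\<close> has condensation type
  \<open>\<eta>\<close>, hence it has blocks of unbounded size.

  A second finite injury construction turns limit computable blocks into a computable copy. Elements
  that have been put into a block by a wrong guess are split off as singletons, and they are used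
  later on as the first elements of other blocks. Since only new elements are put into existing
  blocks, splits are permanent, and the non-block relation enumerates them.

  Both constructions assume that \<open>L\<close> has a first and a last element. If there is no first block a
  first element is added, and a first block without first element is cut off as a sum with
  \<open>\<omega>\<^sup>*\<close>.
\<close>

subsection \<open>Programs for pairing\<close>

text \<open>Lying in one block is a Sigma_2 property: some bound \<open>t\<close> exceeds all
  elements of the interval, and for fixed \<open>t\<close> this is Pi_1. One limit therefore makes
  it enumerable, the first construction makes it decidable by changing the presentation, and giving
  up the limit in the second one leaves a single quantifier, which is spent on the non-block
  relation.

  What shapes the second construction is that an element split off inside a block would cut this
  block in two forever. So the first construction has to leave behind a numbering in which
  everything between two members of a block has a smaller number than one of them: a wrong guess
  discards all elements from some number on, and then what survives of a block has no discarded
  element inside it.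

  The fixed first and last elements guarantee that every new element finds elements with permanent
  images on both of its sides.

  Two kinds of requirements compete in the first construction, to cover each element of the given
  order and to provide each class with a final image. Comparing the least uncovered element with the
  least unmatched representative decides which of them acts, so that neither blocks the
  other.\<close>

abbreviation pr :: "nat \<Rightarrow> nat \<Rightarrow> nat" where
  "pr x y \<equiv> prod_encode (x, y)"

definition pi1 :: "nat \<Rightarrow> nat" where "pi1 z = fst (prod_decode z)"
definition pi2 :: "nat \<Rightarrow> nat" where "pi2 z = snd (prod_decode z)"

lemma pi_pr [simp]: "pi1 (pr x y) = x" "pi2 (pr x y) = y"
  by (simp_all add: pi1_def pi2_def)

lemma pr_pi [simp]: "pr (pi1 z) (pi2 z) = z"
  by (simp add: pi1_def pi2_def)

text \<open>The largest \<open>d\<close> with \<open>triangle d\<close> \<le> \<open>z\<close>.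
  Truncated subtraction makes the increment 1 exactly when \<open>Suc z\<close> reaches the next
  triangular number. This inverts \<open>prod_encode\<close>, whose value at \<open>(x, y)\<close>
  is \<open>triangle (x + y) + x\<close>.\<close>

primrec diag :: "nat \<Rightarrow> nat" where
  "diag 0 = 0"
| "diag (Suc z) = diag z + (1 - (triangle (Suc (diag z)) - Suc z))"

lemma diag_bounds: "triangle (diag z) \<le> z \<and> z < triangle (Suc (diag z))"
proof (induction z)
  case (Suc z)
  show ?case
  proof (cases "triangle (Suc (diag z)) \<le> Suc z")
    case True
    with Suc have "triangle (Suc (diag z)) = Suc z" by simp
    then show ?thesis by simp
  qed (use Suc in auto)
qed simp

lemma pi1_eq: "pi1 z = z - triangle (diag z)"
  and pi2_eq: "pi2 z = diag z - pi1 z"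
proof -
  let ?m = "z - triangle (diag z)"
  have "?m \<le> diag z" using diag_bounds[of z] by (simp add: le_diff_conv add.commute)
  then have "prod_encode (?m, diag z - ?m) = z"
    using diag_bounds[of z] by (simp add: prod_encode_def)
  then show *: "pi1 z = ?m" and "pi2 z = diag z - pi1 z"
    by (metis pi_pr(1), metis pi_pr)
qed

lemma eval_Comp1: "eval q xs y \<Longrightarrow> eval p [y] z \<Longrightarrow> eval (Comp p [q]) xs z"
  by (rule eval_Comp[where ys = "[y]"]) auto

lemma eval_Comp2:
  "eval q xs y \<Longrightarrow> eval q' xs y' \<Longrightarrow> eval p [y, y'] z \<Longrightarrow> eval (Comp p [q, q']) xs z"
  by (rule eval_Comp[where ys = "[y, y']"]) auto

lemma eval_Proj0: "eval (Proj 0) (x # xs) x"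
  and eval_Proj1: "eval (Proj 1) (x # y # xs) y"
  and eval_Proj2: "eval (Proj 2) (x # y # w # xs) w"
  using eval_Proj[of 0 "x # xs"] eval_Proj[of 1 "x # y # xs"] eval_Proj[of 2 "x # y # w # xs"]
  by simp_all

lemmas eval_basic = eval_Zero eval_Succ eval_Proj0 eval_Proj1 eval_Proj2

definition "p_add = PrimRec (Proj 0) (Comp Succ [Proj 1])"
definition "p_pred = PrimRec Zero (Proj 0)"
text \<open>Primitive recursion runs on the first argument, so the arguments are reversed:
  \<open>[n, x]\<close> yields \<open>x - n\<close>.\<close>

definition "p_subr = PrimRec (Proj 0) (Comp p_pred [Proj 1])"
definition "p_tri = PrimRec Zero (Comp p_add [Comp Succ [Proj 0], Proj 1])"
definition "p_diag = PrimRec Zero (Comp p_add [Proj 1, Comp p_subr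
  [Comp p_subr [Comp Succ [Proj 0], Comp p_tri [Comp Succ [Proj 1]]], Comp Succ [Zero]]])"
definition "p_pi1 = Comp p_subr [Comp p_tri [p_diag], Proj 0]"
definition "p_pi2 = Comp p_subr [p_pi1, p_diag]"
definition "p_pair = Comp p_add [Comp p_tri [p_add], Proj 0]"

lemma eval_add: "eval p_add [n, x] (n + x)"
proof (induction n)
  case 0
  then show ?case unfolding p_add_def by (simp add: eval_PrimRec_0 eval_Proj0)
next
  case (Suc n)
  show ?case
    using eval_PrimRec_Suc[OF Suc[unfolded p_add_def] eval_Comp1[OF eval_Proj1 eval_Succ]]
    unfolding p_add_def by simp
qed

lemma eval_pred: "eval p_pred [n] (n - 1)"
proof (induction n)
  case 0
  show ?case unfolding p_pred_def by (simp add: eval_PrimRec_0 eval_Zero)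
next
  case (Suc n)
  show ?case
    using eval_PrimRec_Suc[OF Suc[unfolded p_pred_def] eval_Proj0]
    unfolding p_pred_def by simp
qed

lemma eval_subr: "eval p_subr [n, x] (x - n)"
proof (induction n)
  case 0
  then show ?case unfolding p_subr_def by (simp add: eval_PrimRec_0 eval_Proj0)
next
  case (Suc n)
  show ?case
    using eval_PrimRec_Suc[OF Suc[unfolded p_subr_def] eval_Comp1[OF eval_Proj1 eval_pred]]
    unfolding p_subr_def by simp
qed

lemma eval_tri: "eval p_tri [n] (triangle n)"
proof (induction n)
  case 0
  show ?case unfolding p_tri_def by (simp add: eval_PrimRec_0 eval_Zero)
next
  case (Suc n)
  show ?case
    using eval_PrimRec_Suc[OF Suc[unfolded p_tri_def]
        eval_Comp2[OF eval_Comp1[OF eval_Proj0 eval_Succ] eval_Proj1 eval_add]]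
    unfolding p_tri_def by (simp add: algebra_simps)
qed

lemma eval_diag: "eval p_diag [n] (diag n)"
proof (induction n)
  case 0
  show ?case unfolding p_diag_def by (simp add: eval_PrimRec_0 eval_Zero)
next
  case (Suc n)
  have "eval (Comp p_add [Proj 1, Comp p_subr [Comp p_subr [Comp Succ [Proj 0],
      Comp p_tri [Comp Succ [Proj 1]]], Comp Succ [Zero]]]) [n, diag n] (diag (Suc n))"
    unfolding diag.simps One_nat_def
    by (rule eval_Comp2 eval_Comp1 eval_basic[unfolded One_nat_def] eval_subr eval_tri eval_add)+
  from eval_PrimRec_Suc[OF Suc[unfolded p_diag_def] this]
  show ?case unfolding p_diag_def .
qed

lemma eval_pi1: "eval p_pi1 [z] (pi1 z)"
  unfolding p_pi1_def pi1_eq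
  by (rule eval_Comp2 eval_Comp1 eval_Proj0 eval_subr eval_tri eval_diag)+

lemma eval_pi2: "eval p_pi2 [z] (pi2 z)"
  unfolding p_pi2_def pi2_eq
  by (rule eval_Comp2 eval_pi1 eval_subr eval_diag)+

lemma eval_pair: "eval p_pair [x, y] (pr x y)"
  unfolding p_pair_def prod_encode_def prod.case
  by (rule eval_Comp2 eval_Comp1 eval_Proj0 eval_tri eval_add)+

subsection \<open>Classes of functions closed under recursion and total minimization\<close>

text \<open>
  Functions of several arguments are functions of coded tuples. Besides the total computable
  functions, the limit computable ones form such a class, which serves in place of
  relativization to the halting problem.
\<close>

locale rec_class =
  fixes C :: "(nat \<Rightarrow> nat) \<Rightarrow> bool"
  assumes C_id: "C (\<lambda>x. x)"
    and C_const: "C (\<lambda>x. k)"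
    and C_Suc: "C f \<Longrightarrow> C (\<lambda>x. Suc (f x))"
    and C_pr: "C f \<Longrightarrow> C g \<Longrightarrow> C (\<lambda>x. pr (f x) (g x))"
    and C_pi1: "C f \<Longrightarrow> C (\<lambda>x. pi1 (f x))"
    and C_pi2: "C f \<Longrightarrow> C (\<lambda>x. pi2 (f x))"
    and C_comp: "C f \<Longrightarrow> C g \<Longrightarrow> C (\<lambda>x. f (g x))"
    and C_rec: "C g \<Longrightarrow> C h \<Longrightarrow>
      C (\<lambda>z. rec_nat (g (pi2 z)) (\<lambda>n r. h (pr n (pr r (pi2 z)))) (pi1 z))"
    and C_mu: "C h \<Longrightarrow> (\<And>x. \<exists>y. h (pr y x) = 0) \<Longrightarrow> C (\<lambda>x. LEAST y. h (pr y x) = 0)"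
begin

lemma C_comp2: "C (\<lambda>z. f (pi1 z) (pi2 z)) \<Longrightarrow> C g \<Longrightarrow> C h \<Longrightarrow> C (\<lambda>x. f (g x) (h x))"
  using C_comp[OF _ C_pr, of "\<lambda>z. f (pi1 z) (pi2 z)" g h] by simp

lemma C_comp3: "C (\<lambda>z. f (pi1 z) (pi1 (pi2 z)) (pi2 (pi2 z))) \<Longrightarrow> C g \<Longrightarrow> C h \<Longrightarrow> C k
    \<Longrightarrow> C (\<lambda>x. f (g x) (h x) (k x))"
  using C_comp[OF _ C_pr[OF _ C_pr], of "\<lambda>z. f (pi1 z) (pi1 (pi2 z)) (pi2 (pi2 z))" g h k] by simp

lemma C_comp4: "C (\<lambda>z. f (pi1 z) (pi1 (pi2 z)) (pi1 (pi2 (pi2 z))) (pi2 (pi2 (pi2 z)))) \<Longrightarrow> C a \<Longrightarrow> C b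
    \<Longrightarrow> C c \<Longrightarrow> C d \<Longrightarrow> C (\<lambda>x. f (a x) (b x) (c x) (d x))"
  using C_comp[OF _ C_pr[OF _ C_pr[OF _ C_pr]],
    of "\<lambda>z. f (pi1 z) (pi1 (pi2 z)) (pi1 (pi2 (pi2 z))) (pi2 (pi2 (pi2 z)))" a b c d] by simp

text \<open>Taking the whole input as the parameter of the recursion lets the start, the step and
  the length all depend on it.\<close>

lemma C_rec': 
  assumes "C a" "C (\<lambda>z. h (pi1 z) (pi1 (pi2 z)) (pi2 (pi2 z)))" "C b"
  shows "C (\<lambda>x. rec_nat (a x) (\<lambda>n r. h n r x) (b x))"
  using C_comp[OF C_rec[OF assms(1,2)] C_pr[OF assms(3) C_id]] by simp

lemma C_add: "C f \<Longrightarrow> C g \<Longrightarrow> C (\<lambda>x. f x + g x)"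
proof -
  assume fg: "C f" "C g"
  have "rec_nat a (\<lambda>n r. Suc r) b = b + a" for a b by (induction b) auto
  with C_rec'[of g "\<lambda>n r x. Suc r" f] fg show ?thesis
    by (simp add: C_Suc C_pi1 C_pi2 C_id)
qed

lemma C_pred: "C f \<Longrightarrow> C (\<lambda>x. f x - 1)"
proof -
  assume f: "C f"
  have "rec_nat 0 (\<lambda>n r. n) b = b - 1" for b by (cases b) auto
  with C_rec'[of "\<lambda>x. 0" "\<lambda>n r x. n" f] f show ?thesis
    by (simp add: C_const C_pi1 C_id)
qed

lemma C_diff: "C f \<Longrightarrow> C g \<Longrightarrow> C (\<lambda>x. f x - g x)"
proof -
  assume fg: "C f" "C g"
  have "rec_nat a (\<lambda>n r. r - 1) b = a - b" for a b :: nat by (induction b) auto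
  with C_rec'[of f "\<lambda>n r x. r - 1" g] fg show ?thesis
    by (simp add: C_pred[unfolded One_nat_def] C_pi1 C_pi2 C_id)
qed

lemma C_mult: "C f \<Longrightarrow> C g \<Longrightarrow> C (\<lambda>x. f x * g x)"
proof -
  assume fg: "C f" "C g"
  have "rec_nat 0 (\<lambda>n r. r + a) b = a * b" for a b :: nat by (induction b) auto
  with C_rec'[of "\<lambda>x. 0" "\<lambda>n r x. r + f x" g] fg
  show ?thesis
    by (simp add: C_const C_add C_pi1 C_pi2 C_id C_comp[of f])
qed

definition dec :: "(nat \<Rightarrow> bool) \<Rightarrow> bool" where
  "dec P \<longleftrightarrow> C (\<lambda>x. if P x then 1 else 0)"

lemma C_if: "dec P \<Longrightarrow> C f \<Longrightarrow> C g \<Longrightarrow> C (\<lambda>x. if P x then f x else g x)"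
proof -
  assume a: "dec P" "C f" "C g"
  let ?i = "\<lambda>x. if P x then 1 else (0::nat)"
  have "C (\<lambda>x. ?i x * f x + (1 - ?i x) * g x)"
    using a unfolding dec_def by (intro C_add C_mult C_diff C_const)
  moreover have "(\<lambda>x. ?i x * f x + (1 - ?i x) * g x) = (\<lambda>x. if P x then f x else g x)" by auto
  ultimately show ?thesis by simp
qed

lemma dec_comp: "dec P \<Longrightarrow> C f \<Longrightarrow> dec (\<lambda>x. P (f x))"
  unfolding dec_def by (rule C_comp)

lemma dec_comp2: "dec (\<lambda>z. P (pi1 z) (pi2 z)) \<Longrightarrow> C f \<Longrightarrow> C g \<Longrightarrow> dec (\<lambda>x. P (f x) (g x))"
  using dec_comp[OF _ C_pr, of "\<lambda>z. P (pi1 z) (pi2 z)" f g] by simp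

lemma dec_comp3: "dec (\<lambda>z. P (pi1 z) (pi1 (pi2 z)) (pi2 (pi2 z))) \<Longrightarrow> C f \<Longrightarrow> C g \<Longrightarrow> C h
    \<Longrightarrow> dec (\<lambda>x. P (f x) (g x) (h x))"
  using dec_comp[OF _ C_pr[OF _ C_pr], of "\<lambda>z. P (pi1 z) (pi1 (pi2 z)) (pi2 (pi2 z))" f g h] by simp

lemma dec_const: "dec (\<lambda>x. b)"
  unfolding dec_def by (cases b) (simp_all add: C_const)

lemma dec_zero: "C f \<Longrightarrow> dec (\<lambda>x. f x = 0)"
proof -
  assume "C f"
  moreover have "(\<lambda>x. if f x = 0 then 1 else 0) = (\<lambda>x. 1 - f x)" by auto
  ultimately show ?thesis unfolding dec_def using C_diff[OF C_const[of 1]] by simp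
qed

lemma dec_not:
  assumes "dec P" shows "dec (\<lambda>x. \<not> P x)"
proof -
  have "(\<lambda>x. if \<not> P x then 1 else (0::nat)) = (\<lambda>x. if P x then 0 else 1)" by auto
  with C_if[OF assms C_const[of 0] C_const[of 1]] show ?thesis
    unfolding dec_def by simp
qed

lemma dec_conj: "dec P \<Longrightarrow> dec Q \<Longrightarrow> dec (\<lambda>x. P x \<and> Q x)"
proof -
  assume a: "dec P" "dec Q"
  have "(\<lambda>x. if P x \<and> Q x then 1 else (0::nat)) = (\<lambda>x. if P x then (if Q x then 1 else 0) else 0)"
    by auto
  with C_if[OF a(1) a(2)[unfolded dec_def] C_const[of 0]] show ?thesis
    unfolding dec_def by simp
qed

lemma dec_disj: "dec P \<Longrightarrow> dec Q \<Longrightarrow> dec (\<lambda>x. P x \<or> Q x)"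
  using dec_not[OF dec_conj[OF dec_not dec_not], of P Q] by simp

lemma dec_imp: "dec P \<Longrightarrow> dec Q \<Longrightarrow> dec (\<lambda>x. P x \<longrightarrow> Q x)"
  using dec_disj[OF dec_not, of P Q] by simp

lemma dec_iff: "dec P \<Longrightarrow> dec Q \<Longrightarrow> dec (\<lambda>x. P x \<longleftrightarrow> Q x)"
  unfolding iff_conv_conj_imp by (intro dec_conj dec_imp)

lemma dec_if: "dec P \<Longrightarrow> dec Q \<Longrightarrow> dec R \<Longrightarrow> dec (\<lambda>x. if P x then Q x else R x)"
  unfolding if_bool_eq_conj by (intro dec_conj dec_imp dec_not)

lemma dec_le: "C f \<Longrightarrow> C g \<Longrightarrow> dec (\<lambda>x. f x \<le> g x)"
  using dec_zero[OF C_diff, of f g] by simp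

lemma dec_less: "C f \<Longrightarrow> C g \<Longrightarrow> dec (\<lambda>x. f x < g x)"
  using dec_not[OF dec_le, of g f] by (simp add: not_le)

lemma dec_eq: "C f \<Longrightarrow> C g \<Longrightarrow> dec (\<lambda>x. f x = g x)"
  using dec_conj[OF dec_le dec_le, of f g g f] by (simp add: eq_iff)

lemma dec_all_less:
  assumes "dec (\<lambda>z. P (pi1 z) (pi2 z))" "C b"
  shows "dec (\<lambda>x. \<forall>y<b x. P x y)"
proof -
  have *: "rec_nat 1 (\<lambda>n r. if P x n then r else 0) b = (if \<forall>y<b. P x y then 1 else (0::nat))"
    for x b by (induction b) (auto simp: less_Suc_eq)
  have "dec (\<lambda>z. P (pi2 (pi2 z)) (pi1 z))"
    by (rule dec_comp2[OF assms(1)]) (intro C_pi1 C_pi2 C_id)+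
  then have "C (\<lambda>x. rec_nat 1 (\<lambda>n r. if P x n then r else 0) (b x))"
    by (intro C_rec' C_const assms C_if C_pi1 C_pi2 C_id)
  then show ?thesis unfolding dec_def * .
qed

lemma dec_ex_less:
  assumes "dec (\<lambda>z. P (pi1 z) (pi2 z))" "C b"
  shows "dec (\<lambda>x. \<exists>y<b x. P x y)"
  using dec_not[OF dec_all_less[OF dec_not[OF assms(1)] assms(2)]] by simp

lemma C_Least:
  assumes "dec (\<lambda>z. P (pi1 z) (pi2 z))" "\<And>x. \<exists>y. P x y"
  shows "C (\<lambda>x. LEAST y. P x y)"
proof -
  let ?h = "\<lambda>z. if P (pi2 z) (pi1 z) then 0 else (1::nat)"
  have "dec (\<lambda>z. P (pi2 z) (pi1 z))"
    by (rule dec_comp2[OF assms(1)]) (intro C_pi1 C_pi2 C_id)+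
  then have "C ?h" by (intro C_if C_const)
  moreover have "((if b then 0 else (1::nat)) = 0) = b" for b by simp
  ultimately show ?thesis using C_mu[of ?h] assms(2) by simp
qed

end

section \<open>Coded finite sequences and rational labels\<close>

definition nthc :: "nat \<Rightarrow> nat \<Rightarrow> nat" where
  "nthc c i = pi1 ((pi2 ^^ i) c)"

lemma nthc_pr [simp]: "nthc (pr a c) 0 = a" "nthc (pr a c) (Suc i) = nthc c i"
  by (simp_all add: nthc_def funpow_swap1)

lemma nthc_pr_numeral [simp]: "nthc (pr a c) (numeral k) = nthc c (pred_numeral k)"
  by (simp add: numeral_eq_Suc)

text \<open>Codes carry no length: every number codes an infinite sequence of which a finite part
  can be prescribed. States therefore store their lengths separately.\<close>

lemma ex_nthc: "\<exists>c. \<forall>i<n. nthc c i = f i"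
proof (induction n arbitrary: f)
  case (Suc n)
  from this[of "\<lambda>i. f (Suc i)"] obtain c where "\<forall>i<n. nthc c i = f (Suc i)" by blast
  then have "\<forall>i<Suc n. nthc (pr (f 0) c) i = f i" by (auto simp: less_Suc_eq_0_disj)
  then show ?case ..
qed simp

text \<open>Labels denote nonnegative rationals; they present linear orders on the naturals.\<close>

definition vl :: "nat \<Rightarrow> real" where
  "vl z = real (pi1 z) / real (Suc (pi2 z))"

lemma vl_less_iff: "vl z < vl w \<longleftrightarrow> pi1 z * Suc (pi2 w) < pi1 w * Suc (pi2 z)"
proof -
  have "vl z < vl w \<longleftrightarrow> real (pi1 z) * real (Suc (pi2 w)) < real (pi1 w) * real (Suc (pi2 z))"
    unfolding vl_def by (simp add: divide_simps del: of_nat_Suc)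
  also have "\<dots> \<longleftrightarrow> pi1 z * Suc (pi2 w) < pi1 w * Suc (pi2 z)"
    by (simp only: of_nat_mult[symmetric] of_nat_less_iff)
  finally show ?thesis .
qed

lemma vl_nonneg: "0 \<le> vl z"
  by (simp add: vl_def)

lemma ex_vl: "0 \<le> a \<Longrightarrow> a < b \<Longrightarrow> \<exists>z. a < vl z \<and> vl z < b"
proof -
  assume ab: "0 \<le> a" "a < (b::real)"
  obtain r where r: "a < of_rat r" "of_rat r < b" using of_rat_dense[OF ab(2)] by blast
  with ab have "0 < (of_rat r :: real)" by linarith
  then have "0 < r" by simp
  obtain i j where ij: "r = Fract i j" "j > 0" by (cases r) auto
  with \<open>0 < r\<close> have "i > 0" by (simp add: zero_less_Fract_iff)
  have "vl (pr (nat i) (nat (j - 1))) = of_rat r"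
    unfolding vl_def ij(1) of_rat_rat[OF less_imp_neq[OF ij(2), symmetric]]
    using ij \<open>i > 0\<close> by simp
  with r show ?thesis by metis
qed

text \<open>Provides a label immediately to the right of \<open>a\<close> among finitely many labels
  in use. The bound \<open>a + 1\<close> only keeps the set of upper bounds nonempty.\<close>

lemma ex_vl_right: "finite S \<Longrightarrow> 0 \<le> a \<Longrightarrow> \<exists>z. a < vl z \<and> (\<forall>b\<in>S. a < b \<longrightarrow> vl z < b)"
proof -
  assume S: "finite S" "0 \<le> a"
  let ?b = "Min (insert (a + 1) {b\<in>S. a < b})"
  have "a < ?b" using S by (subst Min_gr_iff) auto
  then obtain z where "a < vl z" "vl z < ?b" using ex_vl S by blast
  moreover have "\<forall>b\<in>S. a < b \<longrightarrow> ?b \<le> b" using S by (auto intro!: Min_le)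
  ultimately show ?thesis by (metis order_less_le_trans)
qed

text \<open>Labels are nonnegative, so \<open>0 < a\<close> is what leaves room to the left of
  \<open>a\<close>.\<close>

lemma ex_vl_left: "finite S \<Longrightarrow> (\<And>b. b \<in> S \<Longrightarrow> 0 \<le> b) \<Longrightarrow> 0 < a \<Longrightarrow> \<exists>z. vl z < a \<and> (\<forall>b\<in>S. b < a \<longrightarrow> b < vl z)"
proof -
  assume S: "finite S" "\<And>b. b \<in> S \<Longrightarrow> 0 \<le> b" "0 < a"
  let ?b = "Max (insert 0 {b\<in>S. b < a})"
  have "?b < a" using S by (subst Max_less_iff) auto
  moreover have "0 \<le> ?b" using S by (intro Max_ge) auto
  ultimately obtain z where "?b < vl z" "vl z < a" using ex_vl by blast
  moreover have "\<forall>b\<in>S. b < a \<longrightarrow> b \<le> ?b" using S by (auto intro!: Max_ge)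
  ultimately show ?thesis by (metis order_le_less_trans)
qed

context rec_class
begin

lemma C_nthc: "C f \<Longrightarrow> C g \<Longrightarrow> C (\<lambda>x. nthc (f x) (g x))"
proof -
  assume fg: "C f" "C g"
  have "rec_nat a (\<lambda>n r. pi2 r) b = (pi2 ^^ b) a" for a b by (induction b) auto
  with C_pi1[OF C_rec'[of f "\<lambda>n r x. pi2 r" g]] fg show ?thesis
    unfolding nthc_def by (simp add: C_pi1 C_pi2 C_id)
qed

lemma dec_vl_less: "C f \<Longrightarrow> C g \<Longrightarrow> dec (\<lambda>x. vl (f x) < vl (g x))"
  unfolding vl_less_iff by (intro dec_less C_mult C_Suc C_pi1 C_pi2)

lemma dec_vl_le: "C f \<Longrightarrow> C g \<Longrightarrow> dec (\<lambda>x. vl (f x) \<le> vl (g x))"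
  using dec_not[OF dec_vl_less, of g f] by (simp add: not_less)

lemma dec_vl_eq: "C f \<Longrightarrow> C g \<Longrightarrow> dec (\<lambda>x. vl (f x) = vl (g x))"
  using dec_conj[OF dec_vl_le dec_vl_le, of f g g f] by (simp add: eq_iff)

lemmas dec_rules = C_id C_const C_Suc C_pr C_pi1 C_pi2 C_nthc C_add
  dec_not dec_conj dec_disj dec_imp dec_iff dec_if dec_vl_less dec_vl_le dec_vl_eq dec_le dec_less dec_eq
  dec_all_less dec_ex_less

text \<open>
  The step relation need not be total: the sequence is decoded from the least code of an
  initial segment, which exists for every length.
\<close>

lemma least_run:
  assumes "dec (\<lambda>z. P (pi1 z) (pi1 (pi2 z)) (pi2 (pi2 z)))"
    and "Inv 0 s0"
    and "\<And>t s. Inv t s \<Longrightarrow> \<exists>s'. P t s s'"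
    and "\<And>t s s'. Inv t s \<Longrightarrow> P t s s' \<Longrightarrow> Inv (Suc t) s'"
  obtains S where "C S" "S 0 = s0" "\<And>t. Inv t (S t)" "\<And>t. P t (S t) (S (Suc t))"
proof -
  define S where "S = rec_nat s0 (\<lambda>t s. LEAST s'. P t s s')"
  have S0: "S 0 = s0" and SS: "S (Suc t) = (LEAST s'. P t (S t) s')" for t
    by (simp_all add: S_def)
  have P: "P t (S t) (S (Suc t))" if "Inv t (S t)" for t
    unfolding SS using assms(3)[OF that] by (rule LeastI_ex)
  have I: "Inv t (S t)" for t
    by (induction t) (use S0 assms(2) P assms(4) in auto)
  \<comment> \<open>The bounded minimality clause keeps \<open>?R\<close> decidable and forces each
    entry to be the least successor, so that all codes satisfying \<open>?R t\<close> agree up to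
    position \<open>t\<close>.\<close>
  let ?R = "\<lambda>t w. nthc w 0 = s0 \<and> (\<forall>i<t. P i (nthc w i) (nthc w (Suc i)) \<and>
    (\<forall>y<nthc w (Suc i). \<not> P i (nthc w i) y))"
  have R: "nthc w i = S i" if "?R t w" "i \<le> t" for t w i
    using that(2)
  proof (induction i)
    case (Suc i)
    then have "nthc w i = S i" "i < t" by simp_all
    then have "P i (S i) (nthc w (Suc i))" "\<forall>y<nthc w (Suc i). \<not> P i (S i) y"
      using that(1) by auto
    then show ?case unfolding SS by (intro Least_equality[symmetric]) (auto simp: not_less[symmetric])
  qed (use that S0 in simp)
  have ex: "\<exists>w. ?R t w" for t
  proof -
    obtain w where w: "\<forall>i<Suc t. nthc w i = S i" using ex_nthc by blast
    have "\<not> P i (S i) y" if "y < S (Suc i)" for i y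
      using that not_less_Least unfolding SS by blast
    then have "?R t w"
      using w S0 P[OF I] by simp
    then show ?thesis ..
  qed
  have "C (\<lambda>t. nthc (LEAST w. ?R t w) t)"
    by (intro C_nthc C_Least ex dec_rules dec_comp3[OF assms(1)])
  moreover have "nthc (LEAST w. ?R t w) t = S t" for t
    using R[OF LeastI_ex[OF ex[of t]]] by simp
  ultimately have "C S" by simp
  then show thesis using S0 I P[OF I] by (rule that)
qed

end

section \<open>Total computable functions\<close>

definition computable_fun :: "(nat \<Rightarrow> nat) \<Rightarrow> bool" where
  "computable_fun f \<longleftrightarrow> (\<exists>p. \<forall>x. eval p [x] (f x))"

lemma computable_funI: "(\<And>x. eval p [x] (f x)) \<Longrightarrow> computable_fun f"
  unfolding computable_fun_def by blast

interpretation cf: rec_class computable_fun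
proof
  show "computable_fun (\<lambda>x. x)"
    by (rule computable_funI, rule eval_Proj0)
  show "computable_fun (\<lambda>x. k)" for k
  proof (induction k)
    case 0
    show ?case by (rule computable_funI, rule eval_Zero)
  next
    case (Suc k)
    then obtain p where p: "eval p [x] k" for x unfolding computable_fun_def by blast
    from computable_funI[OF eval_Comp1[OF p eval_Succ]] show ?case .
  qed
  fix f assume "computable_fun f"
  then obtain p where p: "eval p [x] (f x)" for x unfolding computable_fun_def by blast
  show "computable_fun (\<lambda>x. Suc (f x))" "computable_fun (\<lambda>x. pi1 (f x))" "computable_fun (\<lambda>x. pi2 (f x))"
    by (rule computable_funI, rule eval_Comp1[OF p], rule eval_Succ eval_pi1 eval_pi2)+
  fix g assume "computable_fun g"
  then obtain q where q: "eval q [x] (g x)" for x unfolding computable_fun_def by blast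
  show "computable_fun (\<lambda>x. pr (f x) (g x))"
    by (rule computable_funI, rule eval_Comp2[OF p q eval_pair])
  show "computable_fun (\<lambda>x. f (g x))"
    by (rule computable_funI, rule eval_Comp1[OF q p])
next
  show "computable_fun (\<lambda>z. rec_nat (g (pi2 z)) (\<lambda>n r. h (pr n (pr r (pi2 z)))) (pi1 z))"
    if gh: "computable_fun g" "computable_fun h" for g h
  proof -
    from gh obtain p q where p: "eval p [x] (g x)" and q: "eval q [x] (h x)" for x
      unfolding computable_fun_def by blast
    let ?q = "Comp q [Comp p_pair [Proj 0, Comp p_pair [Proj 1, Proj 2]]]"
    have "eval ?q [n, r, x] (h (pr n (pr r x)))" for n r x
      by (rule eval_Comp1 eval_Comp2 eval_Proj0 eval_Proj1 eval_Proj2 eval_pair q)+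
    then have "eval (PrimRec p ?q) [n, x] (rec_nat (g x) (\<lambda>n r. h (pr n (pr r x))) n)" for n x
      by (induction n) (auto intro: eval_PrimRec_0 p eval_PrimRec_Suc)
    then have "eval (Comp (PrimRec p ?q) [p_pi1, p_pi2]) [z]
        (rec_nat (g (pi2 z)) (\<lambda>n r. h (pr n (pr r (pi2 z)))) (pi1 z))" for z
      by (intro eval_Comp2[OF eval_pi1 eval_pi2])
    then show ?thesis unfolding computable_fun_def by blast
  qed
  show "computable_fun (\<lambda>x. LEAST y. h (pr y x) = 0)"
    if h: "computable_fun h" and ex: "\<And>x. \<exists>y. h (pr y x) = 0" for h
  proof -
    from h obtain q where q: "eval q [x] (h x)" for x
      unfolding computable_fun_def by blast
    have *: "eval (Comp q [p_pair]) [y, x] (h (pr y x))" for x y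
      by (rule eval_Comp1 eval_pair q)+
    have "eval (Mu (Comp q [p_pair])) [x] (LEAST y. h (pr y x) = 0)" for x
    proof (rule eval_Mu)
      let ?l = "LEAST y. h (pr y x) = 0"
      show "eval (Comp q [p_pair]) [?l, x] 0"
        using *[of ?l x] LeastI_ex[OF ex[of x]] by simp
      show "\<forall>m<?l. \<exists>y>0. eval (Comp q [p_pair]) [m, x] y"
        using *[of _ x] not_less_Least[of _ "\<lambda>y. h (pr y x) = 0"] by (metis gr0I)
    qed
    then show ?thesis unfolding computable_fun_def by blast
  qed
qed

lemma computable_rel_iff: "computable_rel R \<longleftrightarrow> cf.dec (\<lambda>z. (pi1 z, pi2 z) \<in> R)"
proof
  assume "computable_rel R"
  then obtain p where p: "eval p [x, y] (if (x, y) \<in> R then 1 else 0)" for x y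
    unfolding computable_rel_def by blast
  then have "eval (Comp p [p_pi1, p_pi2]) [z] (if (pi1 z, pi2 z) \<in> R then 1 else 0)" for z
    by (intro eval_Comp2[OF eval_pi1 eval_pi2])
  then show "cf.dec (\<lambda>z. (pi1 z, pi2 z) \<in> R)"
    unfolding cf.dec_def computable_fun_def by blast
next
  assume "cf.dec (\<lambda>z. (pi1 z, pi2 z) \<in> R)"
  then obtain p where p: "eval p [z] (if (pi1 z, pi2 z) \<in> R then 1 else 0)" for z
    unfolding cf.dec_def computable_fun_def by blast
  then have "eval (Comp p [p_pair]) [x, y] (if (x, y) \<in> R then 1 else 0)" for x y
    using eval_Comp1[OF eval_pair p, of x y] by simp
  then show "computable_rel R" unfolding computable_rel_def by blast
qed

text \<open>\<open>Mu\<close> stops at the value 0, so the search runs through the characteristic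
  function of the negation of \<open>P\<close>. Conversely, determinism of \<open>eval\<close> turns
  the zero found by a halting search into a witness.\<close>

lemma ce_relI:
  assumes P: "cf.dec (\<lambda>z. P (pi1 z) (pi1 (pi2 z)) (pi2 (pi2 z)))"
    and R: "\<And>x y. (x, y) \<in> R \<longleftrightarrow> (\<exists>s. P x y s)"
  shows "ce_rel R"
proof -
  from cf.dec_not[OF P] obtain p
    where p: "eval p [z] (if \<not> P (pi1 z) (pi1 (pi2 z)) (pi2 (pi2 z)) then 1 else 0)" for z
    unfolding cf.dec_def computable_fun_def by blast
  let ?q = "Comp p [Comp p_pair [Proj 1, Comp p_pair [Proj 2, Proj 0]]]"
  have q: "eval ?q [s, x, y] (if \<not> P x y s then 1 else 0)" for s x y
  proof -
    have "eval ?q [s, x, y] (if \<not> P (pi1 (pr x (pr y s))) (pi1 (pi2 (pr x (pr y s))))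
        (pi2 (pi2 (pr x (pr y s)))) then 1 else 0)"
      by (rule eval_Comp1 eval_Comp2 eval_Proj0 eval_Proj1 eval_Proj2 eval_pair p)+
    then show ?thesis by simp
  qed
  have "(\<exists>s. P x y s) \<longleftrightarrow> (\<exists>z. eval (Mu ?q) [x, y] z)" for x y
  proof
    assume ex: "\<exists>s. P x y s"
    let ?s = "LEAST s. P x y s"
    have "P x y ?s" using ex by (rule LeastI_ex)
    then have "eval ?q [?s, x, y] 0" using q[of ?s x y] by simp
    moreover have "\<forall>m<?s. \<exists>w>0. eval ?q [m, x, y] w"
    proof (intro allI impI)
      fix m assume "m < ?s"
      then have "\<not> P x y m" by (rule not_less_Least)
      then show "\<exists>w>0. eval ?q [m, x, y] w" using q[of m x y] by auto
    qed
    ultimately show "\<exists>z. eval (Mu ?q) [x, y] z" by (blast intro: eval_Mu)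
  next
    assume "\<exists>z. eval (Mu ?q) [x, y] z"
    then obtain z where "eval ?q [z, x, y] 0" by (blast elim: eval_MuE)
    from eval_deterministic[OF this q] show "\<exists>s. P x y s" by (auto split: if_splits)
  qed
  then show ?thesis unfolding ce_rel_def using R by metis
qed

subsection \<open>Limit computable functions\<close>

text \<open>By the limit lemma these are the functions computable from the halting problem.\<close>

definition limit_fun :: "(nat \<Rightarrow> nat) \<Rightarrow> bool" where
  "limit_fun f \<longleftrightarrow>
    (\<exists>g. computable_fun (\<lambda>z. g (pi1 z) (pi2 z)) \<and> (\<forall>x. \<forall>\<^sub>F s in sequentially. g s x = f x))"

lemma limit_funI:
  "computable_fun (\<lambda>z. g (pi1 z) (pi2 z)) \<Longrightarrow> (\<And>x. \<forall>\<^sub>F s in sequentially. g s x = f x) \<Longrightarrow> limit_fun f"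
  unfolding limit_fun_def by blast

lemma computable_imp_limit: "computable_fun f \<Longrightarrow> limit_fun f"
  by (rule limit_funI[of "\<lambda>s. f"]) (simp_all add: cf.C_comp[of f] cf.C_pi2 cf.C_id)

interpretation lf: rec_class limit_fun
proof
  show "limit_fun (\<lambda>x. x)" "limit_fun (\<lambda>x. k)" for k
    by (simp_all add: computable_imp_limit cf.C_id cf.C_const)
  have comp1: "limit_fun (\<lambda>x. h (f x))" if fh: "limit_fun f" "computable_fun h" for f h
  proof -
    obtain g where g: "computable_fun (\<lambda>z. g (pi1 z) (pi2 z))" "\<forall>x. \<forall>\<^sub>F s in sequentially. g s x = f x"
      using fh(1) unfolding limit_fun_def by blast
    show ?thesis
    proof (rule limit_funI[of "\<lambda>s x. h (g s x)"])
      show "computable_fun (\<lambda>z. h (g (pi1 z) (pi2 z)))" by (rule cf.C_comp[OF fh(2) g(1)])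
      show "\<forall>\<^sub>F s in sequentially. h (g s x) = h (f x)" for x
        using g(2)[rule_format, of x] by eventually_elim simp
    qed
  qed
  show "limit_fun (\<lambda>x. Suc (f x))" "limit_fun (\<lambda>x. pi1 (f x))" "limit_fun (\<lambda>x. pi2 (f x))"
    if "limit_fun f" for f
    by (rule comp1[OF that]; intro cf.dec_rules)+
  show "limit_fun (\<lambda>x. pr (f x) (g x))" if fg: "limit_fun f" "limit_fun g" for f g
  proof -
    obtain f' where f': "computable_fun (\<lambda>z. f' (pi1 z) (pi2 z))" "\<forall>x. \<forall>\<^sub>F s in sequentially. f' s x = f x"
      using fg(1) unfolding limit_fun_def by blast
    obtain g' where g': "computable_fun (\<lambda>z. g' (pi1 z) (pi2 z))" "\<forall>x. \<forall>\<^sub>F s in sequentially. g' s x = g x"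
      using fg(2) unfolding limit_fun_def by blast
    show ?thesis
    proof (rule limit_funI[of "\<lambda>s x. pr (f' s x) (g' s x)"])
      show "computable_fun (\<lambda>z. pr (f' (pi1 z) (pi2 z)) (g' (pi1 z) (pi2 z)))"
        by (rule cf.C_pr[OF f'(1) g'(1)])
      show "\<forall>\<^sub>F s in sequentially. pr (f' s x) (g' s x) = pr (f x) (g x)" for x
        using f'(2)[rule_format, of x] g'(2)[rule_format, of x] by eventually_elim simp
    qed
  qed
  show "limit_fun (\<lambda>x. f (g x))" if fg: "limit_fun f" "limit_fun g" for f g
  proof -
    obtain f' where f': "computable_fun (\<lambda>z. f' (pi1 z) (pi2 z))" "\<forall>x. \<forall>\<^sub>F s in sequentially. f' s x = f x"
      using fg(1) unfolding limit_fun_def by blast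
    obtain g' where g': "computable_fun (\<lambda>z. g' (pi1 z) (pi2 z))" "\<forall>x. \<forall>\<^sub>F s in sequentially. g' s x = g x"
      using fg(2) unfolding limit_fun_def by blast
    have "computable_fun (\<lambda>z. f' (pi1 z) (g' (pi1 z) (pi2 z)))"
      by (rule cf.C_comp2[OF f'(1)]) (intro cf.dec_rules g')+
    moreover have "\<forall>\<^sub>F s in sequentially. f' s (g' s x) = f (g x)" for x
      using f'(2)[rule_format, of "g x"] g'(2)[rule_format, of x] by eventually_elim simp
    ultimately show ?thesis by (rule limit_funI[of "\<lambda>s x. f' s (g' s x)"])
  qed
  show "limit_fun (\<lambda>z. rec_nat (g (pi2 z)) (\<lambda>n r. h (pr n (pr r (pi2 z)))) (pi1 z))"
    if gh: "limit_fun g" "limit_fun h" for g h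
  proof -
    obtain g' where g': "computable_fun (\<lambda>z. g' (pi1 z) (pi2 z))" "\<forall>x. \<forall>\<^sub>F s in sequentially. g' s x = g x"
      using gh(1) unfolding limit_fun_def by blast
    obtain h' where h': "computable_fun (\<lambda>z. h' (pi1 z) (pi2 z))" "\<forall>x. \<forall>\<^sub>F s in sequentially. h' s x = h x"
      using gh(2) unfolding limit_fun_def by blast
    let ?r = "\<lambda>s x. rec_nat (g' s x) (\<lambda>n r. h' s (pr n (pr r x)))"
    have "computable_fun (\<lambda>z. ?r (pi1 z) (pi2 (pi2 z)) (pi1 (pi2 z)))"
      by (intro cf.C_rec' cf.C_comp2[OF g'(1)] cf.C_comp2[OF h'(1)] cf.dec_rules)
    moreover have "\<forall>\<^sub>F s in sequentially. ?r s x n = rec_nat (g x) (\<lambda>n r. h (pr n (pr r x))) n" for x n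
    proof (induction n)
      case (Suc n)
      from Suc h'(2)[rule_format, of "pr n (pr (rec_nat (g x) (\<lambda>n r. h (pr n (pr r x))) n) x)"]
      show ?case by eventually_elim simp
    qed (simp add: g'(2)[rule_format])
    ultimately show ?thesis
      by (intro limit_funI[of "\<lambda>s z. ?r s (pi2 z) (pi1 z)"])
  qed
  show "limit_fun (\<lambda>x. LEAST y. h (pr y x) = 0)"
    if h: "limit_fun h" and ex: "\<And>x. \<exists>y. h (pr y x) = 0" for h
  proof -
    obtain h' where h': "computable_fun (\<lambda>z. h' (pi1 z) (pi2 z))" "\<forall>x. \<forall>\<^sub>F s in sequentially. h' s x = h x"
      using h unfolding limit_fun_def by blast
    \<comment> \<open>The alternative \<open>y = s\<close> makes the search stop at every stage. It
      does no harm in the limit, when \<open>s\<close> exceeds the true least zero and the finitely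
      many values up to that zero have settled.\<close>
    let ?l = "\<lambda>s x. LEAST y. y = s \<or> h' s (pr y x) = 0"
    have "computable_fun (\<lambda>z. ?l (pi1 z) (pi2 z))"
      by (intro cf.C_Least cf.C_comp2[OF h'(1)] cf.dec_rules) auto
    moreover have "\<forall>\<^sub>F s in sequentially. ?l s x = (LEAST y. h (pr y x) = 0)" for x
    proof -
      let ?y = "LEAST y. h (pr y x) = 0"
      have y: "h (pr ?y x) = 0" using ex by (rule LeastI_ex)
      have ny: "h (pr y x) \<noteq> 0" if "y < ?y" for y using not_less_Least[OF that] .
      have "\<forall>\<^sub>F s in sequentially. \<forall>y\<in>{..?y}. h' s (pr y x) = h (pr y x)"
        using h'(2)[rule_format] by (intro eventually_ball_finite) auto
      moreover have "\<forall>\<^sub>F s in sequentially. ?y < s" by (rule eventually_gt_at_top)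
      ultimately show ?thesis
      proof eventually_elim
        case (elim s)
        show ?case
        proof (rule Least_equality)
          show "?y = s \<or> h' s (pr ?y x) = 0" using elim y by simp
          show "?y \<le> z" if "z = s \<or> h' s (pr z x) = 0" for z
          proof (rule ccontr)
            assume "\<not> ?y \<le> z"
            with that elim ny[of z] show False by auto
          qed
        qed
      qed
    qed
    ultimately show ?thesis by (rule limit_funI[of ?l])
  qed
qed

lemma limit_dec_all:
  assumes "cf.dec (\<lambda>z. P (pi1 z) (pi2 z))"
  shows "lf.dec (\<lambda>x. \<forall>y. P x y)"
  unfolding lf.dec_def
proof (rule limit_funI[of "\<lambda>s x. if \<forall>y<s. P x y then 1 else 0"])
  show "computable_fun (\<lambda>z. if \<forall>y<pi1 z. P (pi2 z) y then 1 else 0)"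
    unfolding cf.dec_def[symmetric]
    by (intro cf.dec_rules cf.dec_comp2[OF assms])
  show "\<forall>\<^sub>F s in sequentially. (if \<forall>y<s. P x y then 1 else 0) = (if \<forall>y. P x y then 1 else (0::nat))" for x
  proof (cases "\<forall>y. P x y")
    case False
    then obtain y where "\<not> P x y" by blast
    then show ?thesis by (intro eventually_mono[OF eventually_gt_at_top[of y]]) auto
  qed simp
qed

lemma computable_dec_imp_limit: "cf.dec P \<Longrightarrow> lf.dec P"
  unfolding cf.dec_def lf.dec_def by (rule computable_imp_limit)

subsection \<open>Linear orders with long finite runs\<close>

text \<open>
  Linear orders on the naturals are given by injective rank functions into the reals; every
  countable linear order has one.
\<close>

definition cint :: "(nat \<Rightarrow> real) \<Rightarrow> nat \<Rightarrow> nat \<Rightarrow> nat set" where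
  "cint r x y = {z. r x \<le> r z \<and> r z \<le> r y \<or> r y \<le> r z \<and> r z \<le> r x}"

definition blk :: "(nat \<Rightarrow> real) \<Rightarrow> nat \<Rightarrow> nat \<Rightarrow> bool" where
  "blk r x y \<longleftrightarrow> finite (cint r x y)"

text \<open>The clause on \<open>cint\<close> makes \<open>S\<close> convex, so that a finite
  \<open>S\<close> lies in a single block: a run of at least \<open>k\<close> elements in a block
  strictly between those of \<open>x\<close> and \<open>y\<close>. Already \<open>k = 1\<close>
  gives density of the blocks.\<close>

definition rich :: "(nat \<Rightarrow> real) \<Rightarrow> bool" where
  "rich r \<longleftrightarrow> (\<forall>x y k. r x < r y \<longrightarrow> \<not> blk r x y \<longrightarrow> (\<exists>S. finite S \<and> k \<le> card S \<and>
    (\<forall>s\<in>S. r x < r s \<and> r s < r y \<and> \<not> blk r x s \<and> \<not> blk r s y) \<and> (\<forall>s\<in>S. \<forall>s'\<in>S. cint r s s' \<subseteq> S)))"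

lemma in_cint_iff: "z \<in> cint r x y \<longleftrightarrow> r x \<le> r z \<and> r z \<le> r y \<or> r y \<le> r z \<and> r z \<le> r x"
  by (simp add: cint_def)

lemma cint_commute: "cint r x y = cint r y x"
  by (auto simp: cint_def)

lemma in_cint [simp]: "x \<in> cint r x y" "y \<in> cint r x y"
  by (auto simp: cint_def)

lemma cint_trans: "cint r x z \<subseteq> cint r x y \<union> cint r y z"
  by (auto simp: cint_def)

lemma cint_mono: "z \<in> cint r x y \<Longrightarrow> cint r x z \<subseteq> cint r x y"
  by (auto simp: cint_def)

lemma blk_commute: "blk r x y \<longleftrightarrow> blk r y x"
  by (simp only: blk_def cint_commute[of r x y])

lemma blk_trans: "blk r x y \<Longrightarrow> blk r y z \<Longrightarrow> blk r x z"
  unfolding blk_def by (rule finite_subset[OF cint_trans]) simp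

lemma blk_mono: "blk r x y \<Longrightarrow> z \<in> cint r x y \<Longrightarrow> blk r x z"
  unfolding blk_def by (rule finite_subset[OF cint_mono])

locale ranked =
  fixes r :: "nat \<Rightarrow> real"
  assumes inj: "inj r"
begin

text \<open>At each stage this is an equivalence relation with convex classes, and it increases with
  \<open>t\<close> to the block relation. The disjunct \<open>x = y\<close> provides reflexivity for
  elements that are not below \<open>t\<close>.\<close>

definition E :: "nat \<Rightarrow> nat \<Rightarrow> nat \<Rightarrow> bool" where
  "E t x y \<longleftrightarrow> x = y \<or> cint r x y \<subseteq> {..<t}"

lemma r_eq [simp]: "r x = r y \<longleftrightarrow> x = y"
  using inj by (auto dest: injD)

lemma cint_self [simp]: "cint r x x = {x}"
proof -
  have "z \<in> cint r x x \<longleftrightarrow> z = x" for z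
    unfolding in_cint_iff using r_eq[of z x] by linarith
  then show ?thesis by blast
qed

lemma blk_refl [simp]: "blk r x x"
  by (simp add: blk_def)

lemma E_refl [simp]: "E t x x"
  by (simp add: E_def)

lemma E_commute: "E t x y \<longleftrightarrow> E t y x"
  unfolding E_def cint_commute[of r y x] by blast

lemma E_trans: "E t x y \<Longrightarrow> E t y z \<Longrightarrow> E t x z"
  unfolding E_def using cint_trans[of r x z y] by blast

lemma E_cint: "E t x y \<Longrightarrow> z \<in> cint r x y \<Longrightarrow> E t x z"
  unfolding E_def using cint_mono[of z r x y] by (cases "x = y") auto

lemma E_mono: "E t x y \<Longrightarrow> t \<le> t' \<Longrightarrow> E t' x y"
  unfolding E_def by auto

lemma E_imp_blk: "E t x y \<Longrightarrow> blk r x y"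
  by (cases "x = y") (simp_all add: E_def blk_def finite_subset[OF _ finite_lessThan])

lemma blk_imp_E: "blk r x y \<Longrightarrow> \<exists>t. E t x y"
  unfolding E_def blk_def finite_nat_set_iff_bounded by blast

text \<open>Makes quantifiers bounded by \<open>t\<close> exhaustive on intervals that are seen to
  lie in one block at stage \<open>t\<close>; this is how convexity of images becomes a decidable
  condition.\<close>

lemma E_less: "E t x y \<Longrightarrow> z \<in> cint r x y \<Longrightarrow> x \<noteq> y \<Longrightarrow> z < t"
  unfolding E_def by auto

end

subsection \<open>A limit computable copy with limit computable blocks\<close>

text \<open>
  A state codes the number \<open>sm\<close> of elements of the copy created so far with their labels \<open>sv\<close> and
  class representatives \<open>sc\<close>, the number \<open>sn\<close> of matched classes, listed by \<open>sq\<close> in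
  decreasing priority, and the map \<open>sf\<close> into the given order, which is meaningful on matched
  classes only.
\<close>

definition "sm \<sigma> = nthc \<sigma> 0"
definition "sn \<sigma> = nthc \<sigma> 1"
definition "sv \<sigma> d = nthc (nthc \<sigma> 2) d"
definition "sc \<sigma> d = nthc (nthc \<sigma> 3) d"
definition "sq \<sigma> i = nthc (nthc \<sigma> 4) i"
definition "sf \<sigma> d = nthc (nthc \<sigma> 5) d"

lemma ex_state:
  "\<exists>\<sigma>. sm \<sigma> = m \<and> sn \<sigma> = n \<and> (\<forall>d<N. sv \<sigma> d = v d \<and> sc \<sigma> d = c d \<and> sq \<sigma> d = q d \<and> sf \<sigma> d = f d)"
proof -
  obtain v' where v': "\<forall>d<N. nthc v' d = v d" using ex_nthc[of N v] by blast
  obtain c' where c': "\<forall>d<N. nthc c' d = c d" using ex_nthc[of N c] by blast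
  obtain q' where q': "\<forall>d<N. nthc q' d = q d" using ex_nthc[of N q] by blast
  obtain f' where f': "\<forall>d<N. nthc f' d = f d" using ex_nthc[of N f] by blast
  let ?\<sigma> = "pr m (pr n (pr v' (pr c' (pr q' (pr f' 0)))))"
  have "sm ?\<sigma> = m" "sn ?\<sigma> = n" "\<forall>d<N. sv ?\<sigma> d = v d" "\<forall>d<N. sc ?\<sigma> d = c d"
      "\<forall>d<N. sq ?\<sigma> d = q d" "\<forall>d<N. sf ?\<sigma> d = f d"
    using v' c' q' f' by (simp_all add: sm_def sn_def sv_def sc_def sq_def sf_def)
  then show ?thesis by blast
qed

text \<open>\<open>C\<close> will be the class of limit computable functions, where
  \<open>E\<close>, a universal statement over a computable order, is decidable. Since
  \<open>a0\<close> and \<open>b0\<close> are the ends and lie in different blocks, the first two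
  classes never come into conflict.\<close>

locale unfold_classes = rec_class C + ranked r
  for C and r :: "nat \<Rightarrow> real" +
  fixes a0 b0 :: nat
  assumes dec_lt: "dec (\<lambda>z. r (pi1 z) < r (pi2 z))"
    and dec_E: "dec (\<lambda>z. E (pi1 z) (pi1 (pi2 z)) (pi2 (pi2 z)))"
    and first: "r a0 \<le> r x" and last: "r x \<le> r b0"
    and ends: "\<not> blk r a0 b0"
    and rich: "rich r"
begin

lemma dec_lt': "C f \<Longrightarrow> C g \<Longrightarrow> dec (\<lambda>x. r (f x) < r (g x))"
  using dec_comp2[of "\<lambda>x y. r x < r y", OF dec_lt] .

lemma dec_E': "C f \<Longrightarrow> C g \<Longrightarrow> C h \<Longrightarrow> dec (\<lambda>x. E (f x) (g x) (h x))"
  by (rule dec_comp3[OF dec_E])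

text \<open>The number \<open>k\<close> cuts the priority list. For elements outside of its first
  \<open>k\<close> classes the value of \<open>sf\<close> is a leftover of an injured
  matching.\<close>

definition mt :: "nat \<Rightarrow> nat \<Rightarrow> nat \<Rightarrow> bool" where
  "mt \<sigma> k d \<longleftrightarrow> d < sm \<sigma> \<and> (\<exists>i<k. sc \<sigma> d = sq \<sigma> i)"

definition valid :: "nat \<Rightarrow> nat \<Rightarrow> nat \<Rightarrow> bool" where
  "valid t \<sigma> k \<longleftrightarrow> (\<forall>j<k. \<forall>i<j. \<not> E t (sf \<sigma> (sq \<sigma> i)) (sf \<sigma> (sq \<sigma> j)))"

text \<open>The first class whose image is seen to have merged with that of a class of higher
  priority is injured, together with all classes after it. This is the position of that
  class.\<close>

definition kept :: "nat \<Rightarrow> nat \<Rightarrow> nat" where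
  "kept t \<sigma> = (LEAST k. k = sn \<sigma> \<or> \<not> valid t \<sigma> (Suc k))"

definition missing :: "nat \<Rightarrow> nat \<Rightarrow> nat" where
  "missing \<sigma> k = (LEAST e. \<forall>d<sm \<sigma>. mt \<sigma> k d \<longrightarrow> sf \<sigma> d \<noteq> e)"

text \<open>The default \<open>sm \<sigma>\<close> signals that no class waits for an image.\<close>

definition idle :: "nat \<Rightarrow> nat \<Rightarrow> nat" where
  "idle \<sigma> k = (LEAST p. p = sm \<sigma> \<or> sc \<sigma> p = p \<and> \<not> mt \<sigma> k p)"

text \<open>
  A class that has lost its image is moved between the components of the least \<open>z\<close> that looks like
  a gap. Choosing the gap before a large enough run has appeared in it is essential: once the least
  code of a true gap is reached the class is never displaced again, whereas a search for a run
  alone could be misled forever by runs that merge after the class has grown.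
\<close>

definition gap :: "nat \<Rightarrow> nat \<Rightarrow> nat \<Rightarrow> nat \<Rightarrow> nat \<Rightarrow> bool" where
  "gap t \<sigma> k p z \<longleftrightarrow> r (pi1 z) < r (pi2 z) \<and> \<not> E t (pi1 z) (pi2 z) \<and>
    (\<forall>d<sm \<sigma>. mt \<sigma> k d \<longrightarrow>
      (vl (sv \<sigma> d) < vl (sv \<sigma> p) \<longrightarrow> r (sf \<sigma> d) < r (pi1 z) \<and> \<not> E t (sf \<sigma> d) (pi1 z)) \<and>
      (vl (sv \<sigma> p) < vl (sv \<sigma> d) \<longrightarrow> r (pi2 z) < r (sf \<sigma> d) \<and> \<not> E t (pi2 z) (sf \<sigma> d)))"

text \<open>The alternative \<open>z = t\<close> bounds the search; the value \<open>t\<close>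
  signals failure.\<close>

definition target :: "nat \<Rightarrow> nat \<Rightarrow> nat \<Rightarrow> nat \<Rightarrow> nat" where
  "target t \<sigma> k p = (LEAST z. z = t \<or> gap t \<sigma> k p z)"

text \<open>The conditions on a new image of the whole class \<open>p\<close>. Given the clause
  \<open>E t\<close>, the bound \<open>y < t\<close> loses nothing in the test of convexity.\<close>

definition fits :: "nat \<Rightarrow> nat \<Rightarrow> nat \<Rightarrow> nat \<Rightarrow> (nat \<Rightarrow> nat) \<Rightarrow> bool" where
  "fits t \<sigma> p z F \<longleftrightarrow> (\<forall>d<sm \<sigma>. sc \<sigma> d = p \<longrightarrow>
    \<not> r (F d) < r (pi1 z) \<and> \<not> r (pi2 z) < r (F d) \<and>
    (\<forall>d'<sm \<sigma>. sc \<sigma> d' = p \<longrightarrow> E t (F d) (F d') \<and>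
      (vl (sv \<sigma> d) < vl (sv \<sigma> d') \<longrightarrow> r (F d) < r (F d')) \<and>
      (\<forall>y<t. r (F d) < r y \<and> r y < r (F d') \<longrightarrow> (\<exists>d''<sm \<sigma>. sc \<sigma> d'' = p \<and> F d'' = y))))"

text \<open>With \<open>c = sm \<sigma>\<close> a new singleton class is meant, and the last clause
  is then vacuous. The clause against splitting concerns unmatched classes too: they have to stay
  convex in order to be moved as a whole.\<close>

definition place :: "nat \<Rightarrow> nat \<Rightarrow> nat \<Rightarrow> nat \<Rightarrow> nat \<Rightarrow> bool" where
  "place \<sigma> k c x y \<longleftrightarrow>
    (\<forall>d<sm \<sigma>. vl (sv \<sigma> d) \<noteq> vl x \<and>
      (mt \<sigma> k d \<longrightarrow> (vl (sv \<sigma> d) < vl x \<longrightarrow> r (sf \<sigma> d) < r y) \<and> (vl x < vl (sv \<sigma> d) \<longrightarrow> r y < r (sf \<sigma> d)))) \<and>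
    (\<forall>i<sm \<sigma>. \<forall>j<sm \<sigma>. sc \<sigma> i = sc \<sigma> j \<longrightarrow> \<not> (vl (sv \<sigma> i) < vl x \<and> vl x < vl (sv \<sigma> j))) \<and>
    (\<forall>l<sm \<sigma>. \<forall>j<sm \<sigma>. sc \<sigma> j = c \<longrightarrow>
      vl (sv \<sigma> j) < vl (sv \<sigma> l) \<and> vl (sv \<sigma> l) < vl x \<or> vl x < vl (sv \<sigma> l) \<and> vl (sv \<sigma> l) < vl (sv \<sigma> j)
      \<longrightarrow> sc \<sigma> l = c)"

text \<open>\<open>y\<close> is the next element on the way from the image of the class towards the
  missing element. Since a class takes in one adjacent element at a time, its image stays convex and
  its members are created outwards.\<close>

definition grows :: "nat \<Rightarrow> nat \<Rightarrow> nat \<Rightarrow> nat \<Rightarrow> nat \<Rightarrow> bool" where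
  "grows t \<sigma> k i y \<longleftrightarrow> E t (missing \<sigma> k) (sf \<sigma> (sq \<sigma> i)) \<and>
    E t y (sf \<sigma> (sq \<sigma> i)) \<and> (\<forall>d<sm \<sigma>. mt \<sigma> k d \<longrightarrow> sf \<sigma> d \<noteq> y) \<and>
    (r (sf \<sigma> (sq \<sigma> i)) < r y \<and> \<not> r (missing \<sigma> k) < r y \<or> r y < r (sf \<sigma> (sq \<sigma> i)) \<and> \<not> r y < r (missing \<sigma> k)) \<and>
    (\<forall>d<sm \<sigma>. sc \<sigma> d = sq \<sigma> i \<longrightarrow> (\<forall>x<t. r (sf \<sigma> d) < r x \<and> r x < r y \<or> r y < r x \<and> r x < r (sf \<sigma> d) \<longrightarrow>
      (\<exists>d'<sm \<sigma>. sc \<sigma> d' = sq \<sigma> i \<and> sf \<sigma> d' = x)))"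

text \<open>Of the possible successors \<open>least_run\<close> will take the least one. A missing
  element seen in the block of a kept class has precedence, since only that class can cover it.
  Otherwise \<open>missing\<close> and \<open>idle\<close> are compared, and the smaller number is
  served, in case of equality the missing element. The last branch waits until a run has appeared
  whose embedding has a code below \<open>t\<close>.\<close>

definition step :: "nat \<Rightarrow> nat \<Rightarrow> nat \<Rightarrow> bool" where
  "step t \<sigma> \<sigma>' \<longleftrightarrow>
    (\<forall>d<sm \<sigma>. sv \<sigma>' d = sv \<sigma> d \<and> sc \<sigma>' d = sc \<sigma> d \<and>
      (mt \<sigma> (kept t \<sigma>) d \<longrightarrow> sf \<sigma>' d = sf \<sigma> d)) \<and>
    (\<forall>i<kept t \<sigma>. sq \<sigma>' i = sq \<sigma> i) \<and>
    (if \<exists>i<kept t \<sigma>. E t (missing \<sigma> (kept t \<sigma>)) (sf \<sigma> (sq \<sigma> i))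
     then sn \<sigma>' = kept t \<sigma> \<and> sm \<sigma>' = Suc (sm \<sigma>) \<and>
       (\<exists>i<kept t \<sigma>. sc \<sigma>' (sm \<sigma>) = sq \<sigma> i \<and> grows t \<sigma> (kept t \<sigma>) i (sf \<sigma>' (sm \<sigma>)) \<and>
         place \<sigma> (kept t \<sigma>) (sq \<sigma> i) (sv \<sigma>' (sm \<sigma>)) (sf \<sigma>' (sm \<sigma>)))
     else if idle \<sigma> (kept t \<sigma>) = sm \<sigma> \<or> missing \<sigma> (kept t \<sigma>) \<le> idle \<sigma> (kept t \<sigma>)
     then sn \<sigma>' = Suc (kept t \<sigma>) \<and> sm \<sigma>' = Suc (sm \<sigma>) \<and> sq \<sigma>' (kept t \<sigma>) = sm \<sigma> \<and>
       sc \<sigma>' (sm \<sigma>) = sm \<sigma> \<and> sf \<sigma>' (sm \<sigma>) = missing \<sigma> (kept t \<sigma>) \<and>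
       place \<sigma> (kept t \<sigma>) (sm \<sigma>) (sv \<sigma>' (sm \<sigma>)) (sf \<sigma>' (sm \<sigma>))
     else if target t \<sigma> (kept t \<sigma>) (idle \<sigma> (kept t \<sigma>)) < t \<and>
       (\<exists>F<t. fits t \<sigma> (idle \<sigma> (kept t \<sigma>)) (target t \<sigma> (kept t \<sigma>) (idle \<sigma> (kept t \<sigma>))) (nthc F))
     then sn \<sigma>' = Suc (kept t \<sigma>) \<and> sm \<sigma>' = sm \<sigma> \<and> sq \<sigma>' (kept t \<sigma>) = idle \<sigma> (kept t \<sigma>) \<and>
       fits t \<sigma> (idle \<sigma> (kept t \<sigma>)) (target t \<sigma> (kept t \<sigma>) (idle \<sigma> (kept t \<sigma>))) (sf \<sigma>')
     else sn \<sigma>' = kept t \<sigma> \<and> sm \<sigma>' = sm \<sigma>)"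

lemma C_sel: "C f \<Longrightarrow> C (\<lambda>x. sm (f x))" "C f \<Longrightarrow> C (\<lambda>x. sn (f x))"
  "C f \<Longrightarrow> C g \<Longrightarrow> C (\<lambda>x. sv (f x) (g x))" "C f \<Longrightarrow> C g \<Longrightarrow> C (\<lambda>x. sc (f x) (g x))"
  "C f \<Longrightarrow> C g \<Longrightarrow> C (\<lambda>x. sq (f x) (g x))" "C f \<Longrightarrow> C g \<Longrightarrow> C (\<lambda>x. sf (f x) (g x))"
  unfolding sm_def sn_def sv_def sc_def sq_def sf_def by (intro dec_rules; assumption)+

lemmas dec_rules1 = C_sel dec_lt' dec_E' dec_rules

lemma dec_mt: "C f \<Longrightarrow> C g \<Longrightarrow> C h \<Longrightarrow> dec (\<lambda>x. mt (f x) (g x) (h x))"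
  by (rule dec_comp3) (unfold mt_def, intro dec_rules1)

lemma dec_valid: "C f \<Longrightarrow> C g \<Longrightarrow> C h \<Longrightarrow> dec (\<lambda>x. valid (f x) (g x) (h x))"
  by (rule dec_comp3) (unfold valid_def, intro dec_rules1)

lemma C_kept: "C f \<Longrightarrow> C g \<Longrightarrow> C (\<lambda>x. kept (f x) (g x))"
  by (rule C_comp2[of kept]) (unfold kept_def, intro C_Least dec_rules1 dec_valid, auto)

lemma ex_missing: "\<exists>e. \<forall>d<sm \<sigma>. mt \<sigma> k d \<longrightarrow> sf \<sigma> d \<noteq> e"
proof -
  obtain e where "e \<notin> sf \<sigma> ` {..<sm \<sigma>}"
    using ex_new_if_finite[OF infinite_UNIV_nat finite_imageI[OF finite_lessThan]] by blast
  then have "sf \<sigma> d \<noteq> e" if "d < sm \<sigma>" for d using that by (auto simp: image_iff)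
  then show ?thesis by blast
qed

lemma C_missing: "C f \<Longrightarrow> C g \<Longrightarrow> C (\<lambda>x. missing (f x) (g x))"
  by (rule C_comp2[of missing]) (unfold missing_def, intro C_Least ex_missing dec_rules1 dec_mt)

lemma C_idle: "C f \<Longrightarrow> C g \<Longrightarrow> C (\<lambda>x. idle (f x) (g x))"
  by (rule C_comp2[of idle]) (unfold idle_def, intro C_Least dec_rules1 dec_mt, auto)

lemma C_target: "C f \<Longrightarrow> C g \<Longrightarrow> C h \<Longrightarrow> C k \<Longrightarrow> C (\<lambda>x. target (f x) (g x) (h x) (k x))"
  by (rule C_comp4[of target]) (unfold target_def gap_def, intro C_Least dec_rules1 dec_mt, auto)

lemma dec_step: "dec (\<lambda>z. step (pi1 z) (pi1 (pi2 z)) (pi2 (pi2 z)))"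
  unfolding step_def fits_def place_def grows_def
  by (intro dec_rules1 dec_mt C_kept C_missing C_idle C_target)

end

section \<open>The invariant of the first construction\<close>

context unfold_classes
begin

text \<open>The part of the invariant that does not mention the stage. The clause
  \<open>l < max i j\<close> records creation outwards and is handed on to the second construction;
  the final clause says that matched classes have convex images.\<close>

definition sound :: "nat \<Rightarrow> bool" where
  "sound \<sigma> \<longleftrightarrow>
    2 \<le> sm \<sigma> \<and> 2 \<le> sn \<sigma> \<and> sq \<sigma> 0 = 0 \<and> sq \<sigma> 1 = 1 \<and> sf \<sigma> 0 = a0 \<and> sf \<sigma> 1 = b0 \<and>
    (\<forall>d<sm \<sigma>. sc \<sigma> d \<le> d \<and> sc \<sigma> (sc \<sigma> d) = sc \<sigma> d) \<and>
    (\<forall>i<sm \<sigma>. \<forall>j<sm \<sigma>. vl (sv \<sigma> i) = vl (sv \<sigma> j) \<longrightarrow> i = j) \<and>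
    (\<forall>i<sm \<sigma>. \<forall>j<sm \<sigma>. \<forall>l<sm \<sigma>. sc \<sigma> i = sc \<sigma> j \<longrightarrow> vl (sv \<sigma> i) < vl (sv \<sigma> l) \<longrightarrow>
      vl (sv \<sigma> l) < vl (sv \<sigma> j) \<longrightarrow> sc \<sigma> l = sc \<sigma> i \<and> l < max i j) \<and>
    (\<forall>d<sm \<sigma>. vl (sv \<sigma> 0) \<le> vl (sv \<sigma> d) \<and> vl (sv \<sigma> d) \<le> vl (sv \<sigma> 1)) \<and>
    (\<forall>i<sn \<sigma>. sq \<sigma> i < sm \<sigma> \<and> sc \<sigma> (sq \<sigma> i) = sq \<sigma> i) \<and>
    (\<forall>i<sn \<sigma>. \<forall>j<sn \<sigma>. sq \<sigma> i = sq \<sigma> j \<longrightarrow> i = j) \<and>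
    (\<forall>d d'. mt \<sigma> (sn \<sigma>) d \<longrightarrow> mt \<sigma> (sn \<sigma>) d' \<longrightarrow> vl (sv \<sigma> d) < vl (sv \<sigma> d') \<longrightarrow>
      r (sf \<sigma> d) < r (sf \<sigma> d')) \<and>
    (\<forall>d d' y. mt \<sigma> (sn \<sigma>) d \<longrightarrow> mt \<sigma> (sn \<sigma>) d' \<longrightarrow> sc \<sigma> d = sc \<sigma> d' \<longrightarrow>
      r (sf \<sigma> d) < r y \<longrightarrow> r y < r (sf \<sigma> d') \<longrightarrow> (\<exists>d''<sm \<sigma>. sc \<sigma> d'' = sc \<sigma> d \<and> sf \<sigma> d'' = y))"

lemma soundD:
  "sound \<sigma> \<Longrightarrow> 2 \<le> sm \<sigma>"
  "sound \<sigma> \<Longrightarrow> 2 \<le> sn \<sigma>"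
  "sound \<sigma> \<Longrightarrow> sq \<sigma> 0 = 0"
  "sound \<sigma> \<Longrightarrow> sq \<sigma> 1 = 1"
  "sound \<sigma> \<Longrightarrow> sf \<sigma> 0 = a0"
  "sound \<sigma> \<Longrightarrow> sf \<sigma> 1 = b0"
  "sound \<sigma> \<Longrightarrow> \<forall>d<sm \<sigma>. sc \<sigma> d \<le> d \<and> sc \<sigma> (sc \<sigma> d) = sc \<sigma> d"
  "sound \<sigma> \<Longrightarrow> \<forall>i<sm \<sigma>. \<forall>j<sm \<sigma>. vl (sv \<sigma> i) = vl (sv \<sigma> j) \<longrightarrow> i = j"
  "sound \<sigma> \<Longrightarrow> \<forall>i<sm \<sigma>. \<forall>j<sm \<sigma>. \<forall>l<sm \<sigma>. sc \<sigma> i = sc \<sigma> j \<longrightarrow> vl (sv \<sigma> i) < vl (sv \<sigma> l) \<longrightarrow>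
      vl (sv \<sigma> l) < vl (sv \<sigma> j) \<longrightarrow> sc \<sigma> l = sc \<sigma> i \<and> l < max i j"
  "sound \<sigma> \<Longrightarrow> \<forall>d<sm \<sigma>. vl (sv \<sigma> 0) \<le> vl (sv \<sigma> d) \<and> vl (sv \<sigma> d) \<le> vl (sv \<sigma> 1)"
  "sound \<sigma> \<Longrightarrow> \<forall>i<sn \<sigma>. sq \<sigma> i < sm \<sigma> \<and> sc \<sigma> (sq \<sigma> i) = sq \<sigma> i"
  "sound \<sigma> \<Longrightarrow> \<forall>i<sn \<sigma>. \<forall>j<sn \<sigma>. sq \<sigma> i = sq \<sigma> j \<longrightarrow> i = j"
  "sound \<sigma> \<Longrightarrow> \<forall>d d'. mt \<sigma> (sn \<sigma>) d \<longrightarrow> mt \<sigma> (sn \<sigma>) d' \<longrightarrow> vl (sv \<sigma> d) < vl (sv \<sigma> d') \<longrightarrow>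
      r (sf \<sigma> d) < r (sf \<sigma> d')"
  "sound \<sigma> \<Longrightarrow> \<forall>d d' y. mt \<sigma> (sn \<sigma>) d \<longrightarrow> mt \<sigma> (sn \<sigma>) d' \<longrightarrow> sc \<sigma> d = sc \<sigma> d' \<longrightarrow>
      r (sf \<sigma> d) < r y \<longrightarrow> r y < r (sf \<sigma> d') \<longrightarrow> (\<exists>d''<sm \<sigma>. sc \<sigma> d'' = sc \<sigma> d \<and> sf \<sigma> d'' = y)"
  unfolding sound_def by (elim conjE, assumption)+

definition inv :: "nat \<Rightarrow> nat \<Rightarrow> bool" where
  "inv t \<sigma> \<longleftrightarrow> sound \<sigma> \<and>
    (\<forall>d d'. mt \<sigma> (sn \<sigma>) d \<longrightarrow> mt \<sigma> (sn \<sigma>) d' \<longrightarrow> sc \<sigma> d = sc \<sigma> d' \<longrightarrow>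
      E t (sf \<sigma> d) (sf \<sigma> d'))"

lemma inv_mono: "inv t \<sigma> \<Longrightarrow> t \<le> t' \<Longrightarrow> inv t' \<sigma>"
  unfolding inv_def using E_mono by metis

lemma kept_props:
  shows kept_le: "kept t \<sigma> \<le> sn \<sigma>"
    and kept_maximal: "kept t \<sigma> < sn \<sigma> \<Longrightarrow> \<not> valid t \<sigma> (Suc (kept t \<sigma>))"
    and valid_kept: "valid t \<sigma> (kept t \<sigma>)"
proof -
  let ?P = "\<lambda>k. k = sn \<sigma> \<or> \<not> valid t \<sigma> (Suc k)"
  have P: "?P (kept t \<sigma>)" unfolding kept_def by (rule LeastI[of ?P "sn \<sigma>"]) simp
  show "kept t \<sigma> \<le> sn \<sigma>" unfolding kept_def by (rule Least_le) simp
  show "kept t \<sigma> < sn \<sigma> \<Longrightarrow> \<not> valid t \<sigma> (Suc (kept t \<sigma>))" using P by simp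
  show "valid t \<sigma> (kept t \<sigma>)"
  proof (cases "kept t \<sigma>")
    case 0
    then show ?thesis by (simp add: valid_def)
  next
    case (Suc k)
    then have "k < kept t \<sigma>" by simp
    then have "\<not> ?P k" unfolding kept_def by (rule not_less_Least)
    then show ?thesis using Suc by simp
  qed
qed

lemma missingI: "mt \<sigma> k d \<Longrightarrow> sf \<sigma> d \<noteq> missing \<sigma> k"
  using LeastI_ex[OF ex_missing[of \<sigma> k]] unfolding missing_def[symmetric] by (simp add: mt_def)

lemma missing_le: "(\<And>d. mt \<sigma> k d \<Longrightarrow> sf \<sigma> d \<noteq> e) \<Longrightarrow> missing \<sigma> k \<le> e"
  unfolding missing_def by (rule Least_le) blast

lemma idle_props:
  shows idle_le: "idle \<sigma> k \<le> sm \<sigma>"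
    and idleD: "idle \<sigma> k < sm \<sigma> \<Longrightarrow> sc \<sigma> (idle \<sigma> k) = idle \<sigma> k \<and> \<not> mt \<sigma> k (idle \<sigma> k)"
    and idle_least: "sc \<sigma> p = p \<Longrightarrow> \<not> mt \<sigma> k p \<Longrightarrow> idle \<sigma> k \<le> p"
proof -
  let ?P = "\<lambda>p. p = sm \<sigma> \<or> sc \<sigma> p = p \<and> \<not> mt \<sigma> k p"
  have "?P (idle \<sigma> k)" unfolding idle_def by (rule LeastI[of ?P "sm \<sigma>"]) simp
  then show "idle \<sigma> k < sm \<sigma> \<Longrightarrow> sc \<sigma> (idle \<sigma> k) = idle \<sigma> k \<and> \<not> mt \<sigma> k (idle \<sigma> k)" by auto
  show "idle \<sigma> k \<le> sm \<sigma>" "sc \<sigma> p = p \<Longrightarrow> \<not> mt \<sigma> k p \<Longrightarrow> idle \<sigma> k \<le> p"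
    unfolding idle_def by (rule Least_le; simp)+
qed

end

locale unfold_stage = unfold_classes +
  fixes t \<sigma> k :: nat
  assumes inv: "inv t \<sigma>"
    and k: "k = kept t \<sigma>"
begin

abbreviation "m \<equiv> sm \<sigma>"
abbreviation "v d \<equiv> vl (sv \<sigma> d)"
abbreviation "c d \<equiv> sc \<sigma> d"
abbreviation "q i \<equiv> sq \<sigma> i"
abbreviation "f d \<equiv> sf \<sigma> d"
abbreviation "e \<equiv> missing \<sigma> k"
abbreviation "p \<equiv> idle \<sigma> k"

lemma k_le: "k \<le> sn \<sigma>"
  unfolding k by (rule kept_le)

lemma mt_sn: "mt \<sigma> k d \<Longrightarrow> mt \<sigma> (sn \<sigma>) d"
  using k_le unfolding mt_def by (meson order_less_le_trans)

lemma
  shows m2: "2 \<le> m" and n2: "2 \<le> sn \<sigma>" and q01: "q 0 = 0" "q 1 = 1"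
    and f01: "f 0 = a0" "f 1 = b0"
    and c_le: "d < m \<Longrightarrow> c d \<le> d" and c_idem: "d < m \<Longrightarrow> c (c d) = c d"
    and v_inj: "i < m \<Longrightarrow> j < m \<Longrightarrow> v i = v j \<Longrightarrow> i = j"
    and c_convex: "i < m \<Longrightarrow> j < m \<Longrightarrow> l < m \<Longrightarrow> c i = c j \<Longrightarrow> v i < v l \<Longrightarrow> v l < v j \<Longrightarrow> c l = c i"
    and c_outward: "i < m \<Longrightarrow> j < m \<Longrightarrow> l < m \<Longrightarrow> c i = c j \<Longrightarrow> v i < v l \<Longrightarrow> v l < v j \<Longrightarrow> l < max i j"
    and v_ends: "d < m \<Longrightarrow> v 0 \<le> v d" "d < m \<Longrightarrow> v d \<le> v 1"
    and q_less: "i < sn \<sigma> \<Longrightarrow> q i < m" and c_q: "i < sn \<sigma> \<Longrightarrow> c (q i) = q i"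
    and q_inj: "i < sn \<sigma> \<Longrightarrow> j < sn \<sigma> \<Longrightarrow> q i = q j \<Longrightarrow> i = j"
    and f_mono: "mt \<sigma> (sn \<sigma>) d \<Longrightarrow> mt \<sigma> (sn \<sigma>) d' \<Longrightarrow> v d < v d' \<Longrightarrow> r (f d) < r (f d')"
    and f_E: "mt \<sigma> (sn \<sigma>) d \<Longrightarrow> mt \<sigma> (sn \<sigma>) d' \<Longrightarrow> c d = c d' \<Longrightarrow> E t (f d) (f d')"
    and f_convex: "mt \<sigma> (sn \<sigma>) d \<Longrightarrow> mt \<sigma> (sn \<sigma>) d' \<Longrightarrow> c d = c d' \<Longrightarrow>
      r (f d) < r y \<Longrightarrow> r y < r (f d') \<Longrightarrow> \<exists>d''<m. c d'' = c d \<and> f d'' = y"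
proof -
  have S: "sound \<sigma>" using inv unfolding inv_def by blast
  note D = soundD[OF S, rule_format]
  show "2 \<le> m" "2 \<le> sn \<sigma>" "q 0 = 0" "q 1 = 1" "f 0 = a0" "f 1 = b0" by (rule D)+
  show "d < m \<Longrightarrow> c d \<le> d" "d < m \<Longrightarrow> c (c d) = c d" using D(7) by blast+
  show "i < m \<Longrightarrow> j < m \<Longrightarrow> v i = v j \<Longrightarrow> i = j" by (rule D(8))
  show "i < m \<Longrightarrow> j < m \<Longrightarrow> l < m \<Longrightarrow> c i = c j \<Longrightarrow> v i < v l \<Longrightarrow> v l < v j \<Longrightarrow> c l = c i"
    "i < m \<Longrightarrow> j < m \<Longrightarrow> l < m \<Longrightarrow> c i = c j \<Longrightarrow> v i < v l \<Longrightarrow> v l < v j \<Longrightarrow> l < max i j"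
    using D(9) by blast+
  show "d < m \<Longrightarrow> v 0 \<le> v d" "d < m \<Longrightarrow> v d \<le> v 1" using D(10) by blast+
  show "i < sn \<sigma> \<Longrightarrow> q i < m" "i < sn \<sigma> \<Longrightarrow> c (q i) = q i" using D(11) by blast+
  show "i < sn \<sigma> \<Longrightarrow> j < sn \<sigma> \<Longrightarrow> q i = q j \<Longrightarrow> i = j" by (rule D(12))
  show "mt \<sigma> (sn \<sigma>) d \<Longrightarrow> mt \<sigma> (sn \<sigma>) d' \<Longrightarrow> v d < v d' \<Longrightarrow> r (f d) < r (f d')" by (rule D(13))
  show "mt \<sigma> (sn \<sigma>) d \<Longrightarrow> mt \<sigma> (sn \<sigma>) d' \<Longrightarrow> c d = c d' \<Longrightarrow> E t (f d) (f d')"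
    using inv unfolding inv_def by blast
  show "mt \<sigma> (sn \<sigma>) d \<Longrightarrow> mt \<sigma> (sn \<sigma>) d' \<Longrightarrow> c d = c d' \<Longrightarrow>
      r (f d) < r y \<Longrightarrow> r y < r (f d') \<Longrightarrow> \<exists>d''<m. c d'' = c d \<and> f d'' = y" by (rule D(14))
qed

text \<open>A conflict between the first two classes would put \<open>a0\<close> and
  \<open>b0\<close> into one block. Hence the ends are never injured.\<close>

lemma k2: "2 \<le> k"
proof (rule ccontr)
  assume "\<not> 2 \<le> k"
  then have "k < sn \<sigma>" "Suc k \<le> 2" using n2 by simp_all
  then have "\<not> valid t \<sigma> (Suc k)" using kept_maximal unfolding k by blast
  then obtain i j where "i < j" "j < 2" "E t (f (q i)) (f (q j))"
    unfolding valid_def using \<open>Suc k \<le> 2\<close> by (meson order_less_le_trans)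
  then have "E t a0 b0" using q01 f01 by (simp add: less_2_cases_iff)
  then show False using ends E_imp_blk by blast
qed

lemma c_mt: "mt \<sigma> k d \<Longrightarrow> d' < m \<Longrightarrow> c d' = c d \<Longrightarrow> mt \<sigma> k d'"
  unfolding mt_def by auto

lemma mt_less: "mt \<sigma> k d \<Longrightarrow> d < m"
  unfolding mt_def by simp

lemma mt_q: "i < k \<Longrightarrow> mt \<sigma> k (q i)"
  unfolding mt_def using q_less c_q k_le by (meson order_less_le_trans)

lemma mt01: "mt \<sigma> k 0" "mt \<sigma> k 1"
  using mt_q[of 0] mt_q[of 1] k2 q01 by simp_all

lemma f_less_iff: "mt \<sigma> k d \<Longrightarrow> mt \<sigma> k d' \<Longrightarrow> r (f d) < r (f d') \<longleftrightarrow> v d < v d'"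
  using f_mono[OF mt_sn mt_sn, of d d'] f_mono[OF mt_sn mt_sn, of d' d] v_inj[of d d'] mt_less
  by (metis less_asym' linorder_neqE_linordered_idom)

lemma f_inj: "mt \<sigma> k d \<Longrightarrow> mt \<sigma> k d' \<Longrightarrow> f d = f d' \<Longrightarrow> d = d'"
  using f_less_iff[of d d'] f_less_iff[of d' d] v_inj[of d d'] mt_less by fastforce

lemma E_q: "i < k \<Longrightarrow> j < k \<Longrightarrow> E t (f (q i)) (f (q j)) \<Longrightarrow> i = j"
  using valid_kept[of t \<sigma>] unfolding k[symmetric] valid_def
  by (metis E_commute linorder_neqE_nat)

text \<open>\<open>d\<close> is seen in one block with the representative of its own class, hence so
  is \<open>q i\<close>, and two kept representatives with images in one seen block
  coincide.\<close>

lemma E_class: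
  assumes "mt \<sigma> k d" "i < k" "E t (f d) (f (q i))" shows "c d = q i"
proof -
  obtain j where j: "j < k" "c d = q j" using assms(1) mt_def by blast
  have "E t (f d) (f (q j))"
    using f_E[OF mt_sn[OF assms(1)] mt_sn[OF mt_q[OF j(1)]]] c_q j k_le by simp
  then have "E t (f (q i)) (f (q j))" using assms(3) E_trans E_commute by blast
  then show ?thesis using E_q[OF assms(2) j(1)] j(2) by simp
qed

text \<open>A fresh label next to the neighbour of \<open>y\<close> falls into no class, since matched classes have convex images.\<close>

lemma place_right:
  assumes y: "\<And>d. mt \<sigma> k d \<Longrightarrow> f d \<noteq> y"
  obtains d0 x where "mt \<sigma> k d0" "r (f d0) < r y"
    "\<And>d. mt \<sigma> k d \<Longrightarrow> r (f d) < r y \<Longrightarrow> r (f d) \<le> r (f d0)"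
    "place \<sigma> k m x y" "place \<sigma> k (c d0) x y"
proof -
  let ?A = "{d. mt \<sigma> k d \<and> r (f d) < r y}"
  have fin: "finite ?A" using mt_less by (auto intro: finite_subset[of _ "{..<m}"])
  have "r a0 < r y" using first[of y] y[OF mt01(1)] f01 by (metis order_le_less r_eq)
  then have "0 \<in> ?A" using mt01 f01 by simp
  then have "?A \<noteq> {}" by blast
  then obtain d0 where d0: "d0 \<in> ?A" and "Max ((\<lambda>d. r (f d)) ` ?A) = r (f d0)"
    using Max_in[of "(\<lambda>d. r (f d)) ` ?A"] fin by fastforce
  then have d0_max: "r (f d) \<le> r (f d0)" if "mt \<sigma> k d" "r (f d) < r y" for d
    using Max_ge[of "(\<lambda>d. r (f d)) ` ?A" "r (f d)"] fin that by auto
  obtain x where x: "v d0 < vl x" "\<And>l. l < m \<Longrightarrow> v d0 < v l \<Longrightarrow> vl x < v l"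
    using ex_vl_right[of "v ` {..<m}" "v d0"] vl_nonneg by auto
  have x': "v l < vl x \<longleftrightarrow> v l \<le> v d0" "vl x \<noteq> v l" if "l < m" for l
    using x(1) x(2)[OF that] by force+
  have cons: "v d < vl x \<longleftrightarrow> r (f d) < r y" if "mt \<sigma> k d" for d
    using d0_max[OF that] f_less_iff[of d0 d] x'[of d] that d0 mt_less
    by (metis leD leI mem_Collect_eq order_le_less_trans)
  have inside: False if "i < m" "j < m" "c i = c j" "v i < vl x" "vl x < v j" for i j
  proof -
    have d0m: "d0 < m" using d0 mt_less by simp
    have vij: "v i \<le> v d0" "v d0 < v j" using that x' x(1) by auto
    have "c d0 = c j"
    proof (cases "i = d0")
      case False
      then have "v i < v d0" using vij v_inj[OF that(1) d0m] by force
      then show ?thesis using c_convex[OF that(1,2) d0m that(3) _ vij(2)] that(3) by simp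
    qed (use that in simp)
    then have mj: "mt \<sigma> k j" using c_mt[of d0 j] d0 that by simp
    then have "r y < r (f j)" using cons[OF mj] that(5) y[OF mj] by (metis linorder_neqE_linordered_idom order_less_asym r_eq)
    then obtain d'' where "d'' < m" "c d'' = c d0" "f d'' = y"
      using f_convex[OF mt_sn mt_sn, of d0 j y] d0 mj \<open>c d0 = c j\<close> by auto
    then show False using c_mt[of d0 d''] d0 y by auto
  qed
  have pl: "place \<sigma> k a x y" if a: "a = m \<or> a = c d0" for a
    unfolding place_def
  proof (intro conjI allI impI notI)
    fix d assume d: "d < m"
    show "v d = vl x \<Longrightarrow> False" using x'(2)[OF d] by simp
    assume mt: "mt \<sigma> k d"
    show "v d < vl x \<Longrightarrow> r (f d) < r y" using cons[OF mt] by simp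
    show "vl x < v d \<Longrightarrow> r y < r (f d)" using cons[OF mt] y[OF mt]
      by (metis linorder_neqE_linordered_idom order_less_asym r_eq)
  next
    fix i j assume "i < m" "j < m" "c i = c j" "v i < vl x \<and> vl x < v j"
    then show False using inside by blast
  next
    fix l j assume l: "l < m" and j: "j < m" and cj: "c j = a"
      and v: "v j < v l \<and> v l < vl x \<or> vl x < v l \<and> v l < v j"
    have "a \<noteq> m" using c_le[OF j] j cj by simp
    then have a: "a = c d0" using a by simp
    have d0m: "d0 < m" using d0 mt_less by simp
    from v have "v j < v l \<and> v l < vl x" using inside[OF d0m j] cj a x(1) by auto
    then have "v j < v l" "v l \<le> v d0" using x'[OF l] by auto
    then show "c l = a"
      using c_convex[OF j d0m l] v_inj[OF l d0m] cj a by (cases "v l = v d0") auto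
  qed
  show thesis using that[of d0 x] d0 d0_max pl by blast
qed

text \<open>Mirror image of \<open>place_right\<close>. As labels are nonnegative, the room to the
  left of \<open>d0\<close> comes from the first element, whose label is smaller.\<close>

lemma place_left:
  assumes y: "\<And>d. mt \<sigma> k d \<Longrightarrow> f d \<noteq> y"
  obtains d0 x where "mt \<sigma> k d0" "r y < r (f d0)"
    "\<And>d. mt \<sigma> k d \<Longrightarrow> r y < r (f d) \<Longrightarrow> r (f d0) \<le> r (f d)"
    "place \<sigma> k m x y" "place \<sigma> k (c d0) x y"
proof -
  let ?A = "{d. mt \<sigma> k d \<and> r y < r (f d)}"
  have fin: "finite ?A" using mt_less by (auto intro: finite_subset[of _ "{..<m}"])
  have "r y < r b0" using last[of y] y[OF mt01(2)] f01 by (metis order_le_less r_eq)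
  then have "1 \<in> ?A" using mt01 f01 by simp
  then have "?A \<noteq> {}" by blast
  then obtain d0 where d0: "d0 \<in> ?A" and "Min ((\<lambda>d. r (f d)) ` ?A) = r (f d0)"
    using Min_in[of "(\<lambda>d. r (f d)) ` ?A"] fin by fastforce
  then have d0_min: "r (f d0) \<le> r (f d)" if "mt \<sigma> k d" "r y < r (f d)" for d
    using Min_le[of "(\<lambda>d. r (f d)) ` ?A" "r (f d)"] fin that by auto
  have "r (f 0) < r (f d0)" using d0 f01 first[of y] by simp
  then have "v 0 < v d0" using f_less_iff[of 0 d0] d0 mt01 by simp
  then have "0 < v d0" using vl_nonneg[of "sv \<sigma> 0"] by simp
  then obtain x where x: "vl x < v d0" "\<And>l. l < m \<Longrightarrow> v l < v d0 \<Longrightarrow> v l < vl x"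
    using ex_vl_left[of "v ` {..<m}" "v d0"] vl_nonneg by auto
  have x': "vl x < v l \<longleftrightarrow> v d0 \<le> v l" "vl x \<noteq> v l" if "l < m" for l
    using x(1) x(2)[OF that] by force+
  have cons: "vl x < v d \<longleftrightarrow> r y < r (f d)" if "mt \<sigma> k d" for d
    using d0_min[OF that] f_less_iff[of d d0] x'[of d] that d0 mt_less
    by (metis leD leI mem_Collect_eq order_less_le_trans)
  have inside: False if "i < m" "j < m" "c i = c j" "v i < vl x" "vl x < v j" for i j
  proof -
    have d0m: "d0 < m" using d0 mt_less by simp
    have vij: "v i < v d0" "v d0 \<le> v j" using that x' x(1) by auto
    have "c d0 = c i"
    proof (cases "j = d0")
      case False
      then have "v d0 < v j" using vij v_inj[OF that(2) d0m] by force
      then show ?thesis using c_convex[OF that(1,2) d0m that(3) vij(1)] by simp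
    qed (use that in simp)
    then have mi: "mt \<sigma> k i" using c_mt[of d0 i] d0 that by simp
    then have "r (f i) < r y" using cons[OF mi] that(4) y[OF mi] by (metis linorder_neqE_linordered_idom order_less_asym r_eq)
    then obtain d'' where "d'' < m" "c d'' = c i" "f d'' = y"
      using f_convex[OF mt_sn mt_sn, of i d0 y] d0 mi \<open>c d0 = c i\<close> by auto
    then show False using c_mt[of d0 d''] d0 y \<open>c d0 = c i\<close> by auto
  qed
  have pl: "place \<sigma> k a x y" if a: "a = m \<or> a = c d0" for a
    unfolding place_def
  proof (intro conjI allI impI notI)
    fix d assume d: "d < m"
    show "v d = vl x \<Longrightarrow> False" using x'(2)[OF d] by simp
    assume mt: "mt \<sigma> k d"
    show "vl x < v d \<Longrightarrow> r y < r (f d)" using cons[OF mt] by simp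
    show "v d < vl x \<Longrightarrow> r (f d) < r y" using cons[OF mt] y[OF mt]
      by (metis linorder_neqE_linordered_idom order_less_asym r_eq)
  next
    fix i j assume "i < m" "j < m" "c i = c j" "v i < vl x \<and> vl x < v j"
    then show False using inside by blast
  next
    fix l j assume l: "l < m" and j: "j < m" and cj: "c j = a"
      and v: "v j < v l \<and> v l < vl x \<or> vl x < v l \<and> v l < v j"
    have "a \<noteq> m" using c_le[OF j] j cj by simp
    then have a: "a = c d0" using a by simp
    have d0m: "d0 < m" using d0 mt_less by simp
    from v have "vl x < v l \<and> v l < v j" using inside[OF j d0m] cj a x(1) by auto
    then have "v l < v j" "v d0 \<le> v l" using x'[OF l] by auto
    then show "c l = a"
      using c_convex[OF d0m j l] v_inj[OF l d0m] cj a by (cases "v l = v d0") auto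
  qed
  show thesis using that[of d0 x] d0 d0_min pl by blast
qed

end

lemma finite_ex_min:
  fixes g :: "'a \<Rightarrow> real"
  assumes "finite S" "S \<noteq> {}"
  obtains y where "y \<in> S" "\<And>z. z \<in> S \<Longrightarrow> g y \<le> g z"
proof -
  have "Min (g ` S) \<in> g ` S" using assms by simp
  then obtain y where y: "y \<in> S" "g y = Min (g ` S)" by auto
  then show thesis using that[of y] assms by simp
qed

context unfold_classes
begin

lemma fits_cong:
  assumes "\<And>d. d < sm \<sigma> \<Longrightarrow> sc \<sigma> d = p \<Longrightarrow> F d = G d" "fits t \<sigma> p z F"
  shows "fits t \<sigma> p z G"
  unfolding fits_def
proof (intro allI impI conjI)
  fix d assume d: "d < sm \<sigma>" "sc \<sigma> d = p"
  note * = assms(2)[unfolded fits_def, rule_format, OF d]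
  show "\<not> r (G d) < r (pi1 z)" "\<not> r (pi2 z) < r (G d)" using * assms(1)[OF d] by simp_all
  fix d' assume d': "d' < sm \<sigma>" "sc \<sigma> d' = p"
  note ** = *[THEN conjunct2, THEN conjunct2, rule_format, OF d']
  show "E t (G d) (G d')" using ** assms(1)[OF d] assms(1)[OF d'] by simp
  show "r (G d) < r (G d')" if "vl (sv \<sigma> d) < vl (sv \<sigma> d')"
    using ** that assms(1)[OF d] assms(1)[OF d'] by simp
  fix y assume y: "y < t" "r (G d) < r y \<and> r y < r (G d')"
  then obtain d'' where "d'' < sm \<sigma>" "sc \<sigma> d'' = p" "F d'' = y"
    using ** assms(1)[OF d] assms(1)[OF d'] by auto
  then show "\<exists>d''<sm \<sigma>. sc \<sigma> d'' = p \<and> G d'' = y" using assms(1) by auto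
qed

end

section \<open>Steps exist and preserve the invariant\<close>

context unfold_stage
begin

text \<open>Of the uncovered elements between the image of the representative and \<open>e\<close>,
  the one nearest to the representative is taken. The covered neighbour of \<open>y\<close> on that
  side lies in the same interval, hence in the block seen, and so belongs to the class
  \<open>q i\<close>. The new label goes right next to it.\<close>

lemma ex_grow:
  assumes i: "i < k" and Ee: "E t e (f (q i))"
  shows "\<exists>x y. grows t \<sigma> k i y \<and> place \<sigma> k (q i) x y"
proof -
  let ?x = "f (q i)"
  have Ee': "E t ?x e" using Ee E_commute by blast
  have xe: "?x \<noteq> e" using missingI[OF mt_q[OF i]] .
  let ?S = "{y \<in> cint r ?x e. \<forall>d. mt \<sigma> k d \<longrightarrow> f d \<noteq> y}"
  have "finite ?S" using E_imp_blk[OF Ee'] by (simp add: blk_def)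
  moreover have eS: "e \<in> ?S" using missingI by simp
  moreover have sk: "i < sn \<sigma>" using i k_le by simp
  have near: "c d = q i" if "mt \<sigma> k d" "f d \<in> cint r ?x e" for d
    using E_class[OF that(1) i] E_cint[OF Ee' that(2)] E_commute by blast
  have cov: "\<exists>d'<m. c d' = q i \<and> f d' = y" if "y \<in> cint r ?x e" "y \<notin> ?S" for y
    using that near mt_less by blast
  have cmt: "mt \<sigma> k d" if "d < m" "c d = q i" for d
    using c_mt[OF mt_q[OF i] that(1)] that(2) c_q[OF sk] by simp
  have conv: "\<exists>d'<m. c d' = q i \<and> f d' = y"
    if "d < m" "c d = q i" "r (f d) < r y \<and> r y < r ?x \<or> r ?x < r y \<and> r y < r (f d)" for d y
    using that f_convex[OF mt_sn[OF cmt] mt_sn[OF mt_q[OF i]], of d y] c_q[OF sk]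
      f_convex[OF mt_sn[OF mt_q[OF i]] mt_sn[OF cmt], of d y] by auto
  consider "r ?x < r e" | "r e < r ?x" using xe by (metis linorder_neqE_linordered_idom r_eq)
  then show ?thesis
  proof cases
    case 1
    from finite_ex_min[of ?S r] eS \<open>finite ?S\<close>
    obtain y where y: "y \<in> ?S" "\<And>z. z \<in> ?S \<Longrightarrow> r y \<le> r z" by blast
    then have unc: "f d \<noteq> y" if "mt \<sigma> k d" for d using that by blast
    have y': "r ?x < r y" "r y \<le> r e" using y(1) 1 unc[OF mt_q[OF i]]
      by (auto simp: in_cint_iff order_le_less)
    obtain d0 x where d0: "mt \<sigma> k d0" "r (f d0) < r y"
      "\<And>d. mt \<sigma> k d \<Longrightarrow> r (f d) < r y \<Longrightarrow> r (f d) \<le> r (f d0)" and pl: "place \<sigma> k (c d0) x y"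
      using place_right[OF unc] by metis
    have "f d0 \<in> cint r ?x e"
      using d0(2) d0(3)[OF mt_q[OF i] y'(1)] y' by (simp add: in_cint_iff)
    then have cd0: "c d0 = q i" using near[OF d0(1)] by simp
    have "grows t \<sigma> k i y" unfolding grows_def
    proof (intro conjI allI impI)
      show "E t e ?x" by (rule Ee)
      show "E t y ?x" using E_cint[OF Ee'] y(1) E_commute by blast
      show "r ?x < r y \<and> \<not> r e < r y \<or> r y < r ?x \<and> \<not> r y < r e" using y' by simp
      fix d z assume d: "d < m" "c d = q i" and z: "r (f d) < r z \<and> r z < r y \<or> r y < r z \<and> r z < r (f d)"
      have "\<not> r y < r (f d)"
        using conv[OF d, of y] y' unc cmt by blast
      with z have z: "r (f d) < r z" "r z < r y" by auto
      consider "r z < r ?x" | "z = ?x" | "r ?x < r z" by (metis linorder_neqE_linordered_idom r_eq)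
      then show "\<exists>d'<m. c d' = q i \<and> f d' = z"
      proof cases
        case 1
        then show ?thesis using conv[OF d] z by blast
      next
        case 2
        then show ?thesis using q_less[OF sk] c_q[OF sk] by blast
      next
        case 3
        then have "z \<in> cint r ?x e" using z y' by (simp add: in_cint_iff)
        moreover have "z \<notin> ?S" using y(2)[of z] z(2) by auto
        ultimately show ?thesis by (rule cov)
      qed
    qed (use unc in blast)
    then show ?thesis using pl cd0 by metis
  next
    case 2
    from finite_ex_min[of ?S "\<lambda>z. - r z"] eS \<open>finite ?S\<close>
    obtain y where y: "y \<in> ?S" "\<And>z. z \<in> ?S \<Longrightarrow> - r y \<le> - r z" by blast
    then have unc: "f d \<noteq> y" if "mt \<sigma> k d" for d using that by blast
    have y': "r y < r ?x" "r e \<le> r y" using y(1) 2 unc[OF mt_q[OF i]]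
      by (auto simp: in_cint_iff order_le_less)
    obtain d0 x where d0: "mt \<sigma> k d0" "r y < r (f d0)"
      "\<And>d. mt \<sigma> k d \<Longrightarrow> r y < r (f d) \<Longrightarrow> r (f d0) \<le> r (f d)" and pl: "place \<sigma> k (c d0) x y"
      using place_left[OF unc] by metis
    have "f d0 \<in> cint r ?x e"
      using d0(2) d0(3)[OF mt_q[OF i] y'(1)] y' by (simp add: in_cint_iff)
    then have cd0: "c d0 = q i" using near[OF d0(1)] by simp
    have "grows t \<sigma> k i y" unfolding grows_def
    proof (intro conjI allI impI)
      show "E t e ?x" by (rule Ee)
      show "E t y ?x" using E_cint[OF Ee'] y(1) E_commute by blast
      show "r ?x < r y \<and> \<not> r e < r y \<or> r y < r ?x \<and> \<not> r y < r e" using y' by simp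
      fix d z assume d: "d < m" "c d = q i" and z: "r (f d) < r z \<and> r z < r y \<or> r y < r z \<and> r z < r (f d)"
      have "\<not> r (f d) < r y"
        using conv[OF d, of y] y' unc cmt by blast
      with z have z: "r z < r (f d)" "r y < r z" by auto
      consider "r ?x < r z" | "z = ?x" | "r z < r ?x" by (metis linorder_neqE_linordered_idom r_eq)
      then show "\<exists>d'<m. c d' = q i \<and> f d' = z"
      proof cases
        case 1
        then show ?thesis using conv[OF d] z by blast
      next
        case 2
        then show ?thesis using q_less[OF sk] c_q[OF sk] by blast
      next
        case 3
        then have "z \<in> cint r ?x e" using z y' by (simp add: in_cint_iff)
        moreover have "z \<notin> ?S" using y(2)[of z] z(2) by auto
        ultimately show ?thesis by (rule cov)
      qed
    qed (use unc in blast)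
    then show ?thesis using pl cd0 by metis
  qed
qed

lemma mt_not_p: "p < m \<Longrightarrow> mt \<sigma> k d \<Longrightarrow> c d \<noteq> p"
  using idleD[of \<sigma> k] c_mt[of d p] by auto

lemma ex_step: "\<exists>\<sigma>'. step t \<sigma> \<sigma>'"
proof -
  let ?st = "\<lambda>m' n' x cn y qn g \<sigma>'. sm \<sigma>' = m' \<and> sn \<sigma>' = n' \<and>
      (\<forall>d<m. sv \<sigma>' d = sv \<sigma> d \<and> sc \<sigma>' d = sc \<sigma> d \<and> sf \<sigma>' d = g d) \<and>
      (\<forall>i<k. sq \<sigma>' i = sq \<sigma> i) \<and> sv \<sigma>' m = x \<and> sc \<sigma>' m = cn \<and> sf \<sigma>' m = y \<and> sq \<sigma>' k = qn"
  have ex: "\<exists>\<sigma>'. ?st m' n' x cn y qn g \<sigma>'" for m' n' x cn y qn g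
  proof -
    obtain \<sigma>' where "sm \<sigma>' = m' \<and> sn \<sigma>' = n' \<and> (\<forall>d<Suc (m + k).
        sv \<sigma>' d = (if d < m then sv \<sigma> d else x) \<and> sc \<sigma>' d = (if d < m then sc \<sigma> d else cn) \<and>
        sq \<sigma>' d = (if d < k then sq \<sigma> d else qn) \<and> sf \<sigma>' d = (if d < m then g d else y))"
      using ex_state[of m' n' "Suc (m + k)" "\<lambda>d. if d < m then sv \<sigma> d else x"
        "\<lambda>d. if d < m then sc \<sigma> d else cn" "\<lambda>d. if d < k then sq \<sigma> d else qn"
        "\<lambda>d. if d < m then g d else y"] by blast
    then have "?st m' n' x cn y qn g \<sigma>'" by simp
    then show ?thesis ..
  qed
  show ?thesis
  proof (cases "\<exists>i<k. E t e (f (q i))")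
    case True
    then obtain i x y where i: "i < k" "grows t \<sigma> k i y" "place \<sigma> k (q i) x y"
      using ex_grow by blast
    obtain \<sigma>' where "?st (Suc m) k x (q i) y 0 f \<sigma>'" using ex by blast
    then have "step t \<sigma> \<sigma>'" unfolding step_def k[symmetric] using True i by auto
    then show ?thesis ..
  next
    case no_grow: False
    show ?thesis
    proof (cases "p = m \<or> e \<le> p")
      case True
      obtain x where x: "place \<sigma> k m x e" using place_right[OF missingI] by metis
      obtain \<sigma>' where "?st (Suc m) (Suc k) x m e m f \<sigma>'" using ex by blast
      then have "step t \<sigma> \<sigma>'" unfolding step_def k[symmetric] if_not_P[OF no_grow] if_P[OF True]
        using x by simp
      then show ?thesis ..
    next
      case no_fresh: False
      then have pm: "p < m" using idle_le[of \<sigma> k] by simp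
      let ?Q = "target t \<sigma> k p < t \<and> (\<exists>F<t. fits t \<sigma> p (target t \<sigma> k p) (nthc F))"
      show ?thesis
      proof (cases ?Q)
        case True
        then obtain F where F: "fits t \<sigma> p (target t \<sigma> k p) (nthc F)" by blast
        obtain \<sigma>' where \<sigma>': "?st m (Suc k) 0 0 0 p (\<lambda>d. if c d = p then nthc F d else f d) \<sigma>'"
          using ex[of m "Suc k" "\<lambda>d. if c d = p then nthc F d else f d" 0 0 0 p] by blast
        then have "fits t \<sigma> p (target t \<sigma> k p) (sf \<sigma>')"
          by (intro fits_cong[OF _ F]) simp
        then have "step t \<sigma> \<sigma>'"
          unfolding step_def k[symmetric] if_not_P[OF no_grow] if_not_P[OF no_fresh] if_P[OF True]
          using \<sigma>' mt_not_p[OF pm] by simp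
        then show ?thesis ..
      next
        case False
        obtain \<sigma>' where "?st m k 0 0 0 0 f \<sigma>'" using ex by blast
        then have "step t \<sigma> \<sigma>'"
          unfolding step_def k[symmetric] if_not_P[OF no_grow] if_not_P[OF no_fresh] if_not_P[OF False]
          by simp
        then show ?thesis ..
      qed
    qed
  qed
qed

text \<open>Handles growth and new classes together: either \<open>c'\<close> is a kept class and
  the list is cut down to \<open>k\<close>, or \<open>c' = m\<close> is appended to it.\<close>

lemma inv_add:
  assumes old: "\<And>d. d < m \<Longrightarrow> sv \<sigma>' d = sv \<sigma> d \<and> sc \<sigma>' d = sc \<sigma> d \<and> (mt \<sigma> k d \<longrightarrow> sf \<sigma>' d = sf \<sigma> d)"
    and oldq: "\<And>i. i < k \<Longrightarrow> sq \<sigma>' i = sq \<sigma> i"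
    and m': "sm \<sigma>' = Suc m"
    and place: "place \<sigma> k c' (sv \<sigma>' m) y"
    and c': "sc \<sigma>' m = c'" and y: "sf \<sigma>' m = y"
    and unc: "\<And>d. mt \<sigma> k d \<Longrightarrow> f d \<noteq> y"
    and new: "(\<exists>i<k. c' = q i \<and> grows t \<sigma> k i y) \<and> sn \<sigma>' = k \<or>
      c' = m \<and> sn \<sigma>' = Suc k \<and> sq \<sigma>' k = m"
  shows "inv t \<sigma>'"
proof -
  let ?x = "vl (sv \<sigma>' m)"
  have sv': "sv \<sigma>' d = sv \<sigma> d" and sc': "sc \<sigma>' d = sc \<sigma> d" if "d < m" for d using old[OF that] by auto
  have sf': "sf \<sigma>' d = sf \<sigma> d" if "mt \<sigma> k d" for d using old[OF mt_less[OF that]] that by auto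
  have qk: "q i < m" "c (q i) = q i" if "i < k" for i
    using q_less c_q k_le that by (meson order_less_le_trans)+
  have c'_le: "c' \<le> m" using new qk(1) by (auto intro: less_imp_le)
  have c'_idem: "sc \<sigma>' c' = c'" using new qk sc' c' by auto
  have cnm: "c d < m" if "d < m" for d using c_le[OF that] that by simp
  have mt': "mt \<sigma>' (sn \<sigma>') d \<longleftrightarrow> mt \<sigma> k d \<or> d = m" for d
  proof (cases "d < m")
    case True
    from new show ?thesis
    proof
      assume "(\<exists>i<k. c' = q i \<and> grows t \<sigma> k i y) \<and> sn \<sigma>' = k"
      then show ?thesis unfolding mt_def using True oldq sc'[OF True] m' by auto
    next
      assume "c' = m \<and> sn \<sigma>' = Suc k \<and> sq \<sigma>' k = m"
      then show ?thesis unfolding mt_def using True oldq sc'[OF True] m' cnm[OF True]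
        by (auto simp: less_Suc_eq)
    qed
  next
    case False
    then have nm: "\<not> mt \<sigma> k d" using mt_less by blast
    from new have "\<exists>i<sn \<sigma>'. c' = sq \<sigma>' i" using oldq by auto
    then show ?thesis using nm False c' m' unfolding mt_def[of \<sigma>'] by auto
  qed
  note pl = place[unfolded place_def]
  have x_neq: "v d \<noteq> ?x" if "d < m" for d using pl that by blast
  have x_f: "v d < ?x \<Longrightarrow> r (f d) < r y" "?x < v d \<Longrightarrow> r y < r (f d)" if "mt \<sigma> k d" for d
    using pl that mt_less[OF that] by blast+
  have x_in: False if "i < m" "j < m" "c i = c j" "v i < ?x" "?x < v j" for i j
    using pl that by blast
  have x_adj: "c l = c'" if "l < m" "j < m" "c j = c'"
    "v j < v l \<and> v l < ?x \<or> ?x < v l \<and> v l < v j" for l j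
    using pl that by blast
  have growE: "E t y (f d)" if "mt \<sigma> k d" "c d = c'" for d
  proof -
    from that new cnm[OF mt_less[OF that(1)]] obtain i where i: "i < k" "c' = q i" "grows t \<sigma> k i y" by auto
    have "E t (f d) (f (q i))"
      using f_E[OF mt_sn[OF that(1)] mt_sn[OF mt_q[OF i(1)]]] qk(2)[OF i(1)] that i by simp
    moreover have "E t y (f (q i))" using i(3) unfolding grows_def by blast
    ultimately show ?thesis using E_trans E_commute by blast
  qed
  have grow_conv: "\<exists>d'<m. c d' = c' \<and> f d' = z"
    if "mt \<sigma> k d" "c d = c'" "r (f d) < r z \<and> r z < r y \<or> r y < r z \<and> r z < r (f d)" for d z
  proof -
    from that new cnm[OF mt_less[OF that(1)]] obtain i where i: "i < k" "c' = q i" "grows t \<sigma> k i y" by auto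
    have "z < t"
      using E_less[OF growE[OF that(1,2)], of z] that(3) unc[OF that(1)] by (auto simp: in_cint_iff)
    then show ?thesis using i that mt_less[OF that(1)] unfolding grows_def by blast
  qed
  have c'_mt: "mt \<sigma> k d" if "d < m" "c d = c'" for d
  proof -
    from that new cnm[OF that(1)] obtain i where "i < k" "c' = q i" by auto
    then show ?thesis using that unfolding mt_def by auto
  qed
  have "sound \<sigma>'"
    unfolding sound_def m'
  proof (intro conjI allI impI)
    show "2 \<le> Suc m" using m2 by simp
    show "2 \<le> sn \<sigma>'" using new k2 by auto
    show "sq \<sigma>' 0 = 0" "sq \<sigma>' 1 = 1" using oldq q01 k2 by simp_all
    show "sf \<sigma>' 0 = a0" "sf \<sigma>' 1 = b0" using sf' mt01 f01 by simp_all
    fix d assume d: "d < Suc m"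
    show "sc \<sigma>' d \<le> d" using d c_le[of d] c'_le c' sc' by (cases "d = m") auto
    show "sc \<sigma>' (sc \<sigma>' d) = sc \<sigma>' d" using d c_idem[of d] cnm[of d] c'_idem c' sc' by (cases "d = m") auto
    have "v 0 < ?x" using x_f(2)[OF mt01(1)] x_neq[of 0] f01 first[of y] m2 by fastforce
    then show "vl (sv \<sigma>' 0) \<le> vl (sv \<sigma>' d)" using d v_ends(1)[of d] sv' m2 by (cases "d = m") auto
    have "?x < v 1" using x_f(1)[OF mt01(2)] x_neq[of 1] f01 last[of y] m2 by fastforce
    then show "vl (sv \<sigma>' d) \<le> vl (sv \<sigma>' 1)" using d v_ends(2)[of d] sv' m2 by (cases "d = m") auto
  next
    fix i j assume "i < Suc m" "j < Suc m" "vl (sv \<sigma>' i) = vl (sv \<sigma>' j)"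
    then show "i = j" using v_inj[of i j] x_neq[of i] x_neq[of j] sv' by (cases "i = m"; cases "j = m") auto
  next
    fix i j l assume i: "i < Suc m" and j: "j < Suc m" and l: "l < Suc m" and cij: "sc \<sigma>' i = sc \<sigma>' j"
      and il: "vl (sv \<sigma>' i) < vl (sv \<sigma>' l)" and lj: "vl (sv \<sigma>' l) < vl (sv \<sigma>' j)"
    consider "i < m" "j < m" "l < m" | "i < m" "j < m" "l = m" | "i = m" "j < m" "l < m"
      | "i < m" "j = m" "l < m"
      using i j l il lj by (metis less_SucE less_irrefl less_trans)
    then have "sc \<sigma>' l = sc \<sigma>' i \<and> l < max i j"
    proof cases
      case 1
      then show ?thesis using c_convex[of i j l] c_outward[of i j l] cij il lj sv' sc' by simp
    next
      case 2
      then show ?thesis using x_in[of i j] cij il lj sv' sc' by simp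
    next
      case 3
      then have "c l = c'" using x_adj[of l j] cij il lj sv' sc' c' by simp
      then show ?thesis using 3 sc' c' by simp
    next
      case 4
      then have "c l = c'" using x_adj[of l i] cij il lj sv' sc' c' by simp
      then show ?thesis using 4 cij sc' c' by simp
    qed
    then show "sc \<sigma>' l = sc \<sigma>' i" "l < max i j" by auto
  next
    fix i assume i: "i < sn \<sigma>'"
    show "sq \<sigma>' i < Suc m" using new i oldq qk(1) by (auto simp: less_Suc_eq)
    have "c' = m \<Longrightarrow> sc \<sigma>' m = m" using c' by simp
    then show "sc \<sigma>' (sq \<sigma>' i) = sq \<sigma>' i" using new i oldq qk sc' by (auto simp: less_Suc_eq)
  next
    fix i j assume i: "i < sn \<sigma>'" and j: "j < sn \<sigma>'" and eq: "sq \<sigma>' i = sq \<sigma>' j"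
    have inj: "i = j" if "i < k" "j < k"
      using q_inj[of i j] eq that oldq k_le by simp
    have ne: "sq \<sigma>' l \<noteq> m" if "l < k" for l using oldq[OF that] qk(1)[OF that] by simp
    from new show "i = j"
    proof
      assume "(\<exists>i<k. c' = q i \<and> grows t \<sigma> k i y) \<and> sn \<sigma>' = k"
      then show ?thesis using i j inj by simp
    next
      assume "c' = m \<and> sn \<sigma>' = Suc k \<and> sq \<sigma>' k = m"
      then show ?thesis using i j inj ne eq by (metis less_SucE)
    qed
  next
    fix d d' assume "mt \<sigma>' (sn \<sigma>') d" "mt \<sigma>' (sn \<sigma>') d'" "vl (sv \<sigma>' d) < vl (sv \<sigma>' d')"
    then show "r (sf \<sigma>' d) < r (sf \<sigma>' d')"
      unfolding mt' using f_mono[OF mt_sn mt_sn, of d d'] x_f(1)[of d] x_f(2)[of d'] sf' sv' y mt_less by auto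
  next
    fix d d' z assume d: "mt \<sigma>' (sn \<sigma>') d" "mt \<sigma>' (sn \<sigma>') d'" "sc \<sigma>' d = sc \<sigma>' d'"
      and z: "r (sf \<sigma>' d) < r z" "r z < r (sf \<sigma>' d')"
    consider "mt \<sigma> k d" "mt \<sigma> k d'" | "mt \<sigma> k d" "d' = m" | "d = m" "mt \<sigma> k d'"
      using d(1,2) z unfolding mt' by force
    then show "\<exists>d''<Suc m. sc \<sigma>' d'' = sc \<sigma>' d \<and> sf \<sigma>' d'' = z"
    proof cases
      case 1
      then obtain d'' where d'': "d'' < m" "c d'' = c d" "f d'' = z"
        using f_convex[OF mt_sn mt_sn, of d d' z] d z sf' sc' mt_less by auto
      then show ?thesis
        using c_mt[OF 1(1) d''(1,2)] less_SucI[OF d''(1)] 1 sc' sf' mt_less by (intro exI[of _ d'']) simp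
    next
      case 2
      then obtain d'' where d'': "d'' < m" "c d'' = c'" "f d'' = z"
        using grow_conv[of d z] d z sf' sc' c' y mt_less by auto
      then show ?thesis
        using c'_mt[OF d''(1,2)] 2 d c' sc' sf' by (intro exI[of _ d'']) simp
    next
      case 3
      then obtain d'' where d'': "d'' < m" "c d'' = c'" "f d'' = z"
        using grow_conv[of d' z] d z sf' sc' c' y mt_less by auto
      then show ?thesis
        using c'_mt[OF d''(1,2)] 3 d c' sc' sf' by (intro exI[of _ d'']) simp
    qed
  qed
  moreover have "E t (sf \<sigma>' d) (sf \<sigma>' d')"
    if "mt \<sigma>' (sn \<sigma>') d" "mt \<sigma>' (sn \<sigma>') d'" "sc \<sigma>' d = sc \<sigma>' d'" for d d'
    using that unfolding mt' using f_E[OF mt_sn mt_sn, of d d'] growE[of d] growE[of d'] sf' sc' c' y mt_less E_commute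
    by auto
  ultimately show ?thesis unfolding inv_def by blast
qed

lemma gap_target: "target t \<sigma> k p < t \<Longrightarrow> gap t \<sigma> k p (target t \<sigma> k p)"
proof -
  let ?P = "\<lambda>z. z = t \<or> gap t \<sigma> k p z"
  have "?P (target t \<sigma> k p)" unfolding target_def by (rule LeastI[of ?P t]) simp
  then show "target t \<sigma> k p < t \<Longrightarrow> gap t \<sigma> k p (target t \<sigma> k p)" by simp
qed

lemma inv_match:
  assumes old: "\<And>d. d < m \<Longrightarrow> sv \<sigma>' d = sv \<sigma> d \<and> sc \<sigma>' d = sc \<sigma> d \<and> (mt \<sigma> k d \<longrightarrow> sf \<sigma>' d = sf \<sigma> d)"
    and oldq: "\<And>i. i < k \<Longrightarrow> sq \<sigma>' i = sq \<sigma> i"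
    and m': "sm \<sigma>' = m" and n': "sn \<sigma>' = Suc k" and q': "sq \<sigma>' k = p" and pm: "p < m"
    and gap: "gap t \<sigma> k p z" and fits: "fits t \<sigma> p z (sf \<sigma>')"
  shows "inv t \<sigma>'"
proof -
  have sv': "sv \<sigma>' d = sv \<sigma> d" and sc': "sc \<sigma>' d = sc \<sigma> d" if "d < m" for d using old[OF that] by auto
  have sf': "sf \<sigma>' d = sf \<sigma> d" if "mt \<sigma> k d" for d using old[OF mt_less[OF that]] that by auto
  have qk: "q i < m" "c (q i) = q i" if "i < k" for i
    using q_less c_q k_le that by (meson order_less_le_trans)+
  have cnm: "c d < m" if "d < m" for d using c_le[OF that] that by simp
  have cp: "c p = p" "\<not> mt \<sigma> k p" using idleD[OF pm] by auto
  have mt': "mt \<sigma>' (sn \<sigma>') d \<longleftrightarrow> mt \<sigma> k d \<or> d < m \<and> c d = p" for d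
    unfolding mt_def m' n' using sc' oldq q' by (auto simp: less_Suc_eq)
  have sep: "c d \<noteq> p" if "mt \<sigma> k d" for d using mt_not_p[OF pm that] .
  have fitsD: "\<not> r (sf \<sigma>' d) < r (pi1 z)" "\<not> r (pi2 z) < r (sf \<sigma>' d)" if "d < m" "c d = p" for d
    using fits that unfolding fits_def by blast+
  have fitsD2: "E t (sf \<sigma>' d) (sf \<sigma>' d')" "v d < v d' \<Longrightarrow> r (sf \<sigma>' d) < r (sf \<sigma>' d')"
    "y < t \<Longrightarrow> r (sf \<sigma>' d) < r y \<Longrightarrow> r y < r (sf \<sigma>' d') \<Longrightarrow> \<exists>d''<m. c d'' = p \<and> sf \<sigma>' d'' = y"
    if "d < m" "c d = p" "d' < m" "c d' = p" for d d' y
    using fits that unfolding fits_def by blast+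
  have gapD: "v d < v p \<Longrightarrow> r (f d) < r (pi1 z)" "v p < v d \<Longrightarrow> r (pi2 z) < r (f d)"
    if "mt \<sigma> k d" for d
    using gap that mt_less[OF that] unfolding gap_def by blast+
  \<comment> \<open>The condition \<open>gap\<close> compares labels with that of \<open>p\<close>
    only. By convexity of the class, an element outside of it lies on the same side of all its
    members.\<close>
  have side: "v d < v p \<longleftrightarrow> v d < v d'" "v p < v d \<longleftrightarrow> v d' < v d"
    if d: "mt \<sigma> k d" and d': "d' < m" "c d' = p" for d d'
  proof -
    have dm: "d < m" using mt_less[OF d] .
    have "\<not> (v p < v d \<and> v d < v d')" "\<not> (v d' < v d \<and> v d < v p)"
      using c_convex[OF pm d'(1) dm] c_convex[OF d'(1) pm dm] cp d' sep[OF d] by auto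
    moreover have "v d \<noteq> v p" "v d \<noteq> v d'"
      using v_inj[OF dm pm] v_inj[OF dm d'(1)] cp d'(2) sep[OF d] by auto
    ultimately show "v d < v p \<longleftrightarrow> v d < v d'" "v p < v d \<longleftrightarrow> v d' < v d" by auto
  qed
  have "sound \<sigma>'"
    unfolding sound_def m'
  proof (intro conjI allI impI)
    show "2 \<le> m" by (rule m2)
    show "2 \<le> sn \<sigma>'" using n' k2 by auto
    show "sq \<sigma>' 0 = 0" "sq \<sigma>' 1 = 1" using oldq q01 k2 by simp_all
    show "sf \<sigma>' 0 = a0" "sf \<sigma>' 1 = b0" using sf' mt01 f01 by simp_all
    fix d assume d: "d < m"
    show "sc \<sigma>' d \<le> d" using d c_le sc' by simp
    show "sc \<sigma>' (sc \<sigma>' d) = sc \<sigma>' d" using d c_idem cnm sc' by simp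
    show "vl (sv \<sigma>' 0) \<le> vl (sv \<sigma>' d)" using d v_ends(1)[of d] sv' m2 by simp
    show "vl (sv \<sigma>' d) \<le> vl (sv \<sigma>' 1)" using d v_ends(2)[of d] sv' m2 by simp
  next
    fix i j assume "i < m" "j < m" "vl (sv \<sigma>' i) = vl (sv \<sigma>' j)"
    then show "i = j" using v_inj[of i j] sv' by simp
  next
    fix i j l assume "i < m" "j < m" "l < m" "sc \<sigma>' i = sc \<sigma>' j"
      "vl (sv \<sigma>' i) < vl (sv \<sigma>' l)" "vl (sv \<sigma>' l) < vl (sv \<sigma>' j)"
    then show "sc \<sigma>' l = sc \<sigma>' i" "l < max i j"
      using c_convex[of i j l] c_outward[of i j l] sv' sc' by simp_all
  next
    fix i assume i: "i < sn \<sigma>'"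
    show "sq \<sigma>' i < m" "sc \<sigma>' (sq \<sigma>' i) = sq \<sigma>' i"
      using i oldq qk sc' n' q' pm cp by (auto simp: less_Suc_eq)
  next
    fix i j assume i: "i < sn \<sigma>'" and j: "j < sn \<sigma>'" and eq: "sq \<sigma>' i = sq \<sigma>' j"
    have inj: "i = j" if "i < k" "j < k"
      using q_inj[of i j] eq that oldq k_le by simp
    have ne: "sq \<sigma>' l \<noteq> p" if "l < k" for l using oldq[OF that] mt_q[OF that] cp by metis
    show "i = j" using i j inj ne eq n' q' by (metis less_SucE)
  next
    fix d d' assume d: "mt \<sigma>' (sn \<sigma>') d" "mt \<sigma>' (sn \<sigma>') d'" and v: "vl (sv \<sigma>' d) < vl (sv \<sigma>' d')"
    have "v d < v d'" using v d sv' mt_less unfolding mt' by auto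
    from d consider "mt \<sigma> k d" "mt \<sigma> k d'" | "mt \<sigma> k d" "d' < m" "c d' = p"
      | "d < m" "c d = p" "mt \<sigma> k d'" | "d < m" "c d = p" "d' < m" "c d' = p"
      unfolding mt' by blast
    then show "r (sf \<sigma>' d) < r (sf \<sigma>' d')"
    proof cases
      case 1
      then show ?thesis using f_mono[OF mt_sn mt_sn, of d d'] sf' \<open>v d < v d'\<close> by simp
    next
      case 2
      then show ?thesis
        using gapD(1)[OF 2(1)] side(1)[OF 2] fitsD(1)[OF 2(2,3)] sf'[OF 2(1)] \<open>v d < v d'\<close> by simp
    next
      case 3
      then show ?thesis
        using gapD(2)[OF 3(3)] side(2)[OF 3(3,1,2)] fitsD(2)[OF 3(1,2)] sf'[OF 3(3)] \<open>v d < v d'\<close> by simp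
    next
      case 4
      then show ?thesis using fitsD2(2)[OF 4] \<open>v d < v d'\<close> by simp
    qed
  next
    fix d d' y assume d: "mt \<sigma>' (sn \<sigma>') d" "mt \<sigma>' (sn \<sigma>') d'" and cd: "sc \<sigma>' d = sc \<sigma>' d'"
      and y: "r (sf \<sigma>' d) < r y" "r y < r (sf \<sigma>' d')"
    have dm: "d < m" "d' < m" using d mt_less unfolding mt' by auto
    have cd': "c d = c d'" using cd sc' dm by simp
    show "\<exists>d''<m. sc \<sigma>' d'' = sc \<sigma>' d \<and> sf \<sigma>' d'' = y"
    proof (cases "c d = p")
      case True
      have E: "E t (sf \<sigma>' d) (sf \<sigma>' d')" using fitsD2(1)[OF dm(1) True dm(2)] cd' True by simp
      have "sf \<sigma>' d \<noteq> sf \<sigma>' d'" using y by auto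
      then have "y < t" using E_less[OF E, of y] y by (auto simp: in_cint_iff)
      then obtain d'' where "d'' < m" "c d'' = p" "sf \<sigma>' d'' = y"
        using fitsD2(3)[OF dm(1) True dm(2), of y] cd' True y by auto
      then show ?thesis using True sc' dm by (intro exI[of _ d'']) simp
    next
      case False
      then have mt: "mt \<sigma> k d" "mt \<sigma> k d'" using d cd' unfolding mt' by auto
      then obtain d'' where d'': "d'' < m" "c d'' = c d" "f d'' = y"
        using f_convex[OF mt_sn mt_sn, of d d' y] cd' y sf' by auto
      then show ?thesis
        using c_mt[OF mt(1) d''(1,2)] sf' sc' dm by (intro exI[of _ d'']) simp
    qed
  qed
  moreover have "E t (sf \<sigma>' d) (sf \<sigma>' d')"
    if d: "mt \<sigma>' (sn \<sigma>') d" "mt \<sigma>' (sn \<sigma>') d'" and cd: "sc \<sigma>' d = sc \<sigma>' d'" for d d'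
  proof -
    have dm: "d < m" "d' < m" using d mt_less unfolding mt' by auto
    then have cd': "c d = c d'" using cd sc' by simp
    show ?thesis
    proof (cases "c d = p")
      case True
      then show ?thesis using fitsD2(1)[OF dm(1) True dm(2)] cd' by simp
    next
      case False
      then have mt: "mt \<sigma> k d" "mt \<sigma> k d'" using d cd' unfolding mt' by auto
      then show ?thesis using f_E[OF mt_sn mt_sn, of d d'] cd' sf' by simp
    qed
  qed
  ultimately show ?thesis unfolding inv_def by blast
qed

lemma inv_wait:
  assumes old: "\<And>d. d < m \<Longrightarrow> sv \<sigma>' d = sv \<sigma> d \<and> sc \<sigma>' d = sc \<sigma> d \<and> (mt \<sigma> k d \<longrightarrow> sf \<sigma>' d = sf \<sigma> d)"
    and oldq: "\<And>i. i < k \<Longrightarrow> sq \<sigma>' i = sq \<sigma> i"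
    and m': "sm \<sigma>' = m" and n': "sn \<sigma>' = k"
  shows "inv t \<sigma>'"
proof -
  have sv': "sv \<sigma>' d = sv \<sigma> d" and sc': "sc \<sigma>' d = sc \<sigma> d" if "d < m" for d using old[OF that] by auto
  have sf': "sf \<sigma>' d = sf \<sigma> d" if "mt \<sigma> k d" for d using old[OF mt_less[OF that]] that by auto
  have qk: "q i < m" "c (q i) = q i" if "i < k" for i
    using q_less c_q k_le that by (meson order_less_le_trans)+
  have cnm: "c d < m" if "d < m" for d using c_le[OF that] that by simp
  have mt': "mt \<sigma>' (sn \<sigma>') d \<longleftrightarrow> mt \<sigma> k d" for d
    unfolding mt_def m' n' using sc' oldq by auto
  have "sound \<sigma>'"
    unfolding sound_def m' mt'
  proof (intro conjI allI impI)
    show "2 \<le> m" by (rule m2)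
    show "2 \<le> sn \<sigma>'" using n' k2 by auto
    show "sq \<sigma>' 0 = 0" "sq \<sigma>' 1 = 1" using oldq q01 k2 by simp_all
    show "sf \<sigma>' 0 = a0" "sf \<sigma>' 1 = b0" using sf' mt01 f01 by simp_all
    fix d assume d: "d < m"
    show "sc \<sigma>' d \<le> d" using d c_le sc' by simp
    show "sc \<sigma>' (sc \<sigma>' d) = sc \<sigma>' d" using d c_idem cnm sc' by simp
    show "vl (sv \<sigma>' 0) \<le> vl (sv \<sigma>' d)" using d v_ends(1)[of d] sv' m2 by simp
    show "vl (sv \<sigma>' d) \<le> vl (sv \<sigma>' 1)" using d v_ends(2)[of d] sv' m2 by simp
  next
    fix i j assume "i < m" "j < m" "vl (sv \<sigma>' i) = vl (sv \<sigma>' j)"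
    then show "i = j" using v_inj[of i j] sv' by simp
  next
    fix i j l assume "i < m" "j < m" "l < m" "sc \<sigma>' i = sc \<sigma>' j"
      "vl (sv \<sigma>' i) < vl (sv \<sigma>' l)" "vl (sv \<sigma>' l) < vl (sv \<sigma>' j)"
    then show "sc \<sigma>' l = sc \<sigma>' i" "l < max i j"
      using c_convex[of i j l] c_outward[of i j l] sv' sc' by simp_all
  next
    fix i assume i: "i < sn \<sigma>'"
    then show "sq \<sigma>' i < m" "sc \<sigma>' (sq \<sigma>' i) = sq \<sigma>' i"
      using oldq qk sc' n' by auto
  next
    fix i j assume "i < sn \<sigma>'" "j < sn \<sigma>'" "sq \<sigma>' i = sq \<sigma>' j"
    then show "i = j" using q_inj[of i j] oldq k_le n' by simp
  next
    fix d d' assume "mt \<sigma> k d" "mt \<sigma> k d'" "vl (sv \<sigma>' d) < vl (sv \<sigma>' d')"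
    then show "r (sf \<sigma>' d) < r (sf \<sigma>' d')"
      using f_mono[OF mt_sn mt_sn, of d d'] sf' sv' mt_less by simp
  next
    fix d d' y assume d: "mt \<sigma> k d" "mt \<sigma> k d'" and cd: "sc \<sigma>' d = sc \<sigma>' d'"
      and y: "r (sf \<sigma>' d) < r y" "r y < r (sf \<sigma>' d')"
    then obtain d'' where d'': "d'' < m" "c d'' = c d" "f d'' = y"
      using f_convex[OF mt_sn mt_sn, of d d' y] sf' sc' mt_less by auto
    then show "\<exists>d''<m. sc \<sigma>' d'' = sc \<sigma>' d \<and> sf \<sigma>' d'' = y"
      using c_mt[OF d(1) d''(1,2)] sf' sc' mt_less[OF d(1)] by (intro exI[of _ d'']) simp
  qed
  moreover have "E t (sf \<sigma>' d) (sf \<sigma>' d')"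
    if "mt \<sigma> k d" "mt \<sigma> k d'" "sc \<sigma>' d = sc \<sigma>' d'" for d d'
    using that f_E[OF mt_sn mt_sn, of d d'] sf' sc' mt_less by simp
  ultimately show ?thesis unfolding inv_def mt' by blast
qed

lemma step_cases:
  assumes "step t \<sigma> \<sigma>'"
  obtains (grow) i where "i < k" "E t e (f (q i))" "sn \<sigma>' = k" "sm \<sigma>' = Suc m" "sc \<sigma>' m = q i"
      "grows t \<sigma> k i (sf \<sigma>' m)" "place \<sigma> k (q i) (sv \<sigma>' m) (sf \<sigma>' m)"
  | (fresh) "\<And>i. i < k \<Longrightarrow> \<not> E t e (f (q i))" "p = m \<or> e \<le> p" "sn \<sigma>' = Suc k" "sm \<sigma>' = Suc m"
      "sq \<sigma>' k = m" "sc \<sigma>' m = m" "sf \<sigma>' m = e" "place \<sigma> k m (sv \<sigma>' m) e"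
  | (match) "\<And>i. i < k \<Longrightarrow> \<not> E t e (f (q i))" "p < m" "p < e" "sn \<sigma>' = Suc k" "sm \<sigma>' = m"
      "sq \<sigma>' k = p" "target t \<sigma> k p < t" "fits t \<sigma> p (target t \<sigma> k p) (sf \<sigma>')"
  | (wait) "\<And>i. i < k \<Longrightarrow> \<not> E t e (f (q i))" "p < m" "p < e" "sn \<sigma>' = k" "sm \<sigma>' = m"
      "\<not> (target t \<sigma> k p < t \<and> (\<exists>F<t. fits t \<sigma> p (target t \<sigma> k p) (nthc F)))"
proof -
  let ?A = "\<exists>i<k. E t e (f (q i))"
  let ?B = "p = m \<or> e \<le> p"
  let ?D = "target t \<sigma> k p < t \<and> (\<exists>F<t. fits t \<sigma> p (target t \<sigma> k p) (nthc F))"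
  note st = assms[unfolded step_def k[symmetric], THEN conjunct2, THEN conjunct2]
  show thesis
  proof (cases ?A)
    case True
    with st obtain i where i: "i < k" "sn \<sigma>' = k" "sm \<sigma>' = Suc m" "sc \<sigma>' m = q i"
      "grows t \<sigma> k i (sf \<sigma>' m)" "place \<sigma> k (q i) (sv \<sigma>' m) (sf \<sigma>' m)"
      unfolding if_P[OF True] by blast
    then show thesis using grow unfolding grows_def by blast
  next
    case A: False
    show thesis
    proof (cases ?B)
      case True
      with A st show thesis
        unfolding if_not_P[OF A] if_P[OF True] by (intro fresh) auto
    next
      case B: False
      then have pm: "p < m" "p < e" using idle_le[of \<sigma> k] by auto
      show thesis
      proof (cases ?D)
        case True
        with A pm st show thesis
          unfolding if_not_P[OF A] if_not_P[OF B] if_P[OF True] by (intro match) auto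
      next
        case False
        with A pm st show thesis
          unfolding if_not_P[OF A] if_not_P[OF B] if_not_P[OF False] by (intro wait) auto
      qed
    qed
  qed
qed

lemma step_old:
  assumes "step t \<sigma> \<sigma>'"
  shows "d < m \<Longrightarrow> sv \<sigma>' d = sv \<sigma> d \<and> sc \<sigma>' d = sc \<sigma> d \<and> (mt \<sigma> k d \<longrightarrow> sf \<sigma>' d = sf \<sigma> d)"
    and "i < k \<Longrightarrow> sq \<sigma>' i = sq \<sigma> i"
  using assms unfolding step_def k[symmetric] by blast+

lemma inv_step:
  assumes st: "step t \<sigma> \<sigma>'"
  shows "inv (Suc t) \<sigma>'"
proof (rule inv_mono[of t])
  show "inv t \<sigma>'"
    using st
  proof (cases rule: step_cases)
    case (grow i)
    then show ?thesis
      using inv_add[OF step_old(1)[OF st] step_old(2)[OF st] grow(4) grow(7) grow(5) refl]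
      unfolding grows_def mt_def by blast
  next
    case fresh
    show ?thesis
      by (rule inv_add[OF step_old(1)[OF st] step_old(2)[OF st] fresh(4,8,6,7)])
        (use fresh missingI in auto)
  next
    case match
    show ?thesis
      by (rule inv_match[OF step_old(1)[OF st] step_old(2)[OF st] match(5,4,6,2) gap_target[OF match(7)] match(8)])
  next
    case wait
    show ?thesis
      by (rule inv_wait[OF step_old(1)[OF st] step_old(2)[OF st] wait(5,4)])
  qed
qed simp

end

lemma eventually_constant:
  fixes g :: "nat \<Rightarrow> nat"
  assumes mono: "\<And>t. t0 \<le> t \<Longrightarrow> g t \<le> g (Suc t)" and bound: "\<And>t. t0 \<le> t \<Longrightarrow> g t \<le> B"
  obtains t1 where "t0 \<le> t1" "\<And>t. t1 \<le> t \<Longrightarrow> g t = g t1"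
proof -
  let ?A = "g ` {t0..}"
  have "finite ?A" using bound by (auto intro: finite_subset[of _ "{..B}"])
  then have "Max ?A \<in> ?A" by (intro Max_in) auto
  then obtain t1 where t1: "t0 \<le> t1" "g t1 = Max ?A" by auto
  have "g t1 \<le> g t" if "t1 \<le> t" for t
    using that by (induction t rule: dec_induct) (use mono t1(1) in \<open>auto intro: order_trans\<close>)
  moreover have "g t \<le> g t1" if "t1 \<le> t" for t
    using that t1 \<open>finite ?A\<close> by simp
  ultimately show thesis using that t1(1) by (meson antisym)
qed

text \<open>By induction all but the greatest element of \<open>A\<close> fill an initial part of
  \<open>S\<close>, and the greatest one goes to the least element of \<open>S\<close> left over. In
  a convex set \<open>S\<close>, an initial image is convex as well, which is what
  \<open>fits\<close> asks for.\<close>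

lemma ex_initial_embedding:
  fixes v r :: "nat \<Rightarrow> real"
  assumes "finite A" "finite S" "card A \<le> card S" "inj_on v A" "inj_on r S"
  shows "\<exists>F. (\<forall>d\<in>A. F d \<in> S) \<and> (\<forall>d\<in>A. \<forall>d'\<in>A. v d < v d' \<longrightarrow> r (F d) < r (F d')) \<and>
    (\<forall>d\<in>A. \<forall>s\<in>S. r s < r (F d) \<longrightarrow> (\<exists>d'\<in>A. F d' = s))"
  using assms
proof (induction "card A" arbitrary: A)
  case 0
  then show ?case by simp
next
  case (Suc n)
  have "A \<noteq> {}" using Suc.hyps(2) by auto
  obtain a where a: "a \<in> A" "\<And>z. z \<in> A \<Longrightarrow> - v a \<le> - v z"
    using finite_ex_min[OF \<open>finite A\<close> \<open>A \<noteq> {}\<close>, of "\<lambda>z. - v z"] by blast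
  let ?A = "A - {a}"
  have n: "n = card ?A" "card ?A \<le> card S" "finite ?A" "inj_on v ?A"
    using Suc.hyps(2) Suc.prems a(1) by (auto intro: inj_on_subset)
  obtain F where F: "\<And>d. d \<in> ?A \<Longrightarrow> F d \<in> S"
    "\<And>d d'. d \<in> ?A \<Longrightarrow> d' \<in> ?A \<Longrightarrow> v d < v d' \<Longrightarrow> r (F d) < r (F d')"
    "\<And>d s. d \<in> ?A \<Longrightarrow> s \<in> S \<Longrightarrow> r s < r (F d) \<Longrightarrow> \<exists>d'\<in>?A. F d' = s"
    using Suc.hyps(1)[OF n(1) n(3) Suc.prems(2) n(2) n(4) Suc.prems(5)] by blast
  have "card (F ` ?A) \<le> n" unfolding n(1) by (rule card_image_le[OF n(3)])
  then have "card (F ` ?A) < card S" using Suc.hyps(2) Suc.prems(3) by simp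
  then have "\<not> S \<subseteq> F ` ?A" using card_mono[OF finite_imageI[OF n(3)], of S F] by auto
  then have "S - F ` ?A \<noteq> {}" by blast
  moreover have "finite (S - F ` ?A)" using Suc.prems by simp
  ultimately obtain s where s: "s \<in> S - F ` ?A" "\<And>z. z \<in> S - F ` ?A \<Longrightarrow> r s \<le> r z"
    using finite_ex_min[of "S - F ` ?A" r] by blast
  let ?F = "F(a := s)"
  have below: "r (F d) < r s" if "d \<in> ?A" for d
  proof (rule ccontr)
    assume "\<not> r (F d) < r s"
    moreover have "r (F d) \<noteq> r s" using inj_onD[OF Suc.prems(5)] F(1)[OF that] s(1) that by blast
    ultimately show False using F(3)[OF that, of s] s(1) by auto
  qed
  have va: "v d < v a" if "d \<in> ?A" for d
    using a(2)[of d] inj_onD[OF Suc.prems(4), of d a] that a(1) by force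
  have "?F d \<in> S" if "d \<in> A" for d using F(1)[of d] s(1) that by auto
  moreover have "r (?F d) < r (?F d')" if "d \<in> A" "d' \<in> A" "v d < v d'" for d d'
    using F(2)[of d d'] below[of d] va[of d'] that by (cases "d = a"; cases "d' = a") auto
  moreover have "\<exists>d'\<in>A. ?F d' = z" if d: "d \<in> A" and z: "z \<in> S" "r z < r (?F d)" for d z
  proof (cases "d = a")
    case True
    then have "z \<in> F ` ?A" using z s(2)[of z] by auto
    then obtain d' where "d' \<in> ?A" "z = F d'" by blast
    then show ?thesis by (intro bexI[of _ d']) auto
  next
    case False
    then obtain d' where "d' \<in> ?A" "F d' = z" using F(3)[of d z] d z by auto
    then show ?thesis by (intro bexI[of _ d']) auto
  qed
  ultimately show ?case by blast
qed

context unfold_classes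
begin

lemma ex_initial: "\<exists>\<sigma>. inv 0 \<sigma> \<and> sn \<sigma> = 2"
proof -
  obtain \<sigma> where \<sigma>: "sm \<sigma> = 2" "sn \<sigma> = 2"
    "\<And>d. d < 2 \<Longrightarrow> sv \<sigma> d = pr d 0 \<and> sc \<sigma> d = d \<and> sq \<sigma> d = d \<and> sf \<sigma> d = (if d = 0 then a0 else b0)"
    using ex_state[of 2 2 2 "\<lambda>d. pr d 0" "\<lambda>d. d" "\<lambda>d. d" "\<lambda>d. if d = 0 then a0 else b0"] by blast
  have v: "vl (sv \<sigma> d) = real d" if "d < 2" for d using \<sigma>(3)[OF that] by (simp add: vl_def)
  have c: "sc \<sigma> d = d" "sq \<sigma> d = d" if "d < 2" for d using \<sigma>(3)[OF that] by simp_all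
  have f: "sf \<sigma> 0 = a0" "sf \<sigma> 1 = b0" using \<sigma>(3)[of 0] \<sigma>(3)[of 1] by simp_all
  have mt: "mt \<sigma> 2 d \<longleftrightarrow> d < 2" for d unfolding mt_def \<sigma>(1) using c by force
  have "a0 \<noteq> b0" using ends by auto
  then have "r a0 < r b0" using first[of b0] by (simp add: order_le_less)
  then have f_mono: "r (sf \<sigma> d) < r (sf \<sigma> d')" if "d < 2" "d' < 2" "d < d'" for d d'
    using that f by (simp add: less_2_cases_iff)
  have "sound \<sigma>" unfolding sound_def \<sigma>(1,2) mt using v c f f_mono
    by (auto simp: less_2_cases_iff)
  moreover have "E 0 (sf \<sigma> d) (sf \<sigma> d')" if "mt \<sigma> 2 d" "mt \<sigma> 2 d'" "sc \<sigma> d = sc \<sigma> d'" for d d'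
    using that c unfolding mt by simp
  ultimately show ?thesis unfolding inv_def using \<sigma>(2) by auto
qed

text \<open>Richness with \<open>k = 1\<close> is applied between the greatest element
  \<open>l\<close> of \<open>A\<close> and the least element \<open>u\<close> of \<open>B\<close> to
  find \<open>a\<close>, and then between \<open>a\<close> and \<open>u\<close> to find
  \<open>b\<close>. Convexity of blocks carries the separation over to the other elements of
  \<open>A\<close> and \<open>B\<close>.\<close>

lemma ex_gap:
  assumes A: "finite A" "A \<noteq> {}" and B: "finite B" "B \<noteq> {}"
    and AB: "\<And>x y. x \<in> A \<Longrightarrow> y \<in> B \<Longrightarrow> r x < r y \<and> \<not> blk r x y"
  shows "\<exists>a b. r a < r b \<and> \<not> blk r a b \<and> (\<forall>x\<in>A. r x < r a \<and> \<not> blk r x a) \<and>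
    (\<forall>y\<in>B. r b < r y \<and> \<not> blk r b y)"
proof -
  obtain l where l: "l \<in> A" "\<And>z. z \<in> A \<Longrightarrow> - r l \<le> - r z"
    using finite_ex_min[OF A, of "\<lambda>z. - r z"] by blast
  obtain u where u: "u \<in> B" "\<And>z. z \<in> B \<Longrightarrow> r u \<le> r z" using finite_ex_min[OF B, of r] by blast
  have dense: "\<exists>s. r x < r s \<and> r s < r y \<and> \<not> blk r x s \<and> \<not> blk r s y"
    if xy: "r x < r y" "\<not> blk r x y" for x y
  proof -
    obtain S where S: "finite S" "1 \<le> card S"
      "\<And>s. s \<in> S \<Longrightarrow> r x < r s \<and> r s < r y \<and> \<not> blk r x s \<and> \<not> blk r s y"
      using rich[unfolded rich_def, rule_format, OF xy, of 1] by blast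
    then have "S \<noteq> {}" by auto
    then show ?thesis using S(3) by blast
  qed
  obtain a where a: "r l < r a" "r a < r u" "\<not> blk r l a" "\<not> blk r a u"
    using dense AB[OF l(1) u(1)] by blast
  obtain b where b: "r a < r b" "r b < r u" "\<not> blk r a b" "\<not> blk r b u"
    using dense[OF a(2,4)] by blast
  have "r x < r a \<and> \<not> blk r x a" if "x \<in> A" for x
  proof -
    have "r x \<le> r l" using l(2)[OF that] by simp
    then have "l \<in> cint r a x" using a(1) by (simp add: in_cint_iff)
    then have "\<not> blk r x a" using a(3) blk_mono[of r a x l] blk_commute by blast
    then show ?thesis using \<open>r x \<le> r l\<close> a(1) by simp
  qed
  moreover have "r b < r y \<and> \<not> blk r b y" if "y \<in> B" for y
  proof -
    have "r u \<le> r y" using u(2)[OF that] by simp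
    then have "u \<in> cint r b y" using b(2) by (simp add: in_cint_iff)
    then have "\<not> blk r b y" using b(4) blk_mono[of r b y u] by blast
    then show ?thesis using \<open>r u \<le> r y\<close> b(2) by simp
  qed
  ultimately show ?thesis using b(1,3) by blast
qed

end

section \<open>Convergence of the first construction\<close>

locale unfold_run = unfold_classes +
  fixes S :: "nat \<Rightarrow> nat"
  assumes C_S: "C S" and inv_S: "inv t (S t)" and step_S: "step t (S t) (S (Suc t))"
    and sn_S0: "sn (S 0) = 2"

sublocale unfold_run \<subseteq> st: unfold_stage C r a0 b0 t "S t" "kept t (S t)" for t
  by unfold_locales (simp_all add: inv_S)

context unfold_run
begin

abbreviation "K t \<equiv> kept t (S t)"

lemma sn_Suc: "sn (S (Suc t)) = K t \<or> sn (S (Suc t)) = Suc (K t)"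
  by (rule st.step_cases[OF step_S[of t]]) simp_all

lemma K_Suc: "K (Suc t) \<le> Suc (K t)"
  using sn_Suc[of t] st.k_le[of "Suc t"] by auto

lemma sm_Suc: "sm (S t) \<le> sm (S (Suc t))"
  by (rule st.step_cases[OF step_S[of t]]) simp_all

lemma sm_mono: "t \<le> t' \<Longrightarrow> sm (S t) \<le> sm (S t')"
  by (rule lift_Suc_mono_le[of "\<lambda>t. sm (S t)"]) (rule sm_Suc)

lemma old_mono:
  assumes "t \<le> t'" "d < sm (S t)"
  shows "sv (S t') d = sv (S t) d \<and> sc (S t') d = sc (S t) d"
  using assms(1)
proof (induction t' rule: dec_induct)
  case (step u)
  have "d < sm (S u)" using sm_mono[OF step(1)] assms(2) by simp
  then show ?case using st.step_old(1)[OF step_S[of u]] step by simp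
qed simp

text \<open>The first \<open>i\<close> positions of the priority list are no longer injured from
  stage \<open>t\<close> on.\<close>

definition final :: "nat \<Rightarrow> nat \<Rightarrow> bool" where
  "final t i \<longleftrightarrow> (\<forall>t'\<ge>t. i \<le> K t')"

lemma final_mono: "final t i \<Longrightarrow> t \<le> t' \<Longrightarrow> j \<le> i \<Longrightarrow> final t' j"
  unfolding final_def by (meson order_trans)

lemma final_keeps:
  assumes "final t i" "t \<le> t'"
  shows "\<And>j. j < i \<Longrightarrow> sq (S t') j = sq (S t) j"
    and "\<And>d. mt (S t) i d \<Longrightarrow> mt (S t') i d \<and> sf (S t') d = sf (S t) d"
    and "\<And>d. d < sm (S t) \<Longrightarrow> mt (S t') i d \<longleftrightarrow> mt (S t) i d"
proof -
  have q: "sq (S t') j = sq (S t) j" if "j < i" for j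
    using assms(2)
  proof (induction t' rule: dec_induct)
    case (step u)
    have "j < K u" using assms(1) step(1) that unfolding final_def by (meson order_less_le_trans)
    then show ?case using st.step_old(2)[OF step_S[of u]] step by simp
  qed simp
  then show "\<And>j. j < i \<Longrightarrow> sq (S t') j = sq (S t) j" .
  show 3: "mt (S t') i d \<longleftrightarrow> mt (S t) i d" if "d < sm (S t)" for d
    unfolding mt_def using q old_mono[OF assms(2) that] sm_mono[OF assms(2)] that by auto
  show "mt (S t') i d \<and> sf (S t') d = sf (S t) d" if d: "mt (S t) i d" for d
    using assms(2)
  proof (induction t' rule: dec_induct)
    case (step u)
    have "d < sm (S u)" using sm_mono[OF step(1)] d unfolding mt_def by simp
    moreover have "mt (S u) (K u) d"
      using assms(1) step(1,3) unfolding final_def mt_def by (meson order_less_le_trans)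
    ultimately have "sf (S (Suc u)) d = sf (S u) d" using st.step_old(1)[OF step_S[of u]] by blast
    moreover have "mt (S (Suc u)) i d"
      unfolding mt_def
    proof (intro conjI)
      show "d < sm (S (Suc u))" using sm_Suc[of u] \<open>d < sm (S u)\<close> by simp
      obtain j where j: "j < i" "sc (S u) d = sq (S u) j" using step(3) unfolding mt_def by blast
      have "j < K u" using assms(1) step(1) j(1) unfolding final_def by (meson order_less_le_trans)
      then have "sc (S (Suc u)) d = sq (S (Suc u)) j"
        using st.step_old[OF step_S[of u]] j(2) \<open>d < sm (S u)\<close> by simp
      then show "\<exists>j<i. sc (S (Suc u)) d = sq (S (Suc u)) j" using j(1) by blast
    qed
    ultimately show ?case using step by simp
  qed (use d in simp)
qed


text \<open>The image of the representative stands for the block into which the class at position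
  \<open>j\<close> is mapped.\<close>

abbreviation "anchor t j \<equiv> sf (S t) (sq (S t) j)"

section \<open>The induction step on priorities\<close>

context
  fixes T i :: nat
  assumes fin: "final T i" and i2: "2 \<le> i"
begin

lemma i_le: "T \<le> t \<Longrightarrow> i \<le> K t"
  using fin unfolding final_def by blast

lemma mt_anchor: "T \<le> t \<Longrightarrow> j < i \<Longrightarrow> mt (S t) i (sq (S t) j)"
  using st.mt_q[of j t] st.c_q[of j t] i_le[of t] st.k_le[of t] unfolding mt_def by auto

lemma anchor_const: "T \<le> t \<Longrightarrow> j < i \<Longrightarrow> anchor t j = anchor T j"
proof -
  assume t: "T \<le> t" and j: "j < i"
  have "sq (S t) j = sq (S T) j" by (rule final_keeps(1)[OF fin t j])
  moreover have "sf (S t) (sq (S T) j) = anchor T j"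
    using final_keeps(2)[OF fin t mt_anchor[OF order_refl j]] by blast
  ultimately show ?thesis by (simp only:)
qed

text \<open>If the anchors were in one block, this would be seen at some stage, and the later of the
  two classes would be injured then.\<close>

lemma anchor_sep: "j < i \<Longrightarrow> l < i \<Longrightarrow> j \<noteq> l \<Longrightarrow> \<not> blk r (anchor T j) (anchor T l)"
proof
  assume jl: "j < i" "l < i" "j \<noteq> l" and "blk r (anchor T j) (anchor T l)"
  then obtain t where t: "E t (anchor T j) (anchor T l)" using blk_imp_E by blast
  let ?t = "max t T"
  have "E ?t (anchor ?t j) (anchor ?t l)" using E_mono[OF t, of ?t] jl anchor_const[of ?t] by simp
  then show False using st.E_q[of j ?t l] jl i_le[of ?t] by simp
qed

lemma blk_anchor:
  assumes "T \<le> t" "mt (S t) i d" "j < i" "sc (S t) d = sq (S t) j"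
  shows "blk r (anchor T j) (sf (S t) d)"
proof -
  have K: "i \<le> sn (S t)" using i_le[OF assms(1)] st.k_le[of t] by simp
  have mt: "mt (S t) (sn (S t)) d'" if "mt (S t) i d'" for d'
    using that K unfolding mt_def by (meson order_less_le_trans)
  have "E t (anchor t j) (sf (S t) d)"
    using st.f_E[OF mt[OF mt_anchor[OF assms(1,3)]] mt[OF assms(2)]] st.c_q[of j t] assms(3,4) K by simp
  then show ?thesis using anchor_const[OF assms(1,3)] E_imp_blk by metis
qed

text \<open>A merger that is seen is genuine. So once the positions before it are final, a class
  whose anchor truly avoids the blocks of their anchors cannot be injured any more.\<close>

lemma lock:
  assumes "T \<le> t" "Suc i \<le> sn (S t)" "\<And>j. j < i \<Longrightarrow> \<not> blk r (anchor T j) (anchor t i)"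
  shows "final t (Suc i)"
proof -
  have *: "Suc i \<le> K u" if u: "T \<le> u" "Suc i \<le> sn (S u)" "anchor u i = anchor t i" for u
  proof (rule ccontr)
    assume "\<not> Suc i \<le> K u"
    then have K: "K u = i" using i_le[OF u(1)] by simp
    then have "\<not> valid u (S u) (Suc i)" using kept_maximal[of u "S u"] u(2) by simp
    then obtain j l where jl: "j < Suc i" "l < j" "E u (anchor u l) (anchor u j)"
      unfolding valid_def by blast
    show False
    proof (cases "j = i")
      case True
      then show False
        using assms(3)[of l] E_imp_blk[OF jl(3)] jl(2) u(3) anchor_const[OF u(1), of l] by simp
    next
      case False
      then show False using st.E_q[of l u j] jl K by simp
    qed
  qed
  have "Suc i \<le> sn (S u) \<and> anchor u i = anchor t i" if "t \<le> u" for u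
    using that
  proof (induction u rule: dec_induct)
    case (step u)
    then have K: "Suc i \<le> K u" using * assms(1) by simp
    then have "Suc i \<le> sn (S (Suc u))" using sn_Suc[of u] by auto
    moreover have "sq (S (Suc u)) i = sq (S u) i" using st.step_old(2)[OF step_S[of u], of i] K by simp
    moreover have "sf (S (Suc u)) (sq (S u) i) = anchor u i"
    proof -
      have mt: "mt (S u) (K u) (sq (S u) i)" using st.mt_q[of i u] K by simp
      show ?thesis using st.step_old(1)[OF step_S[of u] st.mt_less[OF mt]] mt by blast
    qed
    ultimately show ?case using step by simp
  qed (use assms in simp)
  then show ?thesis
    unfolding final_def using * assms(1) by (meson order_trans)
qed

text \<open>The anchor at position 0 is the first element of the order, so a gap between it and all
  other anchors suffices.\<close>

lemma ex_separated: "\<exists>e. \<forall>j<i. \<not> blk r (anchor T j) e"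
proof -
  let ?B = "anchor T ` {1..<i}"
  have a: "anchor T 0 = a0" using st.q01(1) st.f01(1) by simp
  have "r (anchor T 0) < r y \<and> \<not> blk r (anchor T 0) y" if y: "y \<in> ?B" for y
  proof -
    obtain j where j: "1 \<le> j" "j < i" "y = anchor T j" using y by auto
    have "\<not> blk r (anchor T 0) y" using anchor_sep[of 0 j] j i2 by simp
    moreover from this have "anchor T 0 \<noteq> y" by auto
    ultimately show ?thesis using first[of y] a by (simp add: order_le_less)
  qed
  moreover have "1 \<in> {1..<i}" using i2 by simp
  then have "?B \<noteq> {}" by blast
  ultimately obtain a b where ab: "\<not> blk r (anchor T 0) a" "\<And>y. y \<in> ?B \<Longrightarrow> \<not> blk r b y"
      "r (anchor T 0) < r a" "r a < r b" "\<And>y. y \<in> ?B \<Longrightarrow> r b < r y"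
    using ex_gap[of "{anchor T 0}" ?B] by auto
  have "\<not> blk r (anchor T j) a" if "j < i" for j
  proof (cases "j = 0")
    case False
    then have y: "anchor T j \<in> ?B" using that by auto
    then have "b \<in> cint r (anchor T j) a" using ab(4) ab(5)[OF y] by (simp add: in_cint_iff)
    then show ?thesis using ab(2)[OF y] blk_mono[of r "anchor T j" a b] blk_commute by blast
  qed (use ab in simp)
  then show ?thesis by blast
qed

context
  assumes recurrent: "\<And>t. \<exists>u\<ge>t. K u = i"
begin

text \<open>What the first \<open>i\<close> classes cover stays covered, so the least uncovered
  element can only grow, and an element outside the blocks of the anchors bounds it. If its limit
  lay in the block of an anchor, then all late stages with \<open>K t = i\<close> would be growth
  steps, each of them covering a further element of the finite set \<open>F\<close>.\<close>

lemma missing_const: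
  obtains t1 e where "T \<le> t1" "\<And>t. t1 \<le> t \<Longrightarrow> missing (S t) i = e"
    "\<And>j. j < i \<Longrightarrow> \<not> blk r (anchor T j) e"
proof -
  obtain e0 where e0: "\<And>j. j < i \<Longrightarrow> \<not> blk r (anchor T j) e0" using ex_separated by blast
  have "missing (S t) i \<le> e0" if "T \<le> t" for t
  proof (rule missing_le)
    fix d assume d: "mt (S t) i d"
    then obtain j where "j < i" "sc (S t) d = sq (S t) j" unfolding mt_def by blast
    then show "sf (S t) d \<noteq> e0" using blk_anchor[OF that d] e0 by blast
  qed
  moreover have "missing (S t) i \<le> missing (S (Suc t)) i" if "T \<le> t" for t
  proof (rule missing_le)
    fix d assume d: "mt (S t) i d"
    show "sf (S t) d \<noteq> missing (S (Suc t)) i"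
      using final_keeps(2)[OF final_mono[OF fin that order_refl], of "Suc t", OF _ d]
        missingI[of "S (Suc t)" i d] by simp
  qed
  ultimately obtain t1 where t1: "T \<le> t1" "\<And>t. t1 \<le> t \<Longrightarrow> missing (S t) i = missing (S t1) i"
    using eventually_constant[of T "\<lambda>t. missing (S t) i"] by metis
  let ?e = "missing (S t1) i"
  have "\<not> blk r (anchor T j) ?e" if j: "j < i" for j
  proof
    assume "blk r (anchor T j) ?e"
    then obtain tE where tE: "E tE (anchor T j) ?e" using blk_imp_E by blast
    \<comment> \<open>It is not prescribed which position answers for the missing element, so all
      candidates \<open>l\<close> are taken together.\<close>
    define F where "F = (\<Union>l\<in>{l. l < i \<and> blk r (anchor T l) ?e}. cint r (anchor T l) ?e)"
    have finF: "finite F" unfolding F_def by (auto simp: blk_def)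
    define cov where "cov t = F \<inter> sf (S t) ` {d. mt (S t) i d}" for t
    have cov_F: "cov t \<subseteq> F" for t unfolding cov_def by blast
    have cov_mono: "cov t \<subseteq> cov (Suc t)" if "T \<le> t" for t
    proof
      fix y assume "y \<in> cov t"
      then obtain d where d: "y \<in> F" "mt (S t) i d" "y = sf (S t) d" unfolding cov_def by blast
      have "mt (S (Suc t)) i d \<and> sf (S (Suc t)) d = y"
        using final_keeps(2)[OF final_mono[OF fin that order_refl], of "Suc t", OF _ d(2)] d(3) by simp
      then show "y \<in> cov (Suc t)" unfolding cov_def using d(1) by blast
    qed
    obtain t2 where t2: "T \<le> t2" "\<And>t. t2 \<le> t \<Longrightarrow> card (cov t) = card (cov t2)"
      using eventually_constant[of T "\<lambda>t. card (cov t)" "card F"] card_mono[OF finF cov_F]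
        card_mono[OF finite_subset[OF cov_F finF] cov_mono] by metis
    obtain t where t: "max (max t1 t2) tE \<le> t" "K t = i" using recurrent by blast
    then have tT: "T \<le> t" using t1(1) by simp
    have e: "missing (S t) i = ?e" using t1(2)[of t] t by simp
    have "E t ?e (anchor t j)"
      using E_mono[OF tE, of t] t anchor_const[OF tT j] E_commute by simp
    then have Ej: "\<not> (\<forall>l<i. \<not> E t (missing (S t) i) (anchor t l))" using j e by auto
    obtain l where l: "l < i" "E t ?e (anchor t l)"
      "sm (S (Suc t)) = Suc (sm (S t))" "sc (S (Suc t)) (sm (S t)) = sq (S t) l"
      "grows t (S t) i l (sf (S (Suc t)) (sm (S t)))"
      by (rule st.step_cases[OF step_S[of t]]) (use Ej t(2) e in auto)
    let ?y = "sf (S (Suc t)) (sm (S t))"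
    have "?y \<in> cint r (anchor T l) ?e"
      using l(5) e anchor_const[OF tT l(1)] unfolding grows_def by (auto simp: in_cint_iff)
    moreover have "blk r (anchor T l) ?e"
      using E_imp_blk[OF l(2)] anchor_const[OF tT l(1)] blk_commute by simp
    ultimately have yF: "?y \<in> F" unfolding F_def using l(1) by blast
    have "sq (S (Suc t)) l = sq (S t) l" using st.step_old(2)[OF step_S[of t]] l(1) t(2) by simp
    then have "mt (S (Suc t)) i (sm (S t))" unfolding mt_def using l(1,3,4) by auto
    then have "?y \<in> cov (Suc t)" unfolding cov_def using yF by blast
    moreover have "?y \<notin> cov t"
      using l(5) unfolding cov_def grows_def mt_def by auto
    ultimately have "cov t \<subset> cov (Suc t)" using cov_mono[OF tT] by blast
    then have "card (cov t) < card (cov (Suc t))"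
      using psubset_card_mono[OF finite_subset[OF cov_F finF]] by blast
    then show False using t2(2)[of t] t2(2)[of "Suc t"] t by simp
  qed
  then show thesis using that t1 by blast
qed

text \<open>A true gap passes the test \<open>gap\<close> at all stages from \<open>t2\<close> on,
  whereas a false one is exposed at some stage, since blocks only merge. Hence the least code that
  passes converges to the least true gap.\<close>

lemma target_const:
  assumes t2: "T \<le> t2" and P: "P < sm (S t2)" "sc (S t2) P = P" "\<not> mt (S t2) i P"
  shows "\<exists>z t3. t2 \<le> t3 \<and> (\<forall>t\<ge>t3. target t (S t) i P = z \<and> z < t) \<and>
    r (pi1 z) < r (pi2 z) \<and> \<not> blk r (pi1 z) (pi2 z) \<and>
    (\<forall>j<i. \<forall>y. r (pi1 z) \<le> r y \<longrightarrow> r y \<le> r (pi2 z) \<longrightarrow> \<not> blk r (anchor T j) y)"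
proof -
  let ?v = "\<lambda>d. vl (sv (S t2) d)"
  let ?q = "\<lambda>j. sq (S t2) j"
  have vt: "sv (S t) d = sv (S t2) d" if "t2 \<le> t" "d < sm (S t2)" for t d
    using old_mono[OF that] by simp
  have q: "sq (S t) j = ?q j" if "t2 \<le> t" "j < i" for t j
    using final_keeps(1)[OF final_mono[OF fin t2 order_refl] that(1,2)] .
  have qm: "?q j < sm (S t2)" if "j < i" for j using mt_anchor[OF t2 that] unfolding mt_def by simp
  define good where "good z \<longleftrightarrow> r (pi1 z) < r (pi2 z) \<and> \<not> blk r (pi1 z) (pi2 z) \<and>
    (\<forall>j<i. (?v (?q j) < ?v P \<longrightarrow> r (anchor T j) < r (pi1 z) \<and> \<not> blk r (anchor T j) (pi1 z)) \<and>
      (?v P < ?v (?q j) \<longrightarrow> r (pi2 z) < r (anchor T j) \<and> \<not> blk r (pi2 z) (anchor T j)))" for z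
  have qP: "?v (?q j) \<noteq> ?v P" if "j < i" for j
    using st.v_inj[OF qm[OF that] P(1)] mt_anchor[OF t2 that] P(3) by metis
  have "\<exists>z. good z"
  proof -
    let ?A = "anchor T ` {j. j < i \<and> ?v (?q j) < ?v P}"
    let ?B = "anchor T ` {j. j < i \<and> ?v P < ?v (?q j)}"
    have "r x < r y \<and> \<not> blk r x y" if x: "x \<in> ?A" and y: "y \<in> ?B" for x y
    proof -
      obtain j l where jl: "j < i" "?v (?q j) < ?v P" "x = anchor T j" "l < i" "?v P < ?v (?q l)" "y = anchor T l"
        using x y by blast
      have "mt (S t2) (sn (S t2)) (?q j)" "mt (S t2) (sn (S t2)) (?q l)"
        using mt_anchor[OF t2 jl(1)] mt_anchor[OF t2 jl(4)] i_le[OF t2] st.k_le[of t2]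
        unfolding mt_def by (meson order_less_le_trans)+
      then have "r (anchor t2 j) < r (anchor t2 l)" using st.f_mono jl by simp
      then show ?thesis
        using anchor_const[OF t2] jl anchor_sep[of j l] by auto
    qed
    moreover have "0 \<in> {j. j < i \<and> ?v (?q j) < ?v P}"
      using st.v_ends(1)[OF P(1)] qP[of 0] i2 st.q01(1) by auto
    then have "?A \<noteq> {}" by blast
    moreover have "1 \<in> {j. j < i \<and> ?v P < ?v (?q j)}"
      using st.v_ends(2)[OF P(1)] qP[of 1] i2 st.q01(2) by auto
    then have "?B \<noteq> {}" by blast
    ultimately obtain a b where "r a < r b \<and> \<not> blk r a b \<and> (\<forall>x\<in>?A. r x < r a \<and> \<not> blk r x a) \<and>
        (\<forall>y\<in>?B. r b < r y \<and> \<not> blk r b y)"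
      using ex_gap[of ?A ?B] by auto
    then have "good (pr a b)" unfolding good_def by auto
    then show ?thesis ..
  qed
  then have gz: "good (LEAST z. good z)" (is "good ?z") by (rule LeastI_ex)
  \<comment> \<open>\<open>good\<close> speaks about anchors only. Every matched element lies in the
    block of an anchor and, by convexity of the classes, on the same side of \<open>P\<close> as the
    representative of its class.\<close>
  have good_gap: "gap t (S t) i P z" if t: "t2 \<le> t" and z: "good z" for t z
    unfolding gap_def
  proof (intro conjI allI impI)
    have tT: "T \<le> t" using t t2 by simp
    show "r (pi1 z) < r (pi2 z)" "\<not> E t (pi1 z) (pi2 z)"
      using z E_imp_blk unfolding good_def by blast+
    fix d assume "d < sm (S t)" and d: "mt (S t) i d"
    then obtain j where j: "j < i" "sc (S t) d = sq (S t) j" unfolding mt_def by blast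
    have b: "blk r (anchor T j) (sf (S t) d)" using blk_anchor[OF tT d j] .
    have Pm: "P < sm (S t)" using P(1) sm_mono[OF t] by simp
    have cP: "sc (S t) P = P" using old_mono[OF t P(1)] P(2) by simp
    have qjm: "sq (S t) j < sm (S t)" "sc (S t) (sq (S t) j) = sq (S t) j"
      using mt_anchor[OF tT j(1)] st.c_q[of j t] j i_le[OF tT] st.k_le[of t] unfolding mt_def by auto
    have nP: "sc (S t) P \<noteq> sc (S t) d"
      using final_keeps(3)[OF final_mono[OF fin t2 order_refl] t P(1)] P(3) j Pm unfolding mt_def by auto
    have vqj: "vl (sv (S t) (sq (S t) j)) = ?v (?q j)" "vl (sv (S t) P) = ?v P"
      using vt[OF t] q[OF t j(1)] qm[OF j(1)] P(1) by simp_all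
    have side: "?v (?q j) < ?v P" if "vl (sv (S t) d) < vl (sv (S t) P)"
      using st.c_convex[of d t "sq (S t) j" P] that \<open>d < sm (S t)\<close> qjm Pm j(2) nP vqj qP[OF j(1)]
      by (metis linorder_neqE_linordered_idom)
    have side': "?v P < ?v (?q j)" if "vl (sv (S t) P) < vl (sv (S t) d)"
      using st.c_convex[of "sq (S t) j" t d P] that \<open>d < sm (S t)\<close> qjm Pm j(2) nP vqj qP[OF j(1)]
      by (metis linorder_neqE_linordered_idom)
    {
      assume "vl (sv (S t) d) < vl (sv (S t) P)"
      then have a: "r (anchor T j) < r (pi1 z)" "\<not> blk r (anchor T j) (pi1 z)"
        using side z j(1) unfolding good_def by blast+
      show "r (sf (S t) d) < r (pi1 z)"
      proof (rule ccontr)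
        assume "\<not> r (sf (S t) d) < r (pi1 z)"
        then have "pi1 z \<in> cint r (anchor T j) (sf (S t) d)" using a(1) by (simp add: in_cint_iff)
        then show False using blk_mono[OF b] a(2) by blast
      qed
      show "\<not> E t (sf (S t) d) (pi1 z)" using E_imp_blk blk_trans[OF b] a(2) by blast
    next
      assume "vl (sv (S t) P) < vl (sv (S t) d)"
      then have a: "r (pi2 z) < r (anchor T j)" "\<not> blk r (pi2 z) (anchor T j)"
        using side' z j(1) unfolding good_def by blast+
      show "r (pi2 z) < r (sf (S t) d)"
      proof (rule ccontr)
        assume "\<not> r (pi2 z) < r (sf (S t) d)"
        then have "pi2 z \<in> cint r (anchor T j) (sf (S t) d)" using a(1) by (simp add: in_cint_iff)
        then show False using blk_mono[OF b] a(2) blk_commute by blast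
      qed
      show "\<not> E t (pi2 z) (sf (S t) d)"
        using E_imp_blk blk_trans[of r "pi2 z" "sf (S t) d"] b a(2) blk_commute by blast
    }
  qed
  have bad_gap: "\<exists>u. \<forall>t\<ge>u. t2 \<le> t \<longrightarrow> \<not> gap t (S t) i P z" if z: "\<not> good z" for z
  proof -
    have at: "mt (S t) i (sq (S t) j)" "vl (sv (S t) (sq (S t) j)) = ?v (?q j)"
        "vl (sv (S t) P) = ?v P" "anchor t j = anchor T j" if "t2 \<le> t" "j < i" for t j
      using mt_anchor[of t j] vt[OF that(1)] q[OF that] qm[OF that(2)] P(1) anchor_const[of t j] that t2
      by simp_all
    consider "\<not> r (pi1 z) < r (pi2 z)" | "blk r (pi1 z) (pi2 z)"
      | j where "j < i" "?v (?q j) < ?v P" "\<not> r (anchor T j) < r (pi1 z)"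
      | j where "j < i" "?v (?q j) < ?v P" "blk r (anchor T j) (pi1 z)"
      | j where "j < i" "?v P < ?v (?q j)" "\<not> r (pi2 z) < r (anchor T j)"
      | j where "j < i" "?v P < ?v (?q j)" "blk r (pi2 z) (anchor T j)"
      using z unfolding good_def by blast
    then show ?thesis
    proof cases
      case 1
      then show ?thesis unfolding gap_def by blast
    next
      case 2
      then obtain u where "E u (pi1 z) (pi2 z)" using blk_imp_E by blast
      then show ?thesis unfolding gap_def using E_mono by blast
    next
      case 3
      then show ?thesis using at[OF _ 3(1)] unfolding gap_def by (metis mt_def)
    next
      case 4
      then obtain u where "E u (anchor T j) (pi1 z)" using blk_imp_E by blast
      then show ?thesis using at[OF _ 4(1)] 4(2) E_mono unfolding gap_def by (metis mt_def)
    next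
      case 5
      then show ?thesis using at[OF _ 5(1)] unfolding gap_def by (metis mt_def)
    next
      case 6
      then obtain u where "E u (pi2 z) (anchor T j)" using blk_imp_E by blast
      then show ?thesis using at[OF _ 6(1)] 6(2) E_mono unfolding gap_def by (metis mt_def)
    qed
  qed
  have "\<forall>z. \<exists>u. z < ?z \<longrightarrow> (\<forall>t\<ge>u. t2 \<le> t \<longrightarrow> \<not> gap t (S t) i P z)"
    using bad_gap not_less_Least[of _ good] by blast
  then obtain u where u: "\<And>z t. z < ?z \<Longrightarrow> u z \<le> t \<Longrightarrow> t2 \<le> t \<Longrightarrow> \<not> gap t (S t) i P z"
    by metis
  \<comment> \<open>The sum bounds the stages at which the finitely many false gaps below
    \<open>?z\<close> have been exposed; \<open>Suc ?z\<close> brings \<open>?z\<close> itself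
    within the range of the search.\<close>
  let ?t3 = "max t2 (Suc ?z) + (\<Sum>z<?z. u z)"
  have "target t (S t) i P = ?z \<and> ?z < t" if t: "?t3 \<le> t" for t
  proof -
    have "t2 \<le> t" "?z < t" using t by auto
    have ut: "u z \<le> t" if "z < ?z" for z
      using member_le_sum[of z "{..<?z}" u] that t by simp
    have "target t (S t) i P = ?z"
      unfolding target_def
    proof (rule Least_equality)
      show "?z = t \<or> gap t (S t) i P ?z" using good_gap[OF \<open>t2 \<le> t\<close> gz] by blast
      fix y assume "y = t \<or> gap t (S t) i P y"
      then show "?z \<le> y" using u[of y t] ut[of y] \<open>t2 \<le> t\<close> \<open>?z < t\<close> by (metis leI less_imp_le)
    qed
    then show ?thesis using \<open>?z < t\<close> by simp
  qed
  moreover have "\<not> blk r (anchor T j) y"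
    if "j < i" "r (pi1 ?z) \<le> r y" "r y \<le> r (pi2 ?z)" for j y
  proof (cases "?v (?q j) < ?v P")
    case True
    then have a: "r (anchor T j) < r (pi1 ?z)" "\<not> blk r (anchor T j) (pi1 ?z)"
      using gz that(1) unfolding good_def by blast+
    then have "pi1 ?z \<in> cint r (anchor T j) y" using that by (simp add: in_cint_iff)
    then show ?thesis using blk_mono a(2) by blast
  next
    case False
    then have "?v P < ?v (?q j)" using qP[OF that(1)] by simp
    then have a: "r (pi2 ?z) < r (anchor T j)" "\<not> blk r (pi2 ?z) (anchor T j)"
      using gz that(1) unfolding good_def by blast+
    then have "pi2 ?z \<in> cint r (anchor T j) y" using that by (simp add: in_cint_iff)
    then show ?thesis using blk_mono a(2) blk_commute by blast
  qed
  moreover have "r (pi1 ?z) < r (pi2 ?z)" "\<not> blk r (pi1 ?z) (pi2 ?z)"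
    using gz unfolding good_def by blast+
  moreover have "t2 \<le> ?t3" by simp
  ultimately show ?thesis by (intro exI[of _ ?z] exI[of _ ?t3] conjI) blast+
qed

end

end


text \<open>If position \<open>i\<close> were injured again and again, then by \<open>lock\<close>
  each image it receives would lie in the block of an anchor. But late images do not: the missing
  element avoids the blocks of the anchors, and so does everything between the ends of the limit
  target. Hence at late stages with \<open>K t = i\<close> the construction can only wait, and from
  then on it waits forever. Nothing is created any more, the waiting class has a fixed size, and by
  richness the gap contains a run that is long enough, which ends the waiting.\<close>

lemma final_Suc:
  assumes fin: "final T i" and i2: "2 \<le> i"
  shows "\<exists>t. final t (Suc i)"
proof (rule ccontr)
  assume not: "\<not> ?thesis"
  have recurrent: "\<exists>u\<ge>t. K u = i" for t
  proof -
    have "\<not> final (max t T) (Suc i)" using not by blast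
    then obtain u where u: "max t T \<le> u" "K u < Suc i" unfolding final_def by (auto simp: not_le)
    then have "K u = i" using i_le[OF fin i2, of u] by simp
    then show ?thesis using u(1) by auto
  qed
  obtain t1 e where t1: "T \<le> t1" and e: "\<And>t. t1 \<le> t \<Longrightarrow> missing (S t) i = e"
      and e_sep: "\<And>j. j < i \<Longrightarrow> \<not> blk r (anchor T j) e"
    using missing_const[OF fin i2 recurrent] by blast
  have no_grow: "\<not> E t (missing (S t) i) (anchor t j)" if "t1 \<le> t" "j < i" for t j
    using e[OF that(1)] e_sep[OF that(2)] anchor_const[OF fin i2, of t j] that t1 E_imp_blk[of t e] blk_commute
    by (metis order_trans)
  have unlocked: "\<not> (Suc i \<le> sn (S t) \<and> (\<forall>j<i. \<not> blk r (anchor T j) (anchor t i)))" if "T \<le> t" for t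
    using lock[OF fin i2 that] not by blast
  have no_fresh: "idle (S t) i < sm (S t) \<and> idle (S t) i < e" if t: "t1 \<le> t" "K t = i" for t
  proof (rule st.step_cases[OF step_S[of t]])
    fix j assume "j < K t" "E t (missing (S t) (K t)) (anchor t j)"
    then show ?thesis using no_grow[of t j] t by simp
  next
    assume a: "sn (S (Suc t)) = Suc (K t)" "sq (S (Suc t)) (K t) = sm (S t)"
      "sf (S (Suc t)) (sm (S t)) = missing (S t) (K t)"
    then have "anchor (Suc t) i = e" using t e by simp
    then show ?thesis using unlocked[of "Suc t"] a(1) e_sep t t1 by simp
  qed (use t e in auto)
  obtain t2 where t2: "t1 \<le> t2" "K t2 = i" using recurrent by blast
  let ?P = "idle (S t2) i"
  have P: "?P < sm (S t2)" "?P < e" using no_fresh[OF t2] by auto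
  then have P': "sc (S t2) ?P = ?P" "\<not> mt (S t2) i ?P" using idleD[of "S t2" i] by auto
  have t2T: "T \<le> t2" using t1 t2 by simp
  \<comment> \<open>All smaller representatives exist at stage \<open>t2\<close> already, and
    whether they belong to the first \<open>i\<close> classes does not change afterwards.\<close>
  have idle: "idle (S t) i = ?P" if t: "t2 \<le> t" for t
  proof (rule antisym)
    have cP: "sc (S t) ?P = ?P" using old_mono[OF t P(1)] P'(1) by simp
    have nP: "\<not> mt (S t) i ?P"
      using final_keeps(3)[OF final_mono[OF fin t2T order_refl] t P(1)] P'(2) by simp
    show le: "idle (S t) i \<le> ?P" by (rule idle_least[OF cP nP])
    then have m2: "idle (S t) i < sm (S t2)" using P(1) by simp
    then have "idle (S t) i < sm (S t)" using sm_mono[OF t] by simp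
    then have "sc (S t) (idle (S t) i) = idle (S t) i" "\<not> mt (S t) i (idle (S t) i)"
      using idleD by blast+
    then show "?P \<le> idle (S t) i"
      using idle_least[of "S t2" "idle (S t) i" i] old_mono[OF t m2]
        final_keeps(3)[OF final_mono[OF fin t2T order_refl] t m2] by simp
  qed
  obtain z t3 where t3: "t2 \<le> t3" and target': "\<forall>t\<ge>t3. target t (S t) i ?P = z \<and> z < t"
    and z: "r (pi1 z) < r (pi2 z)" "\<not> blk r (pi1 z) (pi2 z)"
    and sep': "\<forall>j<i. \<forall>y. r (pi1 z) \<le> r y \<longrightarrow> r y \<le> r (pi2 z) \<longrightarrow> \<not> blk r (anchor T j) y"
    using target_const[OF fin i2 recurrent t2T P(1) P'] by blast
  note target = target'[rule_format] and sep = sep'[rule_format]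
  have wait: "sn (S (Suc t)) = i \<and> sm (S (Suc t)) = sm (S t) \<and>
      \<not> (\<exists>F<t. fits t (S t) ?P z (nthc F))" if t: "t3 \<le> t" "K t = i" for t
  proof (rule st.step_cases[OF step_S[of t]])
    have t': "t1 \<le> t" "t2 \<le> t" "T \<le> t" using t t1 t2 t3 by simp_all
    {
      fix j assume "j < K t" "E t (missing (S t) (K t)) (anchor t j)"
      then show ?thesis using no_grow[of t j] t t' by simp
    next
      assume "idle (S t) (K t) = sm (S t) \<or> missing (S t) (K t) \<le> idle (S t) (K t)"
      then show ?thesis using no_fresh[OF t'(1) t(2)] e[OF t'(1)] t(2) by simp
    next
      assume a: "sn (S (Suc t)) = Suc (K t)" "sm (S (Suc t)) = sm (S t)"
        "sq (S (Suc t)) (K t) = idle (S t) (K t)"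
        "fits t (S t) (idle (S t) (K t)) (target t (S t) (K t) (idle (S t) (K t))) (sf (S (Suc t)))"
      have Pm: "?P < sm (S t)" "sc (S t) ?P = ?P"
        using P(1) sm_mono[OF t'(2)] old_mono[OF t'(2) P(1)] P'(1) by simp_all
      have f: "fits t (S t) ?P z (sf (S (Suc t)))" using a(4) t idle[OF t'(2)] target[OF t(1)] by simp
      have "anchor (Suc t) i = sf (S (Suc t)) ?P" using a(3) t idle[OF t'(2)] by simp
      moreover have "\<not> r (sf (S (Suc t)) ?P) < r (pi1 z)" "\<not> r (pi2 z) < r (sf (S (Suc t)) ?P)"
        using f Pm unfolding fits_def by blast+
      ultimately have "\<not> blk r (anchor T j) (anchor (Suc t) i)" if "j < i" for j
        using sep[OF that] by simp
      then show ?thesis using unlocked[of "Suc t"] a(1) t(2) t'(3) by simp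
    next
      assume "sn (S (Suc t)) = K t" "sm (S (Suc t)) = sm (S t)"
        "\<not> (target t (S t) (K t) (idle (S t) (K t)) < t \<and>
          (\<exists>F<t. fits t (S t) (idle (S t) (K t)) (target t (S t) (K t) (idle (S t) (K t))) (nthc F)))"
      then show ?thesis using t idle[OF t'(2)] target[OF t(1)] by simp
    }
  qed
  obtain t4 where t4: "t3 \<le> t4" "K t4 = i" using recurrent by blast
  \<comment> \<open>Waiting leaves \<open>sn\<close> at \<open>i\<close>, so the next stage keeps
    exactly \<open>i\<close> classes again and waits in turn.\<close>
  have forever: "K t = i \<and> sm (S t) = sm (S t4)" if "t4 \<le> t" for t
    using that
  proof (induction t rule: dec_induct)
    case (step t)
    then have "t3 \<le> t" "T \<le> Suc t" using t4 t3 t2T by simp_all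
    then have "sn (S (Suc t)) = i" "sm (S (Suc t)) = sm (S t)" using wait step by simp_all
    then show ?case using step i_le[OF fin i2 \<open>T \<le> Suc t\<close>] st.k_le[of "Suc t"] by simp
  qed (use t4 in simp)
  let ?m = "sm (S t4)"
  let ?A = "{d. d < ?m \<and> sc (S t4) d = ?P}"
  \<comment> \<open>The length demanded is the size of the class, which is constant from
    \<open>t4\<close> on.\<close>
  obtain R where R: "finite R" "card ?A \<le> card R"
    "\<And>s. s \<in> R \<Longrightarrow> r (pi1 z) < r s \<and> r s < r (pi2 z)"
    "\<And>s s'. s \<in> R \<Longrightarrow> s' \<in> R \<Longrightarrow> cint r s s' \<subseteq> R"
    using rich[unfolded rich_def, rule_format, OF z, of "card ?A"] by blast
  have "inj_on (\<lambda>d. vl (sv (S t4) d)) ?A" using st.v_inj[of _ t4] by (auto intro!: inj_onI)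
  moreover have "inj_on r R" using inj by (rule inj_on_subset) simp
  moreover have "finite ?A" by simp
  ultimately obtain G where G': "\<forall>d\<in>?A. G d \<in> R"
    "\<forall>d\<in>?A. \<forall>d'\<in>?A. vl (sv (S t4) d) < vl (sv (S t4) d') \<longrightarrow> r (G d) < r (G d')"
    "\<forall>d\<in>?A. \<forall>s\<in>R. r s < r (G d) \<longrightarrow> (\<exists>d'\<in>?A. G d' = s)"
    using ex_initial_embedding[OF _ R(1,2), of "\<lambda>d. vl (sv (S t4) d)" r] by blast
  note G = G'[rule_format]
  obtain F where F: "\<And>d. d < ?m \<Longrightarrow> nthc F d = G d" using ex_nthc[of ?m G] by blast
  obtain b where b: "R \<subseteq> {..<b}" using R(1) finite_nat_iff_bounded by blast
  \<comment> \<open>Late enough for the embedding to have a code below \<open>t\<close> and for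
    \<open>E t\<close> to see the run as part of one block.\<close>
  define t where "t = max t4 (max (Suc F) b)"
  have t: "t4 \<le> t" "F < t" "b \<le> t" unfolding t_def by auto
  have sm_t: "sm (S t) = ?m" using forever[OF t(1)] by simp
  have old: "sv (S t) d = sv (S t4) d" "sc (S t) d = sc (S t4) d" if "d < ?m" for d
    using old_mono[OF t(1) that] by auto
  have "fits t (S t) ?P z (nthc F)"
    unfolding fits_def sm_t
  proof (intro allI impI conjI)
    fix d assume "d < ?m" "sc (S t) d = ?P"
    then have d: "d \<in> ?A" "nthc F d = G d" using old F by auto
    show "\<not> r (nthc F d) < r (pi1 z)" "\<not> r (pi2 z) < r (nthc F d)"
      using R(3)[OF G(1)[OF d(1)]] d(2) by simp_all
    fix d' assume "d' < ?m" "sc (S t) d' = ?P"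
    then have d': "d' \<in> ?A" "nthc F d' = G d'" using old F by auto
    have sub: "cint r (G d) (G d') \<subseteq> R" using R(4) G(1) d(1) d'(1) by blast
    show "E t (nthc F d) (nthc F d')"
      unfolding E_def d(2) d'(2) using sub b t(3) by auto
    show "r (nthc F d) < r (nthc F d')" if "vl (sv (S t) d) < vl (sv (S t) d')"
      using G(2)[OF d(1) d'(1)] that d d' old by simp
    fix y assume "y < t" and y: "r (nthc F d) < r y \<and> r y < r (nthc F d')"
    then have "y \<in> R" using sub d(2) d'(2) by (auto simp: in_cint_iff)
    then obtain d'' where d'': "d'' \<in> ?A" "G d'' = y" using G(3)[OF d'(1)] y d'(2) by auto
    then show "\<exists>d''<?m. sc (S t) d'' = ?P \<and> nthc F d'' = y"
      using old F by (intro exI[of _ d'']) auto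
  qed
  then show False using wait[of t] forever[OF t(1)] t t4(1) by auto
qed

lemma ex_final: "\<exists>t. final t i"
proof (cases "2 \<le> i")
  case True
  then show ?thesis
  proof (induction i rule: dec_induct)
    case base
    show ?case unfolding final_def using st.k2 by blast
  next
    case (step i)
    then show ?case using final_Suc by blast
  qed
next
  case False
  then have "final 0 i" unfolding final_def using st.k2 by (meson le_trans nat_le_linear)
  then show ?thesis ..
qed

text \<open>The last stage at which position \<open>i\<close> is filled.\<close>

definition fill :: "nat \<Rightarrow> nat" where
  "fill i = Max {t. K t \<le> i}"

lemma fill:
  assumes "2 \<le> i"
  shows "K (fill i) = i" "final (fill i) i" "final (Suc (fill i)) (Suc i)"
proof -
  obtain t where t: "final t (Suc i)" using ex_final by blast
  have "{t. K t \<le> i} \<subseteq> {..<t}"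
    using t unfolding final_def by (auto simp: not_le[symmetric])
  then have fin: "finite {t. K t \<le> i}" using finite_subset by blast
  have "0 \<in> {t. K t \<le> i}" using st.k_le[of 0] sn_S0 assms by simp
  then have "fill i \<in> {t. K t \<le> i}" unfolding fill_def using fin by (intro Max_in) auto
  moreover have after: "Suc i \<le> K t" if "fill i < t" for t
  proof (rule ccontr)
    assume "\<not> Suc i \<le> K t"
    then have "t \<in> {t. K t \<le> i}" by simp
    from Max_ge[OF fin this] show False using that unfolding fill_def by simp
  qed
  ultimately have "K (fill i) \<le> i" "Suc i \<le> K (Suc (fill i))" by simp_all
  then show K: "K (fill i) = i" using K_Suc[of "fill i"] by simp
  show "final (Suc (fill i)) (Suc i)" unfolding final_def using after by (simp add: Suc_le_eq)
  have "i \<le> K t" if "fill i \<le> t" for t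
    using that after[of t] K by (cases "t = fill i") auto
  then show "final (fill i) i" unfolding final_def by blast
qed

section \<open>Every element is covered and every class is matched in the limit\<close>

definition fin_covered :: "nat \<Rightarrow> bool" where
  "fin_covered y \<longleftrightarrow> (\<exists>T i. final T i \<and> (\<exists>d. mt (S T) i d \<and> sf (S T) d = y))"

definition fin_matched :: "nat \<Rightarrow> bool" where
  "fin_matched d \<longleftrightarrow> (\<exists>T i. final T i \<and> mt (S T) i d)"

lemma mt_mono: "mt \<sigma> i d \<Longrightarrow> i \<le> i' \<Longrightarrow> mt \<sigma> i' d"
  unfolding mt_def by (meson order_less_le_trans)

lemma covered_below:
  assumes "\<And>y. y < b \<Longrightarrow> fin_covered y"
  shows "\<exists>T n. \<forall>t\<ge>T. \<forall>i\<ge>n. \<forall>y<b. \<exists>d. mt (S t) i d \<and> sf (S t) d = y"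
  using assms
proof (induction b)
  case (Suc b)
  then obtain T n where Tn: "\<forall>t\<ge>T. \<forall>i\<ge>n. \<forall>y<b. \<exists>d. mt (S t) i d \<and> sf (S t) d = y"
    by (metis less_SucI)
  obtain T' i' d where d: "final T' i'" "mt (S T') i' d" "sf (S T') d = b"
    using Suc.prems[of b] unfolding fin_covered_def by blast
  have "\<exists>d. mt (S t) i d \<and> sf (S t) d = y" if "max T T' \<le> t" "max n i' \<le> i" "y < Suc b" for t i y
  proof (cases "y = b")
    case True
    then show ?thesis using final_keeps(2)[OF d(1) _ d(2), of t] d(3) mt_mono[of "S t" i' d i] that by auto
  next
    case False
    then show ?thesis using Tn that by simp
  qed
  then show ?case by blast
qed simp

lemma matched_below:
  assumes "\<And>p. p < b \<Longrightarrow> Q p \<Longrightarrow> fin_matched p"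
  shows "\<exists>T n. \<forall>t\<ge>T. \<forall>i\<ge>n. \<forall>p<b. Q p \<longrightarrow> mt (S t) i p"
  using assms
proof (induction b)
  case (Suc b)
  then obtain T n where Tn: "\<forall>t\<ge>T. \<forall>i\<ge>n. \<forall>p<b. Q p \<longrightarrow> mt (S t) i p"
    by (metis less_SucI)
  show ?case
  proof (cases "Q b")
    case True
    then obtain T' i' where d: "final T' i'" "mt (S T') i' b"
      using Suc.prems[of b] unfolding fin_matched_def by blast
    have "mt (S t) i p" if "max T T' \<le> t" "max n i' \<le> i" "p < Suc b" "Q p" for t i p
    proof (cases "p = b")
      case True
      then show ?thesis using final_keeps(2)[OF d(1) _ d(2), of t] mt_mono[of "S t" i' b i] that by auto
    next
      case False
      then show ?thesis using Tn that by simp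
    qed
    then show ?thesis by blast
  next
    case False
    then have "\<forall>t\<ge>T. \<forall>i\<ge>n. \<forall>p<Suc b. Q p \<longrightarrow> mt (S t) i p" using Tn by (auto simp: less_Suc_eq)
    then show ?thesis by blast
  qed
qed simp

text \<open>Since \<open>K (fill i) = i\<close>, each stage is the last filling of at most one
  position, and the sum of \<open>K\<close> bounds the positions that are filled for the last time
  before \<open>T\<close>.\<close>

lemma fill_large: "\<exists>n. \<forall>i\<ge>n. 2 \<le> i \<and> T \<le> fill i"
proof -
  have "T \<le> fill i" if "2 + (\<Sum>t<T. K t) < i" for i
  proof (rule ccontr)
    assume "\<not> T \<le> fill i"
    then have "K (fill i) \<le> (\<Sum>t<T. K t)" using member_le_sum[of "fill i" "{..<T}" K] by simp
    then show False using fill(1)[of i] that by simp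
  qed
  then show ?thesis by (intro exI[of _ "3 + (\<Sum>t<T. K t)"]) auto
qed

lemma fill_cases:
  assumes "2 \<le> i"
  shows "sq (S (Suc (fill i))) i = sm (S (fill i)) \<and>
      sf (S (Suc (fill i))) (sm (S (fill i))) = missing (S (fill i)) i \<and>
      mt (S (Suc (fill i))) (Suc i) (sm (S (fill i))) \<and>
      (idle (S (fill i)) i = sm (S (fill i)) \<or> missing (S (fill i)) i \<le> idle (S (fill i)) i)
    \<or> sq (S (Suc (fill i))) i = idle (S (fill i)) i \<and> idle (S (fill i)) i < sm (S (fill i)) \<and>
      idle (S (fill i)) i < missing (S (fill i)) i \<and> mt (S (Suc (fill i))) (Suc i) (idle (S (fill i)) i)"
proof -
  note f = fill[OF assms]
  have sn: "Suc i \<le> sn (S (Suc (fill i)))"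
    using f(3) st.k_le[of "Suc (fill i)"] unfolding final_def by (meson order_refl order_trans)
  show ?thesis
  proof (rule st.step_cases[OF step_S[of "fill i"]], goal_cases)
    case (2)
    then show ?case using f(1) unfolding mt_def by auto
  next
    case 3
    then have "sc (S (Suc (fill i))) (idle (S (fill i)) i) = idle (S (fill i)) i"
      using st.step_old(1)[OF step_S[of "fill i"], of "idle (S (fill i)) i"] idleD[of "S (fill i)" i] f(1) by simp
    then show ?case using 3 f(1) unfolding mt_def by auto
  qed (use sn f(1) in auto)
qed

text \<open>Both entries are still in the priority list at the later of the two stages, and the list
  has no repetitions.\<close>

lemma fill_inj:
  assumes "2 \<le> i" "2 \<le> j" "sq (S (Suc (fill i))) i = sq (S (Suc (fill j))) j"
  shows "i = j"
proof -
  let ?u = "max (Suc (fill i)) (Suc (fill j))"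
  have "sq (S ?u) i = sq (S (Suc (fill i))) i" "sq (S ?u) j = sq (S (Suc (fill j))) j"
    using final_keeps(1)[OF fill(3)[OF assms(1)], of ?u i] final_keeps(1)[OF fill(3)[OF assms(2)], of ?u j]
    by simp_all
  moreover have "Suc i \<le> K ?u" "Suc j \<le> K ?u"
    using fill(3)[OF assms(1)] fill(3)[OF assms(2)] unfolding final_def by simp_all
  then have "i < sn (S ?u)" "j < sn (S ?u)" using st.k_le[of ?u] by simp_all
  ultimately show ?thesis using st.q_inj[of i ?u j] assms(3) by simp
qed

lemma not_inj_bounded:
  fixes h :: "nat \<Rightarrow> nat"
  assumes "\<And>i. n \<le> i \<Longrightarrow> h i < b" "\<And>i j. n \<le> i \<Longrightarrow> n \<le> j \<Longrightarrow> h i = h j \<Longrightarrow> i = j"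
  shows False
proof -
  have "inj_on h {n..}" using assms(2) by (intro inj_onI) simp
  moreover have "finite (h ` {n..})" by (rule finite_subset[of _ "{..<b}"]) (use assms(1) in auto)
  ultimately have "finite {n..}" using finite_imageD by blast
  then show False using infinite_Ici by blast
qed

text \<open>Let \<open>y\<close> be the least exception. At the last filling of any late position
  \<open>y\<close> is the missing element, and a new class would cover it for good. So each of these
  fillings goes to an idle class with representative below \<open>y\<close>, but the representatives
  are distinct for distinct positions.\<close>

lemma all_covered: "fin_covered y"
proof (induction y rule: less_induct)
  case (less y)
  show ?case
  proof (rule ccontr)
    assume y: "\<not> fin_covered y"
    obtain T n where Tn: "\<And>t i z. T \<le> t \<Longrightarrow> n \<le> i \<Longrightarrow> z < y \<Longrightarrow> \<exists>d. mt (S t) i d \<and> sf (S t) d = z"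
      using covered_below[OF less] by blast
    obtain n' where n': "\<And>i. n' \<le> i \<Longrightarrow> 2 \<le> i \<and> T \<le> fill i" using fill_large by blast
    have "sq (S (Suc (fill i))) i < y" if i: "max n n' \<le> i" for i
    proof -
      have i': "2 \<le> i" "T \<le> fill i" "n \<le> i" using n'[of i] i by auto
      note f = fill[OF i'(1)]
      have "\<not> missing (S (fill i)) i < y"
        using Tn[OF i'(2,3), of "missing (S (fill i)) i"] missingI[of "S (fill i)" i] by blast
      moreover have "missing (S (fill i)) i \<le> y"
        by (rule missing_le) (use y f(2) in \<open>auto simp: fin_covered_def\<close>)
      ultimately have e: "missing (S (fill i)) i = y" by simp
      consider "sf (S (Suc (fill i))) (sm (S (fill i))) = missing (S (fill i)) i"
          "mt (S (Suc (fill i))) (Suc i) (sm (S (fill i)))"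
        | "sq (S (Suc (fill i))) i = idle (S (fill i)) i" "idle (S (fill i)) i < missing (S (fill i)) i"
        using fill_cases[OF i'(1)] by blast
      then show ?thesis
      proof cases
        case 1
        then have "fin_covered y" unfolding fin_covered_def using e f(3) by blast
        then show ?thesis using y by simp
      qed (use e in simp)
    qed
    then show False
      using not_inj_bounded[of "max n n'" "\<lambda>i. sq (S (Suc (fill i))) i" y] fill_inj n' by simp
  qed
qed

text \<open>The dual count. If \<open>p\<close> is the least exception, the last filling of any late
  position creates a class for a missing element that is at most \<open>p\<close>, and these images
  are distinct for distinct positions.\<close>

lemma all_matched:
  assumes "p < sm (S t)" "sc (S t) p = p"
  shows "fin_matched p"
  using assms
proof (induction p arbitrary: t rule: less_induct)
  case (less p)
  show ?case
  proof (rule ccontr)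
    assume p: "\<not> fin_matched p"
    let ?Q = "\<lambda>p'. p' < sm (S t) \<and> sc (S t) p' = p'"
    obtain T n where Tn: "\<And>u i p'. T \<le> u \<Longrightarrow> n \<le> i \<Longrightarrow> p' < p \<Longrightarrow> ?Q p' \<Longrightarrow> mt (S u) i p'"
      using matched_below[of p ?Q] less.IH by blast
    obtain n' where n': "\<And>i. n' \<le> i \<Longrightarrow> 2 \<le> i \<and> max t T \<le> fill i" using fill_large by blast
    have *: "missing (S (fill i)) i \<le> p \<and> mt (S (Suc (fill i))) (Suc i) (sq (S (Suc (fill i))) i) \<and>
        sf (S (Suc (fill i))) (sq (S (Suc (fill i))) i) = missing (S (fill i)) i" if i: "max n n' \<le> i" for i
    proof -
      have i': "2 \<le> i" "T \<le> fill i" "t \<le> fill i" "n \<le> i" using n'[of i] i by auto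
      note f = fill[OF i'(1)]
      have pm: "p < sm (S (fill i))" "sc (S (fill i)) p = p"
        using less.prems sm_mono[OF i'(3)] old_mono[OF i'(3) less.prems(1)] by simp_all
      have "\<not> mt (S (fill i)) i p" using p f(2) unfolding fin_matched_def by blast
      then have le: "idle (S (fill i)) i \<le> p" using idle_least[OF pm(2)] by blast
      have idle: "idle (S (fill i)) i = p"
      proof (rule ccontr)
        assume "idle (S (fill i)) i \<noteq> p"
        then have lt: "idle (S (fill i)) i < p" using le by simp
        then have "idle (S (fill i)) i < sm (S t)" "idle (S (fill i)) i < sm (S (fill i))"
          using less.prems(1) pm by simp_all
        then have "?Q (idle (S (fill i)) i)" "\<not> mt (S (fill i)) i (idle (S (fill i)) i)"
          using idleD[of "S (fill i)" i] old_mono[OF i'(3), of "idle (S (fill i)) i"] by auto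
        then show False using Tn[OF i'(2,4) lt] by blast
      qed
      consider "sq (S (Suc (fill i))) i = sm (S (fill i))"
          "sf (S (Suc (fill i))) (sm (S (fill i))) = missing (S (fill i)) i"
          "mt (S (Suc (fill i))) (Suc i) (sm (S (fill i)))" "missing (S (fill i)) i \<le> p"
        | "mt (S (Suc (fill i))) (Suc i) (idle (S (fill i)) i)"
        using fill_cases[OF i'(1)] idle pm(1) by auto
      then show ?thesis
      proof cases
        case 2
        then have "fin_matched p" unfolding fin_matched_def using idle f(3) by metis
        then show ?thesis using p by simp
      qed simp
    qed
    have inj: "i = j" if "max n n' \<le> i" "max n n' \<le> j" "missing (S (fill i)) i = missing (S (fill j)) j" for i j
    proof -
      let ?u = "max (Suc (fill i)) (Suc (fill j))"
      let ?a = "sq (S (Suc (fill i))) i" and ?b = "sq (S (Suc (fill j))) j"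
      have ij: "2 \<le> i" "2 \<le> j" using n' that by auto
      note fi = fill(3)[OF ij(1)] and fj = fill(3)[OF ij(2)]
      have a: "mt (S ?u) (Suc i) ?a" "sf (S ?u) ?a = missing (S (fill i)) i"
        using final_keeps(2)[OF fi, of ?u ?a] *[OF that(1)] by simp_all
      have b: "mt (S ?u) (Suc j) ?b" "sf (S ?u) ?b = missing (S (fill j)) j"
        using final_keeps(2)[OF fj, of ?u ?b] *[OF that(2)] by simp_all
      have "Suc i \<le> K ?u" "Suc j \<le> K ?u" using fi fj unfolding final_def by simp_all
      then have "?a = ?b" using st.f_inj[OF mt_mono[OF a(1)] mt_mono[OF b(1)]] a(2) b(2) that(3) by simp
      then show "i = j" using fill_inj[OF ij] by simp
    qed
    show False
      using not_inj_bounded[of "max n n'" "\<lambda>i. missing (S (fill i)) i" "Suc p"] inj * by (simp add: less_Suc_eq_le)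
  qed
qed

end

subsection \<open>From limit computable blocks to a computable copy\<close>

text \<open>
  Elements are created from the middle of their blocks outwards, so that a finite part of the
  order never acquires new elements inside of a block.
\<close>

locale block_presentation =
  fixes v c :: "nat \<Rightarrow> nat"
  assumes v_inj: "vl (v i) = vl (v j) \<Longrightarrow> i = j"
    and c_le: "c i \<le> i" and c_idem: "c (c i) = c i"
    and c_convex: "c i = c j \<Longrightarrow> vl (v i) < vl (v l) \<Longrightarrow> vl (v l) < vl (v j) \<Longrightarrow> c l = c i"
    and c_outward: "c i = c j \<Longrightarrow> vl (v i) < vl (v l) \<Longrightarrow> vl (v l) < vl (v j) \<Longrightarrow> l < max i j"
    and v_ends: "vl (v 0) \<le> vl (v i)" "vl (v i) \<le> vl (v 1)"
    and c_dense: "vl (v i) < vl (v j) \<Longrightarrow> c i \<noteq> c j \<Longrightarrow>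
      \<exists>l. vl (v i) < vl (v l) \<and> vl (v l) < vl (v j) \<and> c l \<noteq> c i \<and> c l \<noteq> c j"

section \<open>Reading off the limit copy\<close>

context unfold_run
begin

lemma sm_unbounded: "\<exists>t. d < sm (S t)"
proof -
  obtain t where t: "final t (Suc d)" using ex_final by blast
  have n: "Suc d \<le> sn (S t)" using t st.k_le[of t] unfolding final_def by (meson order_refl order_trans)
  have "inj_on (sq (S t)) {..<sn (S t)}" using st.q_inj[of _ t] by (auto intro!: inj_onI)
  moreover have "sq (S t) ` {..<sn (S t)} \<subseteq> {..<sm (S t)}" using st.q_less[of _ t] by auto
  ultimately have "card {..<sn (S t)} \<le> card {..<sm (S t)}" by (intro card_inj_on_le) auto
  then show ?thesis using n by (intro exI[of _ t]) simp
qed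

definition birth :: "nat \<Rightarrow> nat" where "birth d = (LEAST t. d < sm (S t))"
definition out_v :: "nat \<Rightarrow> nat" where "out_v d = sv (S (birth d)) d"
definition out_c :: "nat \<Rightarrow> nat" where "out_c d = sc (S (birth d)) d"

lemma out_eq: "d < sm (S t) \<Longrightarrow> out_v d = sv (S t) d \<and> out_c d = sc (S t) d"
proof -
  assume d: "d < sm (S t)"
  have "birth d \<le> t" unfolding birth_def by (rule Least_le) (rule d)
  moreover have "d < sm (S (birth d))" unfolding birth_def by (rule LeastI_ex) (rule sm_unbounded)
  ultimately show ?thesis unfolding out_v_def out_c_def using old_mono by simp
qed

lemma C_out: "C out_v" "C out_c"
proof -
  have "C birth" unfolding birth_def
    by (intro C_Least sm_unbounded dec_rules C_sel C_comp[OF C_S])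
  then show "C out_v" "C out_c" unfolding out_v_def out_c_def
    by (intro C_sel C_comp[OF C_S] C_id; assumption)+
qed

lemma matched_any: "fin_matched d"
proof -
  obtain t where t: "d < sm (S t)" using sm_unbounded by blast
  let ?p = "sc (S t) d"
  have p: "?p < sm (S t)" "sc (S t) ?p = ?p" using st.c_le[OF t] st.c_idem[OF t] t by simp_all
  then obtain T i where Ti: "final T i" "mt (S T) i ?p" using all_matched unfolding fin_matched_def by blast
  let ?u = "max t T"
  have "mt (S ?u) i ?p" using final_keeps(2)[OF Ti(1) _ Ti(2), of ?u] by simp
  moreover have "sc (S ?u) ?p = ?p" "sc (S ?u) d = ?p"
    using old_mono[of t ?u] p t by simp_all
  moreover have "d < sm (S ?u)" using sm_mono[of t ?u] t by simp
  ultimately have "mt (S ?u) i d" unfolding mt_def by simp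
  moreover have "final ?u i" using final_mono[OF Ti(1)] by simp
  ultimately show ?thesis unfolding fin_matched_def by blast
qed

text \<open>Only the labels and the classes have to lie in \<open>C\<close>; the isomorphism onto
  the given order may be chosen freely.\<close>

definition out_f :: "nat \<Rightarrow> nat" where
  "out_f d = (SOME y. \<exists>T i. final T i \<and> mt (S T) i d \<and> sf (S T) d = y)"

lemma out_f: "\<exists>T i. final T i \<and> mt (S T) i d \<and> sf (S T) d = out_f d"
  unfolding out_f_def
  by (rule someI_ex) (use matched_any in \<open>auto simp: fin_matched_def\<close>)

lemma out_f_eq:
  assumes "final T i" "mt (S T) i d"
  shows "sf (S T) d = out_f d"
proof -
  obtain T' i' where T': "final T' i'" "mt (S T') i' d" "sf (S T') d = out_f d" using out_f by blast
  show ?thesis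
    using final_keeps(2)[OF assms(1) _ assms(2), of "max T T'"]
      final_keeps(2)[OF T'(1) _ T'(2), of "max T T'"] T'(3) by simp
qed

text \<open>Reduces statements about the limit to the invariant of a single stage.\<close>

lemma joint:
  assumes "finite D"
  shows "\<exists>T i. 2 \<le> i \<and> final T i \<and> (\<forall>d\<in>D. mt (S T) i d \<and> sf (S T) d = out_f d)"
  using assms
proof (induction D)
  case empty
  then show ?case using ex_final[of 2] by auto
next
  case (insert d D)
  then obtain T i where Ti: "2 \<le> i" "final T i" "\<And>d. d \<in> D \<Longrightarrow> mt (S T) i d \<and> sf (S T) d = out_f d" by blast
  obtain T' i' where T': "final T' i'" "mt (S T') i' d" "sf (S T') d = out_f d" using out_f by blast
  let ?T = "max T T'" and ?i = "max i i'"
  have fin: "final ?T ?i" using Ti(2) T'(1) unfolding final_def by simp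
  have "mt (S ?T) ?i d \<and> sf (S ?T) d = out_f d"
    using final_keeps(2)[OF T'(1) _ T'(2), of ?T] T'(3) mt_mono[of "S ?T" i' d ?i] by simp
  moreover have "mt (S ?T) ?i d' \<and> sf (S ?T) d' = out_f d'" if "d' \<in> D" for d'
    using final_keeps(2)[OF Ti(2), of ?T d'] Ti(3)[OF that] mt_mono[of "S ?T" i d' ?i] by simp
  ultimately show ?case using fin Ti(1) by (intro exI[of _ ?T] exI[of _ ?i]) auto
qed

lemma out_less_iff: "vl (out_v d) < vl (out_v d') \<longleftrightarrow> r (out_f d) < r (out_f d')"
proof -
  obtain T i where T: "final T i" "mt (S T) i d" "sf (S T) d = out_f d" "mt (S T) i d'" "sf (S T) d' = out_f d'"
    using joint[of "{d, d'}"] by auto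
  have "i \<le> K T" using T(1) unfolding final_def by simp
  then have m: "mt (S T) (K T) d" "mt (S T) (K T) d'" using T(2,4) mt_mono by blast+
  show ?thesis using st.f_less_iff[OF m] T(3,5) out_eq[OF st.mt_less[OF m(1)]] out_eq[OF st.mt_less[OF m(2)]]
    by simp
qed

text \<open>One direction is the invariant. In the other one the block shared by the images contains
  the anchors of both classes, and final anchors at different positions are in different
  blocks.\<close>

lemma out_blk: "out_c d = out_c d' \<longleftrightarrow> blk r (out_f d) (out_f d')"
proof -
  obtain T i where T: "final T i" "mt (S T) i d" "sf (S T) d = out_f d" "mt (S T) i d'" "sf (S T) d' = out_f d'"
    and i2: "2 \<le> i"
    using joint[of "{d, d'}"] by auto
  have "i \<le> K T" using T(1) unfolding final_def by simp
  then have m: "mt (S T) (K T) d" "mt (S T) (K T) d'" using T(2,4) mt_mono by blast+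
  have eq: "out_c d = sc (S T) d" "out_c d' = sc (S T) d'"
    using out_eq[OF st.mt_less[OF m(1)]] out_eq[OF st.mt_less[OF m(2)]] by simp_all
  show ?thesis
  proof
    assume "out_c d = out_c d'"
    then have "E T (sf (S T) d) (sf (S T) d')" using st.f_E[OF st.mt_sn[OF m(1)] st.mt_sn[OF m(2)]] eq by simp
    then show "blk r (out_f d) (out_f d')" using E_imp_blk T(3,5) by simp
  next
    assume b: "blk r (out_f d) (out_f d')"
    obtain j l where j: "j < i" "sc (S T) d = sq (S T) j" and l: "l < i" "sc (S T) d' = sq (S T) l"
      using T(2,4) unfolding mt_def by blast
    have "blk r (anchor T j) (out_f d)" "blk r (anchor T l) (out_f d')"
      using blk_anchor[OF T(1) i2 order_refl T(2) j] blk_anchor[OF T(1) i2 order_refl T(4) l] T(3,5) by simp_all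
    then have "blk r (anchor T j) (anchor T l)"
      using b blk_trans blk_commute by meson
    then have "j = l" using anchor_sep[OF T(1) i2 j(1) l(1)] by blast
    then show "out_c d = out_c d'" using j l eq by simp
  qed
qed

lemma bij_out_f: "bij out_f"
proof (rule bijI)
  show "inj out_f"
  proof (rule injI)
    fix d d' assume eq: "out_f d = out_f d'"
    obtain T i where T: "final T i" "mt (S T) i d" "sf (S T) d = out_f d" "mt (S T) i d'" "sf (S T) d' = out_f d'"
      using joint[of "{d, d'}"] by auto
    have "i \<le> K T" using T(1) unfolding final_def by simp
    then show "d = d'" using st.f_inj[of T d d'] T eq mt_mono by simp
  qed
  show "surj out_f"
    unfolding surj_def
  proof
    fix y
    obtain T i d where "final T i" "mt (S T) i d" "sf (S T) d = y"
      using all_covered[of y] unfolding fin_covered_def by blast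
    then show "\<exists>x. y = out_f x" using out_f_eq by metis
  qed
qed

lemma block_presentation_out: "block_presentation out_v out_c"
proof
  fix i j l
  obtain t0 where t0: "i + j + l < sm (S t0)" using sm_unbounded by blast
  then have t: "i < sm (S t0)" "j < sm (S t0)" "l < sm (S t0)" "0 < sm (S t0)" "1 < sm (S t0)"
    using st.m2[of t0] by simp_all
  note eq = out_eq[OF t(1)] out_eq[OF t(2)] out_eq[OF t(3)] out_eq[OF t(4)] out_eq[OF t(5)]
  show "vl (out_v i) = vl (out_v j) \<Longrightarrow> i = j" using st.v_inj[OF t(1,2)] eq by simp
  show le: "out_c i \<le> i" using st.c_le[OF t(1)] eq by simp
  have "sc (S t0) i < sm (S t0)" using st.c_le[OF t(1)] t(1) by simp
  then show "out_c (out_c i) = out_c i" using st.c_idem[OF t(1)] eq out_eq[of "sc (S t0) i" t0] by simp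
  show "out_c i = out_c j \<Longrightarrow> vl (out_v i) < vl (out_v l) \<Longrightarrow> vl (out_v l) < vl (out_v j) \<Longrightarrow> out_c l = out_c i"
    using st.c_convex[OF t(1,2,3)] eq by simp
  show "out_c i = out_c j \<Longrightarrow> vl (out_v i) < vl (out_v l) \<Longrightarrow> vl (out_v l) < vl (out_v j) \<Longrightarrow> l < max i j"
    using st.c_outward[OF t(1,2,3)] eq by simp
  show "vl (out_v 0) \<le> vl (out_v i)" "vl (out_v i) \<le> vl (out_v 1)"
    using st.v_ends[OF t(1)] eq by simp_all
  assume ij: "vl (out_v i) < vl (out_v j)" "out_c i \<noteq> out_c j"
  then have "r (out_f i) < r (out_f j)" "\<not> blk r (out_f i) (out_f j)" using out_less_iff out_blk by simp_all
  then obtain a b where ab: "r a < r b" "r (out_f i) < r a" "\<not> blk r (out_f i) a" "r b < r (out_f j)"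
      "\<not> blk r b (out_f j)"
    using ex_gap[of "{out_f i}" "{out_f j}"] by auto
  obtain x where x: "out_f x = a" using bij_out_f by (metis bij_pointE)
  have "\<not> blk r a (out_f j)"
  proof
    assume "blk r a (out_f j)"
    moreover have "b \<in> cint r (out_f j) a" using ab by (simp add: in_cint_iff)
    ultimately show False using ab(5) blk_mono[of r "out_f j" a b] blk_commute by blast
  qed
  then have "vl (out_v i) < vl (out_v x) \<and> vl (out_v x) < vl (out_v j) \<and> out_c x \<noteq> out_c i \<and> out_c x \<noteq> out_c j"
    unfolding out_less_iff out_blk x using ab blk_commute by auto
  then show "\<exists>l. vl (out_v i) < vl (out_v l) \<and> vl (out_v l) < vl (out_v j) \<and> out_c l \<noteq> out_c i \<and> out_c l \<noteq> out_c j" ..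
qed

end

lemma (in unfold_classes) ex_block_presentation:
  "\<exists>v c f. C v \<and> C c \<and> block_presentation v c \<and> bij f \<and> (\<forall>i j. vl (v i) < vl (v j) \<longleftrightarrow> r (f i) < r (f j))"
proof -
  obtain s0 where s0: "inv 0 s0" "sn s0 = 2" using ex_initial by blast
  have ex: "\<exists>s'. step t s s'" if "inv t s" for t s
  proof -
    interpret unfold_stage C r a0 b0 t s "kept t s" by unfold_locales (simp_all add: that)
    show ?thesis by (rule ex_step)
  qed
  have pres: "inv (Suc t) s'" if "inv t s" "step t s s'" for t s s'
  proof -
    interpret unfold_stage C r a0 b0 t s "kept t s" by unfold_locales (simp_all add: that)
    show ?thesis by (rule inv_step[OF that(2)])
  qed
  obtain S where S: "C S" "S 0 = s0" "\<And>t. inv t (S t)" "\<And>t. step t (S t) (S (Suc t))"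
    by (rule least_run[of step inv s0]) (use dec_step s0 ex pres in blast)+
  interpret unfold_run C r a0 b0 S by unfold_locales (use S s0 in simp_all)
  show ?thesis using C_out block_presentation_out bij_out_f out_less_iff by blast
qed

lemma neighbour_below:
  fixes g :: "nat \<Rightarrow> real"
  assumes "i < k" "g i < x"
  obtains i0 where "i0 < k" "g i0 < x" "\<And>j. j < k \<Longrightarrow> g j < x \<Longrightarrow> g j \<le> g i0"
proof -
  obtain i0 where "i0 \<in> {j. j < k \<and> g j < x}" "\<And>z. z \<in> {j. j < k \<and> g j < x} \<Longrightarrow> - g i0 \<le> - g z"
    using finite_ex_min[of "{j. j < k \<and> g j < x}" "\<lambda>z. - g z"] assms by auto
  then show thesis using that[of i0] by simp
qed

lemma neighbour_above:
  fixes g :: "nat \<Rightarrow> real"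
  assumes "i < k" "x < g i"
  obtains i0 where "i0 < k" "x < g i0" "\<And>j. j < k \<Longrightarrow> x < g j \<Longrightarrow> g i0 \<le> g j"
proof -
  obtain i0 where "i0 \<in> {j. j < k \<and> x < g j}" "\<And>z. z \<in> {j. j < k \<and> x < g j} \<Longrightarrow> g i0 \<le> g z"
    using finite_ex_min[of "{j. j < k \<and> x < g j}" g] assms by auto
  then show thesis using that[of i0] by simp
qed

text \<open>
  A state codes the number \<open>tm\<close> of elements of the computable copy with their labels \<open>tv\<close>, and the
  images \<open>tg\<close> of the first \<open>tn\<close> elements of the approximated order.
\<close>

definition "tm \<tau> = nthc \<tau> 0"
definition "tn \<tau> = nthc \<tau> 1"
definition "tv \<tau> d = nthc (nthc \<tau> 2) d"
definition "tg \<tau> i = nthc (nthc \<tau> 3) i"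

lemma ex_tstate: "\<exists>\<tau>. tm \<tau> = m \<and> tn \<tau> = n \<and> (\<forall>d<N. tv \<tau> d = v d \<and> tg \<tau> d = g d)"
proof -
  obtain v' where v': "\<forall>d<N. nthc v' d = v d" using ex_nthc[of N v] by blast
  obtain g' where g': "\<forall>d<N. nthc g' d = g d" using ex_nthc[of N g] by blast
  let ?\<tau> = "pr m (pr n (pr v' (pr g' 0)))"
  have "tm ?\<tau> = m" "tn ?\<tau> = n" "\<forall>d<N. tv ?\<tau> d = v d" "\<forall>d<N. tg ?\<tau> d = g d"
    using v' g' by (simp_all add: tm_def tn_def tv_def tg_def)
  then show ?thesis by blast
qed

lemma C_tsel: "computable_fun f \<Longrightarrow> computable_fun (\<lambda>x. tm (f x))"
  "computable_fun f \<Longrightarrow> computable_fun (\<lambda>x. tn (f x))"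
  "computable_fun f \<Longrightarrow> computable_fun g \<Longrightarrow> computable_fun (\<lambda>x. tv (f x) (g x))"
  "computable_fun f \<Longrightarrow> computable_fun g \<Longrightarrow> computable_fun (\<lambda>x. tg (f x) (g x))"
  unfolding tm_def tn_def tv_def tg_def by (intro cf.dec_rules; assumption)+

section \<open>Step relation and invariant of the second construction\<close>

locale approx_presentation = block_presentation v c for v c +
  fixes vs cs :: "nat \<Rightarrow> nat \<Rightarrow> nat"
  assumes computable_vs: "computable_fun (\<lambda>z. vs (pi1 z) (pi2 z))"
    and computable_cs: "computable_fun (\<lambda>z. cs (pi1 z) (pi2 z))"
    and limit: "\<forall>\<^sub>F s in sequentially. vs s i = v i \<and> cs s i = c i"
    and start: "i < 2 \<Longrightarrow> vs s i = v i \<and> cs s i = c i"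
begin

lemma C_vs: "computable_fun f \<Longrightarrow> computable_fun g \<Longrightarrow> computable_fun (\<lambda>x. vs (f x) (g x))"
  by (rule cf.C_comp2[OF computable_vs])

lemma C_cs: "computable_fun f \<Longrightarrow> computable_fun g \<Longrightarrow> computable_fun (\<lambda>x. cs (f x) (g x))"
  by (rule cf.C_comp2[OF computable_cs])

lemmas dec_rules2 = C_tsel C_vs C_cs cf.dec_rules

abbreviation "w s i \<equiv> vl (vs s i)"

definition agree :: "nat \<Rightarrow> nat \<Rightarrow> bool" where
  "agree s k \<longleftrightarrow> (\<forall>i<k. vs s i = vs (Suc s) i \<and> cs s i = cs (Suc s) i)"

text \<open>Wrong approximations need not describe any finite order; an element is mapped only if
  they do. Density of the classes is left out, since a finite part cannot exhibit it.\<close>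

definition ok :: "nat \<Rightarrow> nat \<Rightarrow> bool" where
  "ok s k \<longleftrightarrow> (\<forall>i<k. \<forall>j<k. (w s i = w s j \<longrightarrow> i = j) \<and> cs s i \<le> i \<and> cs s (cs s i) = cs s i \<and>
    w s 0 \<le> w s i \<and> w s i \<le> w s 1 \<and>
    (\<forall>l<k. cs s i = cs s j \<longrightarrow> w s i < w s l \<longrightarrow> w s l < w s j \<longrightarrow> cs s l = cs s i \<and> l < max i j))"

text \<open>A change in the approximation of one element costs this element and all later ones their
  images.\<close>

definition keep :: "nat \<Rightarrow> nat \<Rightarrow> nat" where
  "keep s \<tau> = (LEAST k. k = tn \<tau> \<or> \<not> agree s (Suc k))"

definition fitting :: "nat \<Rightarrow> nat \<Rightarrow> nat \<Rightarrow> nat \<Rightarrow> bool" where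
  "fitting s \<tau> k x \<longleftrightarrow> (\<forall>i<k. (w s i < w s k \<longrightarrow> vl (tv \<tau> (tg \<tau> i)) < vl x) \<and>
    (w s k < w s i \<longrightarrow> vl x < vl (tv \<tau> (tg \<tau> i))))"

text \<open>Elements of the copy that have lost their preimage are tried in the order of their
  numbers. This is what brings each of them back into the image in the end.\<close>

definition spare :: "nat \<Rightarrow> nat \<Rightarrow> nat \<Rightarrow> nat" where
  "spare s \<tau> k = (LEAST d. d = tm \<tau> \<or> (\<forall>i<k. tg \<tau> i \<noteq> d) \<and> fitting s \<tau> k (tv \<tau> d))"

text \<open>An element that does not represent its class is placed directly beside an existing
  member, so that no discarded element gets between them.\<close>

definition attach :: "nat \<Rightarrow> nat \<Rightarrow> nat \<Rightarrow> nat \<Rightarrow> bool" where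
  "attach s \<tau> k x \<longleftrightarrow> fitting s \<tau> k x \<and> (\<forall>d<tm \<tau>. vl (tv \<tau> d) \<noteq> vl x) \<and>
    (cs s k \<noteq> k \<longrightarrow> (\<exists>i<k. cs s i = cs s k \<and> (\<forall>d<tm \<tau>.
      \<not> (vl (tv \<tau> (tg \<tau> i)) < vl (tv \<tau> d) \<and> vl (tv \<tau> d) < vl x) \<and>
      \<not> (vl x < vl (tv \<tau> d) \<and> vl (tv \<tau> d) < vl (tv \<tau> (tg \<tau> i))))))"

text \<open>A discarded element is reused only for a \<open>k\<close> that represents its own class,
  when no smaller number belongs to this class. This restriction makes splits permanent.\<close>

definition step2 :: "nat \<Rightarrow> nat \<Rightarrow> nat \<Rightarrow> bool" where
  "step2 s \<tau> \<tau>' \<longleftrightarrow>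
    (\<forall>d<tm \<tau>. tv \<tau>' d = tv \<tau> d) \<and> (\<forall>i<keep s \<tau>. tg \<tau>' i = tg \<tau> i) \<and>
    (if ok (Suc s) (Suc (keep s \<tau>)) then
       tn \<tau>' = Suc (keep s \<tau>) \<and>
       (if cs (Suc s) (keep s \<tau>) = keep s \<tau> \<and> spare (Suc s) \<tau> (keep s \<tau>) < tm \<tau>
        then tm \<tau>' = tm \<tau> \<and> tg \<tau>' (keep s \<tau>) = spare (Suc s) \<tau> (keep s \<tau>)
        else tm \<tau>' = Suc (tm \<tau>) \<and> tg \<tau>' (keep s \<tau>) = tm \<tau> \<and>
          attach (Suc s) \<tau> (keep s \<tau>) (tv \<tau>' (tm \<tau>)))
     else tn \<tau>' = keep s \<tau> \<and> tm \<tau>' = tm \<tau>)"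

lemma dec_agree: "computable_fun f \<Longrightarrow> computable_fun g \<Longrightarrow> cf.dec (\<lambda>x. agree (f x) (g x))"
  by (rule cf.dec_comp2[of agree]) (unfold agree_def, intro dec_rules2)

lemma dec_ok: "computable_fun f \<Longrightarrow> computable_fun g \<Longrightarrow> cf.dec (\<lambda>x. ok (f x) (g x))"
  by (rule cf.dec_comp2[of ok]) (unfold ok_def less_max_iff_disj, intro dec_rules2)

lemma C_keep: "computable_fun f \<Longrightarrow> computable_fun g \<Longrightarrow> computable_fun (\<lambda>x. keep (f x) (g x))"
  by (rule cf.C_comp2[of keep]) (unfold keep_def, intro cf.C_Least dec_rules2 dec_agree, auto)

lemma C_spare: "computable_fun f \<Longrightarrow> computable_fun g \<Longrightarrow> computable_fun h \<Longrightarrow>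
    computable_fun (\<lambda>x. spare (f x) (g x) (h x))"
  by (rule cf.C_comp3[of spare]) (unfold spare_def fitting_def, intro cf.C_Least dec_rules2, auto)

lemma dec_step2: "cf.dec (\<lambda>z. step2 (pi1 z) (pi1 (pi2 z)) (pi2 (pi2 z)))"
  unfolding step2_def attach_def fitting_def
  by (intro dec_rules2 dec_ok C_keep C_spare)

lemma keep_props:
  shows keep_le: "keep s \<tau> \<le> tn \<tau>"
    and keep_maximal: "keep s \<tau> < tn \<tau> \<Longrightarrow> \<not> agree s (Suc (keep s \<tau>))"
    and agree_keep: "agree s (keep s \<tau>)"
proof -
  let ?P = "\<lambda>k. k = tn \<tau> \<or> \<not> agree s (Suc k)"
  have P: "?P (keep s \<tau>)" unfolding keep_def by (rule LeastI[of ?P "tn \<tau>"]) simp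
  show "keep s \<tau> \<le> tn \<tau>" unfolding keep_def by (rule Least_le) simp
  show "keep s \<tau> < tn \<tau> \<Longrightarrow> \<not> agree s (Suc (keep s \<tau>))" using P by simp
  show "agree s (keep s \<tau>)"
  proof (cases "keep s \<tau>")
    case 0
    then show ?thesis by (simp add: agree_def)
  next
    case (Suc k)
    then have "k < keep s \<tau>" by simp
    then have "\<not> ?P k" unfolding keep_def by (rule not_less_Least)
    then show ?thesis using Suc by simp
  qed
qed

lemma spare_props:
  shows spareD: "spare s \<tau> k < tm \<tau> \<Longrightarrow>
      (\<forall>i<k. tg \<tau> i \<noteq> spare s \<tau> k) \<and> fitting s \<tau> k (tv \<tau> (spare s \<tau> k))"
    and spare_le: "(\<And>i. i < k \<Longrightarrow> tg \<tau> i \<noteq> d) \<Longrightarrow> fitting s \<tau> k (tv \<tau> d) \<Longrightarrow> spare s \<tau> k \<le> d"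
proof -
  let ?P = "\<lambda>d. d = tm \<tau> \<or> (\<forall>i<k. tg \<tau> i \<noteq> d) \<and> fitting s \<tau> k (tv \<tau> d)"
  have "?P (spare s \<tau> k)" unfolding spare_def by (rule LeastI[of ?P "tm \<tau>"]) simp
  then show "spare s \<tau> k < tm \<tau> \<Longrightarrow>
      (\<forall>i<k. tg \<tau> i \<noteq> spare s \<tau> k) \<and> fitting s \<tau> k (tv \<tau> (spare s \<tau> k))" by auto
  show "(\<And>i. i < k \<Longrightarrow> tg \<tau> i \<noteq> d) \<Longrightarrow> fitting s \<tau> k (tv \<tau> d) \<Longrightarrow> spare s \<tau> k \<le> d"
    unfolding spare_def by (rule Least_le) blast
qed

lemma okD:
  assumes "ok s k" "i < k" "j < k"
  shows "w s i = w s j \<Longrightarrow> i = j" "cs s i \<le> i" "cs s (cs s i) = cs s i" "w s 0 \<le> w s i" "w s i \<le> w s 1"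
    "l < k \<Longrightarrow> cs s i = cs s j \<Longrightarrow> w s i < w s l \<Longrightarrow> w s l < w s j \<Longrightarrow> cs s l = cs s i"
    "l < k \<Longrightarrow> cs s i = cs s j \<Longrightarrow> w s i < w s l \<Longrightarrow> w s l < w s j \<Longrightarrow> l < max i j"
  using assms unfolding ok_def by blast+

lemma ok_mono: "ok s k \<Longrightarrow> k' \<le> k \<Longrightarrow> ok s k'"
  unfolding ok_def by (meson order_less_le_trans)

lemma agreeD: "agree s k \<Longrightarrow> i < k \<Longrightarrow> vs (Suc s) i = vs s i \<and> cs (Suc s) i = cs s i"
  unfolding agree_def by simp

lemma ok_agree:
  assumes ok: "ok s k" and a: "agree s k" and "2 \<le> k"
  shows "ok (Suc s) k"
proof -
  have eq: "vs (Suc s) i = vs s i" "cs (Suc s) i = cs s i" if "i < k" for i using agreeD[OF a that] by auto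
  have "cs s i < k" if "i < k" for i using okD(2)[OF ok that that] that by simp
  note c = this
  show ?thesis
    unfolding ok_def
  proof (intro allI impI conjI)
    fix i j assume i: "i < k" and j: "j < k"
    have 01: "0 < k" "1 < k" using assms(3) by simp_all
    note D = okD[OF ok i j]
    show "w (Suc s) i = w (Suc s) j \<Longrightarrow> i = j" unfolding eq(1)[OF i] eq(1)[OF j] by (rule D(1))
    show "cs (Suc s) i \<le> i" unfolding eq(2)[OF i] by (rule D(2))
    show "cs (Suc s) (cs (Suc s) i) = cs (Suc s) i"
      unfolding eq(2)[OF i] eq(2)[OF c[OF i]] by (rule D(3))
    show "w (Suc s) 0 \<le> w (Suc s) i" "w (Suc s) i \<le> w (Suc s) 1"
      unfolding eq(1)[OF i] eq(1)[OF 01(1)] eq(1)[OF 01(2)] by (rule D)+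
    fix l assume l: "l < k" and *: "cs (Suc s) i = cs (Suc s) j" "w (Suc s) i < w (Suc s) l" "w (Suc s) l < w (Suc s) j"
    note ** = *[unfolded eq(2)[OF i] eq(2)[OF j] eq(1)[OF i] eq(1)[OF j] eq(1)[OF l]]
    show "cs (Suc s) l = cs (Suc s) i" unfolding eq(2)[OF i] eq(2)[OF l] by (rule D(6)[OF l **])
    show "l < max i j" by (rule D(7)[OF l **])
  qed
qed

text \<open>The last clause is the crucial one: between the images of two members of a class there
  is no discarded element.\<close>

definition tsound :: "nat \<Rightarrow> nat \<Rightarrow> bool" where
  "tsound s \<tau> \<longleftrightarrow> 2 \<le> tn \<tau> \<and> 2 \<le> tm \<tau> \<and> tg \<tau> 0 = 0 \<and> tg \<tau> 1 = 1 \<and> ok s (tn \<tau>) \<and>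
    (\<forall>i<tn \<tau>. tg \<tau> i < tm \<tau>) \<and>
    (\<forall>i<tn \<tau>. \<forall>j<tn \<tau>. w s i < w s j \<longrightarrow> vl (tv \<tau> (tg \<tau> i)) < vl (tv \<tau> (tg \<tau> j))) \<and>
    (\<forall>d<tm \<tau>. \<forall>d'<tm \<tau>. vl (tv \<tau> d) = vl (tv \<tau> d') \<longrightarrow> d = d') \<and>
    (\<forall>d<tm \<tau>. vl (tv \<tau> 0) \<le> vl (tv \<tau> d) \<and> vl (tv \<tau> d) \<le> vl (tv \<tau> 1)) \<and>
    (\<forall>i<tn \<tau>. \<forall>j<tn \<tau>. \<forall>d<tm \<tau>. cs s i = cs s j \<longrightarrow> vl (tv \<tau> (tg \<tau> i)) < vl (tv \<tau> d) \<longrightarrow>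
      vl (tv \<tau> d) < vl (tv \<tau> (tg \<tau> j)) \<longrightarrow> (\<exists>l<tn \<tau>. tg \<tau> l = d))"

lemma tsoundD:
  "tsound s \<tau> \<Longrightarrow> 2 \<le> tn \<tau>"
  "tsound s \<tau> \<Longrightarrow> 2 \<le> tm \<tau>"
  "tsound s \<tau> \<Longrightarrow> tg \<tau> 0 = 0"
  "tsound s \<tau> \<Longrightarrow> tg \<tau> 1 = 1"
  "tsound s \<tau> \<Longrightarrow> ok s (tn \<tau>)"
  "tsound s \<tau> \<Longrightarrow> \<forall>i<tn \<tau>. tg \<tau> i < tm \<tau>"
  "tsound s \<tau> \<Longrightarrow> \<forall>i<tn \<tau>. \<forall>j<tn \<tau>. w s i < w s j \<longrightarrow> vl (tv \<tau> (tg \<tau> i)) < vl (tv \<tau> (tg \<tau> j))"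
  "tsound s \<tau> \<Longrightarrow> \<forall>d<tm \<tau>. \<forall>d'<tm \<tau>. vl (tv \<tau> d) = vl (tv \<tau> d') \<longrightarrow> d = d'"
  "tsound s \<tau> \<Longrightarrow> \<forall>d<tm \<tau>. vl (tv \<tau> 0) \<le> vl (tv \<tau> d) \<and> vl (tv \<tau> d) \<le> vl (tv \<tau> 1)"
  "tsound s \<tau> \<Longrightarrow> \<forall>i<tn \<tau>. \<forall>j<tn \<tau>. \<forall>d<tm \<tau>. cs s i = cs s j \<longrightarrow> vl (tv \<tau> (tg \<tau> i)) < vl (tv \<tau> d) \<longrightarrow>
      vl (tv \<tau> d) < vl (tv \<tau> (tg \<tau> j)) \<longrightarrow> (\<exists>l<tn \<tau>. tg \<tau> l = d)"
  unfolding tsound_def by (elim conjE, assumption)+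

lemma ok_exact:
  assumes eq': "\<And>i. i < n \<Longrightarrow> vs s i = v i \<and> cs s i = c i" and n: "2 \<le> n"
  shows "ok s n"
proof -
  have eq: "vs s i = v i" "cs s i = c i" if "i < n" for i using eq'[OF that] by auto
  have "c i < n" if "i < n" for i using c_le[of i] that by simp
  note c = this
  show ?thesis
    unfolding ok_def
  proof (intro allI impI conjI)
    fix i j :: nat assume i: "i < n" and j: "j < n"
    have 01: "0 < n" "1 < n" using n by simp_all
    show "w s i = w s j \<Longrightarrow> i = j" unfolding eq(1)[OF i] eq(1)[OF j] by (rule v_inj)
    show "cs s i \<le> i" unfolding eq(2)[OF i] by (rule c_le)
    show "cs s (cs s i) = cs s i" unfolding eq(2)[OF i] eq(2)[OF c[OF i]] by (rule c_idem)
    show "w s 0 \<le> w s i" "w s i \<le> w s 1"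
      unfolding eq(1)[OF i] eq(1)[OF 01(1)] eq(1)[OF 01(2)] by (rule v_ends)+
    fix l :: nat assume l: "l < n" and *: "cs s i = cs s j" "w s i < w s l" "w s l < w s j"
    note ** = *[unfolded eq(2)[OF i] eq(2)[OF j] eq(1)[OF i] eq(1)[OF j] eq(1)[OF l]]
    show "cs s l = cs s i" unfolding eq(2)[OF i] eq(2)[OF l] by (rule c_convex[OF **])
    show "l < max i j" by (rule c_outward[OF **])
  qed
qed

lemma ok2: "ok s 2"
  by (rule ok_exact[OF start]) simp_all

lemma ex_tinitial: "\<exists>\<tau>. tsound 0 \<tau> \<and> tn \<tau> = 2"
proof -
  obtain \<tau> where \<tau>: "tm \<tau> = 2" "tn \<tau> = 2" "\<And>d. d < 2 \<Longrightarrow> tv \<tau> d = pr d 0 \<and> tg \<tau> d = d"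
    using ex_tstate[of 2 2 2 "\<lambda>d. pr d 0" "\<lambda>d. d"] by blast
  have l: "vl (tv \<tau> d) = real d" "tg \<tau> d = d" if "d < 2" for d using \<tau>(3)[OF that] by (simp_all add: vl_def)
  have "w 0 0 \<le> w 0 1" using okD(4)[OF ok2, of 1 1 0] by simp
  then have "tsound 0 \<tau>" unfolding tsound_def \<tau>(1,2) using ok2[of 0] l by (auto simp: less_2_cases_iff)
  then show ?thesis using \<tau>(2) by blast
qed

end

section \<open>A single stage of the second construction\<close>

locale fold_stage = approx_presentation +
  fixes s \<tau> k :: nat
  assumes sound: "tsound s \<tau>" and k: "k = keep s \<tau>"
begin

abbreviation "m \<equiv> tm \<tau>"
abbreviation "lab d \<equiv> vl (tv \<tau> d)"
abbreviation "g i \<equiv> tg \<tau> i"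
abbreviation "u i \<equiv> w (Suc s) i"
abbreviation "b i \<equiv> cs (Suc s) i"

lemma k_le: "k \<le> tn \<tau>"
  unfolding k by (rule keep_le)

lemma k2: "2 \<le> k"
proof (rule ccontr)
  assume "\<not> 2 \<le> k"
  then have "k < tn \<tau>" "Suc k \<le> 2" using tsoundD(1)[OF sound] by simp_all
  then have "\<not> agree s (Suc k)" using keep_maximal unfolding k by blast
  then obtain i where "i < Suc k" "vs s i \<noteq> vs (Suc s) i \<or> cs s i \<noteq> cs (Suc s) i"
    unfolding agree_def by blast
  moreover from this have "i < 2" using \<open>Suc k \<le> 2\<close> by simp
  ultimately show False using start[of i s] start[of i "Suc s"] by simp
qed

lemma agree: "agree s k"
  unfolding k by (rule agree_keep)

lemma ub: "i < k \<Longrightarrow> w s i = u i" "i < k \<Longrightarrow> cs s i = b i"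
  using agreeD[OF agree] by simp_all

lemma m2: "2 \<le> m" and g01: "g 0 = 0" "g 1 = 1"
  using tsoundD(2-4)[OF sound] by simp_all

lemma okn: "ok s (tn \<tau>)" and okk: "ok (Suc s) k"
  using tsoundD(5)[OF sound] ok_agree[OF ok_mono[OF tsoundD(5)[OF sound] k_le] agree k2] by simp_all

lemma g_less: "i < tn \<tau> \<Longrightarrow> g i < m"
  using tsoundD(6)[OF sound] by simp

lemma lab_inj: "d < m \<Longrightarrow> d' < m \<Longrightarrow> lab d = lab d' \<Longrightarrow> d = d'"
  using tsoundD(8)[OF sound] by simp

lemma lab_ends: "d < m \<Longrightarrow> lab 0 \<le> lab d" "d < m \<Longrightarrow> lab d \<le> lab 1"
  using tsoundD(9)[OF sound] by simp_all

lemma g_mono_n: "i < tn \<tau> \<Longrightarrow> j < tn \<tau> \<Longrightarrow> w s i < w s j \<Longrightarrow> lab (g i) < lab (g j)"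
  using tsoundD(7)[OF sound] by simp

lemma g_less_iff_n: "i < tn \<tau> \<Longrightarrow> j < tn \<tau> \<Longrightarrow> lab (g i) < lab (g j) \<longleftrightarrow> w s i < w s j"
  using g_mono_n[of i j] g_mono_n[of j i] okD(1)[OF okn, of i j]
  by (metis less_asym' linorder_neqE_linordered_idom)

lemma g_less_iff: "i < k \<Longrightarrow> j < k \<Longrightarrow> lab (g i) < lab (g j) \<longleftrightarrow> u i < u j"
  using g_less_iff_n[of i j] ub k_le by simp

text \<open>Cutting the map down to its first \<open>k\<close> elements leaves no discarded element
  inside a class: what lies between two kept members of a class has, by creation outwards, a smaller
  number than one of them, and so it is kept too.\<close>

lemma no_trap:
  assumes "i < k" "j < k" "d < m" "b i = b j" "lab (g i) < lab d" "lab d < lab (g j)"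
  shows "\<exists>l<k. g l = d"
proof -
  have n: "i < tn \<tau>" "j < tn \<tau>" using assms k_le by simp_all
  have c: "cs s i = cs s j" using assms ub by simp
  obtain l where l: "l < tn \<tau>" "g l = d"
    using tsoundD(10)[OF sound, rule_format, OF n assms(3) c assms(5,6)] by blast
  have "w s i < w s l" "w s l < w s j"
    using g_less_iff_n[OF n(1) l(1)] g_less_iff_n[OF l(1) n(2)] assms(5,6) l(2) by simp_all
  then have "l < max i j" using okD(7)[OF okn n l(1) c] by simp
  then have "l < k" using assms(1,2) by simp
  then show ?thesis using l(2) by blast
qed

lemma rank_neq_new:
  assumes ok: "ok (Suc s) (Suc k)" and i: "i < k"
  shows "u i \<noteq> u k"
  using okD(1)[OF ok, of i k] i by auto

lemma beside_right:
  assumes ok: "ok (Suc s) (Suc k)"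
  obtains i0 x where "i0 < k" "u i0 < u k" "\<And>j. j < k \<Longrightarrow> u j < u k \<Longrightarrow> u j \<le> u i0"
    "fitting (Suc s) \<tau> k x" "\<And>d. d < m \<Longrightarrow> lab d \<noteq> vl x"
    "\<And>d. d < m \<Longrightarrow> \<not> (lab (g i0) < lab d \<and> lab d < vl x)" "lab (g i0) < vl x"
proof -
  have "u 0 < u k" using okD(4)[OF ok, of k k] rank_neq_new[OF ok, of 0] k2 by force
  then obtain i0 where i0: "i0 < k" "u i0 < u k" "\<And>j. j < k \<Longrightarrow> u j < u k \<Longrightarrow> u j \<le> u i0"
    using neighbour_below[of 0 k u "u k"] k2 by auto
  obtain x where x: "lab (g i0) < vl x" "\<And>d. d < m \<Longrightarrow> lab (g i0) < lab d \<Longrightarrow> vl x < lab d"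
    using ex_vl_right[of "lab ` {..<m}" "lab (g i0)"] vl_nonneg by auto
  have gm: "g i < m" if "i < k" for i using g_less that k_le by simp
  have "fitting (Suc s) \<tau> k x"
    unfolding fitting_def
  proof (intro allI impI conjI)
    fix i assume i: "i < k"
    {
      assume "u i < u k"
      then have "u i \<le> u i0" using i0(3)[OF i] by simp
      then have "lab (g i) \<le> lab (g i0)" using g_less_iff[OF i0(1) i] by simp
      then show "lab (g i) < vl x" using x(1) by simp
    next
      assume "u k < u i"
      then have "lab (g i0) < lab (g i)" using g_less_iff[OF i0(1) i] i0(2) by simp
      then show "vl x < lab (g i)" using x(2)[OF gm[OF i]] by simp
    }
  qed
  moreover have "lab d \<noteq> vl x" "\<not> (lab (g i0) < lab d \<and> lab d < vl x)" if "d < m" for d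
    using x(1) x(2)[OF that] by auto
  ultimately show thesis using that[of i0 x] i0 x(1) by blast
qed

lemma beside_left:
  assumes ok: "ok (Suc s) (Suc k)"
  obtains i0 x where "i0 < k" "u k < u i0" "\<And>j. j < k \<Longrightarrow> u k < u j \<Longrightarrow> u i0 \<le> u j"
    "fitting (Suc s) \<tau> k x" "\<And>d. d < m \<Longrightarrow> lab d \<noteq> vl x"
    "\<And>d. d < m \<Longrightarrow> \<not> (vl x < lab d \<and> lab d < lab (g i0))" "vl x < lab (g i0)"
proof -
  have "u k < u 1" using okD(5)[OF ok, of k k] rank_neq_new[OF ok, of 1] k2 by force
  then obtain i0 where i0: "i0 < k" "u k < u i0" "\<And>j. j < k \<Longrightarrow> u k < u j \<Longrightarrow> u i0 \<le> u j"
    using neighbour_above[of 1 k "u k" u] k2 by auto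
  have "u 0 \<le> u k" using okD(4)[OF ok, of k k] by simp
  then have "lab (g 0) < lab (g i0)" using i0(2) g_less_iff[OF _ i0(1), of 0] k2 by simp
  then have "0 < lab (g i0)" using vl_nonneg[of "tv \<tau> (g 0)"] by simp
  then obtain x where x: "vl x < lab (g i0)" "\<And>d. d < m \<Longrightarrow> lab d < lab (g i0) \<Longrightarrow> lab d < vl x"
    using ex_vl_left[of "lab ` {..<m}" "lab (g i0)"] vl_nonneg by auto
  have gm: "g i < m" if "i < k" for i using g_less that k_le by simp
  have "fitting (Suc s) \<tau> k x"
    unfolding fitting_def
  proof (intro allI impI conjI)
    fix i assume i: "i < k"
    {
      assume "u k < u i"
      then have "u i0 \<le> u i" using i0(3)[OF i] by simp
      then have "lab (g i0) \<le> lab (g i)" using g_less_iff[OF i i0(1)] by simp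
      then show "vl x < lab (g i)" using x(1) by simp
    next
      assume "u i < u k"
      then have "lab (g i) < lab (g i0)" using g_less_iff[OF i i0(1)] i0(2) by simp
      then show "lab (g i) < vl x" using x(2)[OF gm[OF i]] by simp
    }
  qed
  moreover have "lab d \<noteq> vl x" "\<not> (vl x < lab d \<and> lab d < lab (g i0))" if "d < m" for d
    using x(1) x(2)[OF that] by auto
  ultimately show thesis using that[of i0 x] i0 x(1) by blast
qed

text \<open>If \<open>k\<close> does not represent its class, the representative has a smaller
  number and lies on one side of \<open>k\<close>. By convexity the nearest kept element on that
  side is a member as well, and the fresh label goes next to its image.\<close>

lemma ex_attach:
  assumes ok: "ok (Suc s) (Suc k)"
  shows "\<exists>x. attach (Suc s) \<tau> k x"
proof (cases "b k = k")
  case True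
  then show ?thesis using beside_right[OF ok] unfolding attach_def by metis
next
  case False
  then have j: "b k < k" using okD(2)[OF ok, of k k] by simp
  have bj: "b (b k) = b k" using okD(3)[OF ok, of k k] by simp
  have "u (b k) \<noteq> u k" using rank_neq_new[OF ok j] .
  then consider "u (b k) < u k" | "u k < u (b k)" by linarith
  then show ?thesis
  proof cases
    case 1
    obtain i0 x where x: "i0 < k" "u i0 < u k" "\<And>j. j < k \<Longrightarrow> u j < u k \<Longrightarrow> u j \<le> u i0"
        "fitting (Suc s) \<tau> k x" "\<And>d. d < m \<Longrightarrow> lab d \<noteq> vl x"
        "\<And>d. d < m \<Longrightarrow> \<not> (lab (g i0) < lab d \<and> lab d < vl x)" "lab (g i0) < vl x"
      using beside_right[OF ok] by metis
    have "b i0 = b k"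
    proof (cases "i0 = b k")
      case False
      then have "u (b k) < u i0" using x(3)[OF j 1] okD(1)[OF ok, of "b k" i0] j x(1) by force
      then show ?thesis using okD(6)[OF ok, of "b k" k i0] j x(1,2) bj by simp
    qed (use bj in simp)
    then show ?thesis unfolding attach_def using x by (intro exI[of _ x]) force
  next
    case 2
    obtain i0 x where x: "i0 < k" "u k < u i0" "\<And>j. j < k \<Longrightarrow> u k < u j \<Longrightarrow> u i0 \<le> u j"
        "fitting (Suc s) \<tau> k x" "\<And>d. d < m \<Longrightarrow> lab d \<noteq> vl x"
        "\<And>d. d < m \<Longrightarrow> \<not> (vl x < lab d \<and> lab d < lab (g i0))" "vl x < lab (g i0)"
      using beside_left[OF ok] by metis
    have "b i0 = b k"
    proof (cases "i0 = b k")
      case False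
      then have "u i0 < u (b k)" using x(3)[OF j 2] okD(1)[OF ok, of "b k" i0] j x(1) by force
      then show ?thesis using okD(6)[OF ok, of k "b k" i0] j x(1,2) bj by simp
    qed (use bj in simp)
    then show ?thesis unfolding attach_def using x by (intro exI[of _ x]) force
  qed
qed

lemma ex_step2: "\<exists>\<tau>'. step2 s \<tau> \<tau>'"
proof -
  let ?st = "\<lambda>m' n' x y \<tau>'. tm \<tau>' = m' \<and> tn \<tau>' = n' \<and>
      (\<forall>d<m. tv \<tau>' d = tv \<tau> d) \<and> (\<forall>i<k. tg \<tau>' i = tg \<tau> i) \<and> tv \<tau>' m = x \<and> tg \<tau>' k = y"
  have ex: "\<exists>\<tau>'. ?st m' n' x y \<tau>'" for m' n' x y
  proof -
    obtain \<tau>' where "tm \<tau>' = m' \<and> tn \<tau>' = n' \<and> (\<forall>d<Suc (m + k).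
        tv \<tau>' d = (if d < m then tv \<tau> d else x) \<and> tg \<tau>' d = (if d < k then tg \<tau> d else y))"
      using ex_tstate[of m' n' "Suc (m + k)" "\<lambda>d. if d < m then tv \<tau> d else x"
        "\<lambda>d. if d < k then tg \<tau> d else y"] by blast
    then have "?st m' n' x y \<tau>'" by simp
    then show ?thesis ..
  qed
  show ?thesis
  proof (cases "ok (Suc s) (Suc k)")
    case ok: True
    let ?Q = "b k = k \<and> spare (Suc s) \<tau> k < m"
    show ?thesis
    proof (cases ?Q)
      case True
      obtain \<tau>' where "?st m (Suc k) 0 (spare (Suc s) \<tau> k) \<tau>'" using ex by blast
      then have "step2 s \<tau> \<tau>'" unfolding step2_def k[symmetric] if_P[OF ok] if_P[OF True] by simp
      then show ?thesis ..
    next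
      case False
      obtain x where x: "attach (Suc s) \<tau> k x" using ex_attach[OF ok] by blast
      obtain \<tau>' where "?st (Suc m) (Suc k) x m \<tau>'" using ex by blast
      then have "step2 s \<tau> \<tau>'" unfolding step2_def k[symmetric] if_P[OF ok] if_not_P[OF False]
        using x by simp
      then show ?thesis ..
    qed
  next
    case False
    obtain \<tau>' where "?st m k 0 0 \<tau>'" using ex by blast
    then have "step2 s \<tau> \<tau>'" unfolding step2_def k[symmetric] if_not_P[OF False] by simp
    then show ?thesis ..
  qed
qed

lemma step2_old:
  assumes "step2 s \<tau> \<tau>'"
  shows "d < m \<Longrightarrow> tv \<tau>' d = tv \<tau> d" "i < k \<Longrightarrow> tg \<tau>' i = g i"
  using assms unfolding step2_def k[symmetric] by blast+

lemma step2_cases: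
  assumes "step2 s \<tau> \<tau>'"
  obtains (reuse) "ok (Suc s) (Suc k)" "tn \<tau>' = Suc k" "tm \<tau>' = m" "b k = k"
      "spare (Suc s) \<tau> k < m" "tg \<tau>' k = spare (Suc s) \<tau> k"
  | (create) "ok (Suc s) (Suc k)" "tn \<tau>' = Suc k" "tm \<tau>' = Suc m" "tg \<tau>' k = m"
      "attach (Suc s) \<tau> k (tv \<tau>' m)" "\<not> (b k = k \<and> spare (Suc s) \<tau> k < m)"
  | (wait) "\<not> ok (Suc s) (Suc k)" "tn \<tau>' = k" "tm \<tau>' = m"
proof -
  note st = assms[unfolded step2_def k[symmetric], THEN conjunct2, THEN conjunct2]
  let ?Q = "b k = k \<and> spare (Suc s) \<tau> k < m"
  show thesis
  proof (cases "ok (Suc s) (Suc k)")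
    case ok: True
    show thesis
    proof (cases ?Q)
      case True
      then show thesis using reuse[OF ok] st unfolding if_P[OF ok] if_P[OF True] by blast
    next
      case False
      then show thesis using create[OF ok] st unfolding if_P[OF ok] if_not_P[OF False] by blast
    qed
  next
    case False
    then show thesis using wait st unfolding if_not_P[OF False] by blast
  qed
qed

text \<open>Handles reuse and creation together: \<open>tg \<tau>' k\<close> is either an old
  element or the new element \<open>m\<close>.\<close>

lemma tsound_extend:
  assumes ok: "ok (Suc s) (Suc k)"
    and old: "\<And>d. d < m \<Longrightarrow> tv \<tau>' d = tv \<tau> d" "\<And>i. i < k \<Longrightarrow> tg \<tau>' i = g i"
    and n': "tn \<tau>' = Suc k" and m': "m \<le> tm \<tau>'" "tm \<tau>' \<le> Suc m" and gk: "tg \<tau>' k < tm \<tau>'"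
    and new: "m < tm \<tau>' \<Longrightarrow> tg \<tau>' k = m \<and> (\<forall>d<m. lab d \<noteq> vl (tv \<tau>' m))"
    and fit: "fitting (Suc s) \<tau> k (tv \<tau>' (tg \<tau>' k))"
    and adj: "b k \<noteq> k \<Longrightarrow> \<exists>i<k. b i = b k \<and> (\<forall>d<m.
      \<not> (lab (g i) < lab d \<and> lab d < vl (tv \<tau>' (tg \<tau>' k))) \<and>
      \<not> (vl (tv \<tau>' (tg \<tau>' k)) < lab d \<and> lab d < lab (g i)))"
  shows "tsound (Suc s) \<tau>'"
proof -
  let ?L = "\<lambda>d. vl (tv \<tau>' d)"
  have oldL: "?L d = lab d" if "d < m" for d using old(1)[OF that] by simp
  have gm: "g i < m" if "i < k" for i using g_less that k_le by simp
  have Lg: "?L (tg \<tau>' i) = lab (g i)" if "i < k" for i using oldL[OF gm[OF that]] old(2)[OF that] by simp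
  have d_cases: "d < m \<or> d = m \<and> m < tm \<tau>' \<and> tg \<tau>' k = m" if "d < tm \<tau>'" for d
    using that m' new by linarith
  have fitD: "u i < u k \<Longrightarrow> lab (g i) < ?L (tg \<tau>' k)" "u k < u i \<Longrightarrow> ?L (tg \<tau>' k) < lab (g i)" if "i < k" for i
    using fit that unfolding fitting_def by blast+
  have mono: "?L (tg \<tau>' i) < ?L (tg \<tau>' j)" if ij: "i < Suc k" "j < Suc k" "u i < u j" for i j
  proof -
    have "i \<noteq> j" using ij(3) by auto
    then consider "i < k" "j < k" | "i = k" "j < k" | "i < k" "j = k" using ij(1,2) by (metis less_SucE)
    then show ?thesis
      by cases (use ij g_less_iff[of i j] Lg fitD in auto)
  qed
  have mono_iff: "?L (tg \<tau>' i) < ?L (tg \<tau>' j) \<longleftrightarrow> u i < u j" if "i < Suc k" "j < Suc k" for i j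
    using mono[OF that] mono[OF that(2,1)] okD(1)[OF ok that] by (metis less_asym' linorder_neqE_linordered_idom)
  have trap0: "\<exists>l<Suc k. tg \<tau>' l = d"
    if i: "i < k" and j: "j < k" and d: "d < tm \<tau>'" and c: "b i = b j" "?L (tg \<tau>' i) < ?L d" "?L d < ?L (tg \<tau>' j)" for i j d
  proof (cases "d < m")
    case True
    then obtain l where "l < k" "g l = d" using no_trap[OF i j True c(1)] c(2,3) Lg i j oldL by auto
    then show ?thesis using old(2) by (intro exI[of _ l]) simp
  next
    case False
    then have "tg \<tau>' k = d" using d_cases[OF d] by simp
    then show ?thesis by blast
  qed
  have trap: "\<exists>l<Suc k. tg \<tau>' l = d"
    if i: "i < Suc k" and j: "j < Suc k" and d: "d < tm \<tau>'" and c: "b i = b j" "?L (tg \<tau>' i) < ?L d" "?L d < ?L (tg \<tau>' j)" for i j d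
  proof (cases "d < m")
    case False
    then have "tg \<tau>' k = d" using d_cases[OF d] by simp
    then show ?thesis by blast
  next
    case dm: True
    have "i \<noteq> j" using c by auto
    then consider "i < k" "j < k" | "i = k" "j < k" | "i < k" "j = k" using i j by (metis less_SucE)
    then show ?thesis
    proof cases
      case 1
      then show ?thesis using trap0 d c by blast
    next
      case 2
      \<comment> \<open>As \<open>k\<close> shares its class with the smaller \<open>j\<close>, it
        is not a representative and \<open>adj\<close> applies. Nothing lies between the new image
        and that of \<open>i0\<close>, which reduces the claim to kept elements.\<close>
      have "b j \<le> j" using okD(2)[OF okk 2(2) 2(2)] .
      then have "b k \<noteq> k" using 2 c(1) by auto
      then obtain i0 where i0: "i0 < k" "b i0 = b k" "\<not> (?L (tg \<tau>' k) < lab d \<and> lab d < lab (g i0))"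
        using adj dm by blast
      consider "lab d = lab (g i0)" | "lab (g i0) < lab d" using i0(3) c(2) 2(1) oldL[OF dm] by fastforce
      then show ?thesis
      proof cases
        case 1
        then have "tg \<tau>' i0 = d" using lab_inj[OF dm gm[OF i0(1)]] old(2)[OF i0(1)] by simp
        then show ?thesis using i0(1) less_SucI by blast
      next
        case B: 2
        then show ?thesis using trap0[OF i0(1) 2(2) d] c i0(2) 2(1) Lg[OF i0(1)] oldL[OF dm] by simp
      qed
    next
      case 3
      have "b i \<le> i" using okD(2)[OF okk 3(1) 3(1)] .
      then have "b k \<noteq> k" using 3 c(1) by auto
      then obtain i0 where i0: "i0 < k" "b i0 = b k" "\<not> (lab (g i0) < lab d \<and> lab d < ?L (tg \<tau>' k))"
        using adj dm by blast
      consider "lab d = lab (g i0)" | "lab d < lab (g i0)" using i0(3) c(3) 3(2) oldL[OF dm] by fastforce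
      then show ?thesis
      proof cases
        case 1
        then have "tg \<tau>' i0 = d" using lab_inj[OF dm gm[OF i0(1)]] old(2)[OF i0(1)] by simp
        then show ?thesis using i0(1) less_SucI by blast
      next
        case B: 2
        then show ?thesis using trap0[OF 3(1) i0(1) d] c i0(2) 3(2) Lg[OF i0(1)] oldL[OF dm] by simp
      qed
    qed
  qed
  have L01: "?L 0 = lab 0" "?L 1 = lab 1" using oldL m2 by simp_all
  have "lab 0 < ?L (tg \<tau>' k)" "?L (tg \<tau>' k) < lab 1"
    using fitD[of 0] fitD[of 1] g01 k2 okD(4,5)[OF ok, of k k] rank_neq_new[OF ok, of 0] rank_neq_new[OF ok, of 1]
    by force+
  note Lk = this
  show ?thesis
    unfolding tsound_def n'
  proof (intro conjI allI impI)
    show "2 \<le> Suc k" using k2 by simp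
    show "2 \<le> tm \<tau>'" using m2 m' by simp
    show "tg \<tau>' 0 = 0" "tg \<tau>' 1 = 1" using old(2) g01 k2 by simp_all
    show "ok (Suc s) (Suc k)" by (rule ok)
    show "tg \<tau>' i < tm \<tau>'" if "i < Suc k" for i
    proof (cases "i = k")
      case False
      then show ?thesis using that old(2)[of i] gm[of i] m'(1) by simp
    qed (use gk in simp)
    show "?L (tg \<tau>' i) < ?L (tg \<tau>' j)" if "i < Suc k" "j < Suc k" "u i < u j" for i j
      by (rule mono[OF that])
    show "d = d'" if d: "d < tm \<tau>'" and d': "d' < tm \<tau>'" and eq: "?L d = ?L d'" for d d'
      using d_cases[OF d] d_cases[OF d'] lab_inj[of d d'] oldL[of d] oldL[of d'] new eq by metis
    show "?L 0 \<le> ?L d" "?L d \<le> ?L 1" if "d < tm \<tau>'" for d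
      using d_cases[OF that] lab_ends[of d] oldL[of d] L01 Lk by auto
    show "\<exists>l<Suc k. tg \<tau>' l = d" if "i < Suc k" "j < Suc k" "d < tm \<tau>'" "b i = b j"
        "?L (tg \<tau>' i) < ?L d" "?L d < ?L (tg \<tau>' j)" for i j d
      by (rule trap[OF that])
  qed
qed

lemma tsound_step2:
  assumes st: "step2 s \<tau> \<tau>'"
  shows "tsound (Suc s) \<tau>'"
  using st
proof (cases rule: step2_cases)
  case reuse
  show ?thesis
    by (rule tsound_extend[OF reuse(1) step2_old[OF st] reuse(2)])
      (use reuse spareD[OF reuse(5)] step2_old(1)[OF st] in simp_all)
next
  case create
  show ?thesis
    by (rule tsound_extend[OF create(1) step2_old[OF st] create(2)])
      (use create(3-5) in \<open>simp_all add: attach_def\<close>)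
next
  case wait
  have old: "tv \<tau>' d = tv \<tau> d" if "d < m" for d using step2_old(1)[OF st that] .
  have oldg: "tg \<tau>' i = g i" if "i < k" for i using step2_old(2)[OF st that] .
  have gm: "g i < m" if "i < k" for i using g_less that k_le by simp
  show ?thesis
    unfolding tsound_def wait(2,3)
  proof (intro conjI allI impI)
    show "2 \<le> k" "2 \<le> m" by (rule k2, rule m2)
    show "tg \<tau>' 0 = 0" "tg \<tau>' 1 = 1" using oldg g01 k2 by simp_all
    show "ok (Suc s) k" by (rule okk)
    show "tg \<tau>' i < m" if "i < k" for i using gm[OF that] oldg[OF that] by simp
    show "vl (tv \<tau>' (tg \<tau>' i)) < vl (tv \<tau>' (tg \<tau>' j))" if "i < k" "j < k" "u i < u j" for i j
      using that g_less_iff[OF that(1,2)] oldg gm old by simp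
    show "d = d'" if "d < m" "d' < m" "vl (tv \<tau>' d) = vl (tv \<tau>' d')" for d d'
      using that lab_inj[of d d'] old by simp
    show "vl (tv \<tau>' 0) \<le> vl (tv \<tau>' d)" "vl (tv \<tau>' d) \<le> vl (tv \<tau>' 1)" if "d < m" for d
      using lab_ends[OF that] old m2 that by simp_all
    show "\<exists>l<k. tg \<tau>' l = d" if i: "i < k" and j: "j < k" and d: "d < m" and c: "b i = b j"
        "vl (tv \<tau>' (tg \<tau>' i)) < vl (tv \<tau>' d)" "vl (tv \<tau>' d) < vl (tv \<tau>' (tg \<tau>' j))" for i j d
    proof -
      obtain l where "l < k" "g l = d"
        using no_trap[OF i j d c(1)] c(2,3) oldg[OF i] oldg[OF j] old[OF d] old[OF gm[OF i]] old[OF gm[OF j]] by auto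
      then show ?thesis using oldg by (intro exI[of _ l]) simp
    qed
  qed
qed

end

section \<open>The classes of a block presentation are its blocks\<close>

lemma blk_iso:
  assumes "bij f" "\<And>i j. r (f i) < r (f j) \<longleftrightarrow> r' i < (r' j :: real)"
  shows "blk r (f i) (f j) \<longleftrightarrow> blk r' i j"
proof -
  have le: "r (f i) \<le> r (f j) \<longleftrightarrow> r' i \<le> r' j" for i j using assms(2)[of j i] by (simp add: not_less[symmetric])
  have "cint r (f i) (f j) = f ` cint r' i j"
  proof (intro set_eqI iffI)
    fix z assume z: "z \<in> cint r (f i) (f j)"
    obtain l where l: "z = f l" using assms(1) by (metis bij_pointE)
    then have "l \<in> cint r' i j" using z by (simp add: in_cint_iff le)
    then show "z \<in> f ` cint r' i j" using l by blast
  qed (auto simp: in_cint_iff le)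
  moreover have "inj_on f (cint r' i j)" using assms(1) by (meson bij_is_inj inj_on_subset subset_UNIV)
  ultimately show ?thesis unfolding blk_def by (simp add: finite_image_iff)
qed

context block_presentation
begin

abbreviation "rk \<equiv> \<lambda>i. vl (v i)"

text \<open>By density an interval with ends in different classes has a proper subinterval with the
  same left end and again with ends in different classes. A finite interval does not admit this
  indefinitely.\<close>

lemma finite_imp_same: "finite (cint rk i j) \<Longrightarrow> rk i < rk j \<Longrightarrow> c i = c j"
proof (induction "card (cint rk i j)" arbitrary: j rule: less_induct)
  case less
  show ?case
  proof (rule ccontr)
    assume "c i \<noteq> c j"
    then obtain l where l: "rk i < rk l" "rk l < rk j" "c l \<noteq> c i" using c_dense less.prems(2) by blast
    have "cint rk i l \<subseteq> cint rk i j" using l by (intro cint_mono) (simp add: in_cint_iff)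
    moreover have "j \<notin> cint rk i l" using l by (simp add: in_cint_iff)
    ultimately have "cint rk i l \<subset> cint rk i j" using in_cint(2)[of j rk i] by blast
    then have "card (cint rk i l) < card (cint rk i j)" "finite (cint rk i l)"
      using less.prems(1) psubset_card_mono finite_subset by blast+
    then show False using less.hyps[of l] l by simp
  qed
qed

text \<open>That members of one class lie in one block is due to \<open>c_outward\<close>: every
  number between them is at most the larger one of the two.\<close>

lemma blk_iff: "blk rk i j \<longleftrightarrow> c i = c j"
proof
  assume "blk rk i j"
  then have f: "finite (cint rk i j)" "finite (cint rk j i)" unfolding blk_def cint_commute[of rk j i] by auto
  consider "rk i < rk j" | "rk j < rk i" | "i = j" using v_inj[of i j] less_linear[of "rk i" "rk j"] by blast
  then show "c i = c j"
  proof cases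
    case 1
    then show ?thesis by (rule finite_imp_same[OF f(1)])
  next
    case 2
    then show ?thesis by (rule finite_imp_same[OF f(2), symmetric])
  qed simp
next
  assume c: "c i = c j"
  have "l \<le> max i j" if lc: "l \<in> cint rk i j" for l
  proof -
    consider "l = i \<or> l = j" | "rk i < rk l" "rk l < rk j" | "rk j < rk l" "rk l < rk i"
      using lc v_inj[of i l] v_inj[of l j] unfolding in_cint_iff order_le_less by argo
    then show ?thesis
    proof cases
      case 2
      then show ?thesis using c_outward[OF c] less_imp_le by blast
    next
      case 3
      then show ?thesis using c_outward[OF c[symmetric]] less_imp_le by (metis max.commute)
    qed auto
  qed
  then have "cint rk i j \<subseteq> {..max i j}" by auto
  then show "blk rk i j" unfolding blk_def using finite_subset by blast
qed

end

section \<open>Convergence of the second construction\<close>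

locale fold_run = approx_presentation +
  fixes S :: "nat \<Rightarrow> nat"
  assumes C_S: "computable_fun S" and sound_S: "tsound t (S t)" and step_S: "step2 t (S t) (S (Suc t))"
    and tn_S0: "tn (S 0) = 2"

sublocale fold_run \<subseteq> st: fold_stage v c vs cs t "S t" "keep t (S t)" for t
  by unfold_locales (simp_all add: sound_S)

context fold_run
begin

abbreviation "K t \<equiv> keep t (S t)"

lemma tn_Suc: "tn (S (Suc t)) = K t \<or> tn (S (Suc t)) = Suc (K t)"
  by (rule st.step2_cases[OF step_S[of t]]) simp_all

lemma K_le_tn: "K (Suc t) \<le> tn (S (Suc t))" "K t \<le> tn (S (Suc t))"
  using st.k_le[of "Suc t"] tn_Suc[of t] by auto

lemma tm_Suc: "tm (S t) \<le> tm (S (Suc t))"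
  by (rule st.step2_cases[OF step_S[of t]]) simp_all

lemma tm_mono: "t \<le> t' \<Longrightarrow> tm (S t) \<le> tm (S t')"
  by (rule lift_Suc_mono_le[of "\<lambda>t. tm (S t)"]) (rule tm_Suc)

lemma tv_mono:
  assumes "t \<le> t'" "d < tm (S t)"
  shows "tv (S t') d = tv (S t) d"
  using assms(1)
proof (induction t' rule: dec_induct)
  case (step u)
  have "d < tm (S u)" using tm_mono[OF step(1)] assms(2) by simp
  then show ?case using st.step2_old(1)[OF step_S[of u]] step by simp
qed simp

definition final :: "nat \<Rightarrow> nat \<Rightarrow> bool" where
  "final t i \<longleftrightarrow> (\<forall>t'\<ge>t. i \<le> K t')"

lemma final_mono: "final t i \<Longrightarrow> t \<le> t' \<Longrightarrow> j \<le> i \<Longrightarrow> final t' j"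
  unfolding final_def by (meson order_trans)

lemma final_tg:
  assumes "final t i" "t \<le> t'" "j < i"
  shows "tg (S t') j = tg (S t) j"
  using assms(2)
proof (induction t' rule: dec_induct)
  case (step u)
  have "j < K u" using assms(1,3) step(1) unfolding final_def by (meson order_less_le_trans)
  then show ?case using st.step2_old(2)[OF step_S[of u]] step by simp
qed simp

lemma exact_limit: "\<exists>s1. \<forall>s\<ge>s1. \<forall>i<n. vs s i = v i \<and> cs s i = c i"
proof -
  have "\<forall>\<^sub>F s in sequentially. \<forall>i\<in>{..<n}. vs s i = v i \<and> cs s i = c i"
    using limit by (intro eventually_ball_finite) auto
  then show ?thesis unfolding eventually_sequentially by auto
qed

text \<open>As long as an element is kept its approximation does not change; if it is kept forever,
  the current values are the limits.\<close>

lemma final_exact: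
  assumes fin: "final t i" and t': "t \<le> t'" and j: "j < i"
  shows "vs t' j = v j" "cs t' j = c j"
proof -
  obtain s1 where s1: "\<And>s. s1 \<le> s \<Longrightarrow> vs s j = v j \<and> cs s j = c j" using exact_limit[of "Suc j"] by auto
  have "vs (t' + n) j = vs t' j \<and> cs (t' + n) j = cs t' j" for n
  proof (induction n)
    case (Suc n)
    have "j < K (t' + n)" using fin t' j unfolding final_def by (meson order_less_le_trans trans_le_add1)
    then show ?case using st.ub[of j "t' + n"] agreeD[OF st.agree[of "t' + n"], of j] Suc by simp
  qed simp
  from this[of s1] show "vs t' j = v j" "cs t' j = c j" using s1[of "t' + s1"] by simp_all
qed

lemma ex_final: "\<exists>t. final t i"
proof (induction i)
  case 0
  show ?case unfolding final_def by simp
next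
  case (Suc i)
  then obtain t0 where t0: "final t0 i" by blast
  obtain s1 where s1: "\<And>s j. s1 \<le> s \<Longrightarrow> j < Suc (Suc i) \<Longrightarrow> vs s j = v j \<and> cs s j = c j"
    using exact_limit[of "Suc (Suc i)"] by blast
  \<comment> \<open>The index is raised to \<open>Suc (Suc i)\<close> because
    \<open>ok_exact\<close> asks for at least two elements.\<close>
  have ok: "ok s (Suc i)" if "s1 \<le> s" for s
    by (rule ok_mono[OF ok_exact[of "Suc (Suc i)"]]) (use s1[OF that] in auto)
  have agree: "agree s (Suc i)" if "s1 \<le> s" for s
    unfolding agree_def using s1[of s] s1[of "Suc s"] that by simp
  have up: "Suc i \<le> K s" if "s1 \<le> s" "t0 \<le> s" "Suc i \<le> tn (S s)" for s
  proof (rule ccontr)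
    assume "\<not> Suc i \<le> K s"
    then have "K s = i" using t0 that(2) unfolding final_def by (simp add: le_antisym not_less_eq_eq)
    then show False using keep_maximal[of s "S s"] that(3) agree[OF that(1)] by simp
  qed
  let ?t = "max t0 s1"
  have tn: "Suc i \<le> tn (S (Suc s))" if "?t \<le> s" for s
  proof (cases "Suc i \<le> K s")
    case True
    then show ?thesis using K_le_tn(2)[of s] by simp
  next
    case False
    then have K: "K s = i" using t0 that unfolding final_def by (simp add: le_antisym not_less_eq_eq)
    have "s1 \<le> Suc s" using that by simp
    then have ok': "ok (Suc s) (Suc (K s))" using ok K by simp
    have "tn (S (Suc s)) = Suc (K s)"
      by (rule st.step2_cases[OF step_S[of s]]) (assumption | (erule notE, rule ok'))+
    then show ?thesis using K by simp
  qed
  have "final (Suc ?t) (Suc i)"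
    unfolding final_def
  proof (intro allI impI)
    fix s assume s: "Suc ?t \<le> s"
    then obtain s' where s': "s = Suc s'" "?t \<le> s'" by (cases s) auto
    show "Suc i \<le> K s" using up[of s] tn[OF s'(2)] s s' by simp
  qed
  then show ?case ..
qed

definition fill :: "nat \<Rightarrow> nat" where
  "fill i = Max {t. K t \<le> i}"

lemma fill:
  assumes "2 \<le> i"
  shows "K (fill i) = i" "final (fill i) i" "final (Suc (fill i)) (Suc i)"
proof -
  obtain t where t: "final t (Suc i)" using ex_final by blast
  have "{t. K t \<le> i} \<subseteq> {..<t}"
    using t unfolding final_def by (auto simp: not_le[symmetric])
  then have fin: "finite {t. K t \<le> i}" using finite_subset by blast
  have "0 \<in> {t. K t \<le> i}" using st.k_le[of 0] tn_S0 assms by simp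
  then have "fill i \<in> {t. K t \<le> i}" unfolding fill_def using fin by (intro Max_in) auto
  moreover have after: "Suc i \<le> K t" if "fill i < t" for t
  proof (rule ccontr)
    assume "\<not> Suc i \<le> K t"
    then have "t \<in> {t. K t \<le> i}" by simp
    from Max_ge[OF fin this] show False using that unfolding fill_def by simp
  qed
  ultimately have "K (fill i) \<le> i" "Suc i \<le> K (Suc (fill i))" by simp_all
  then show K: "K (fill i) = i" using K_le_tn(1)[of "fill i"] tn_Suc[of "fill i"] by auto
  show "final (Suc (fill i)) (Suc i)" unfolding final_def using after by (simp add: Suc_le_eq)
  have "i \<le> K t" if "fill i \<le> t" for t
    using that after[of t] K by (cases "t = fill i") auto
  then show "final (fill i) i" unfolding final_def by blast
qed

definition img :: "nat \<Rightarrow> nat" where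
  "img i = tg (S (SOME t. final t (Suc i))) i"

lemma img_eq:
  assumes "final t j" "i < j"
  shows "tg (S t) i = img i"
proof -
  let ?t = "SOME t. final t (Suc i)"
  have t: "final ?t (Suc i)" using ex_final by (rule someI_ex)
  show ?thesis unfolding img_def
    using final_tg[OF assms(1) _ assms(2), of "max t ?t"] final_tg[OF t, of "max t ?t" i] by simp
qed

lemma tg_inj: "i < tn (S t) \<Longrightarrow> j < tn (S t) \<Longrightarrow> tg (S t) i = tg (S t) j \<Longrightarrow> i = j"
  using st.g_less_iff_n[of i t j] st.g_less_iff_n[of j t i] okD(1)[OF st.okn[of t], of i j] by fastforce

lemma tm_unbounded: "\<exists>t. d < tm (S t)"
proof -
  obtain t where t: "final t (Suc d)" using ex_final by blast
  have n: "Suc d \<le> tn (S t)" using t st.k_le[of t] unfolding final_def by (meson order_refl order_trans)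
  have "inj_on (tg (S t)) {..<tn (S t)}" using tg_inj by (auto intro!: inj_onI)
  moreover have "tg (S t) ` {..<tn (S t)} \<subseteq> {..<tm (S t)}" using st.g_less[of _ t] by auto
  ultimately have "card {..<tn (S t)} \<le> card {..<tm (S t)}" by (intro card_inj_on_le) auto
  then show ?thesis using n by (intro exI[of _ t]) simp
qed

definition birth :: "nat \<Rightarrow> nat" where "birth d = (LEAST t. d < tm (S t))"
definition lbl :: "nat \<Rightarrow> nat" where "lbl d = tv (S (birth d)) d"

lemma lbl_eq: "d < tm (S t) \<Longrightarrow> tv (S t) d = lbl d"
proof -
  assume d: "d < tm (S t)"
  have "birth d \<le> t" unfolding birth_def by (rule Least_le) (rule d)
  moreover have "d < tm (S (birth d))" unfolding birth_def by (rule LeastI_ex) (rule tm_unbounded)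
  ultimately show ?thesis unfolding lbl_def using tv_mono by simp
qed

lemma computable_lbl: "computable_fun lbl"
proof -
  have "computable_fun birth" unfolding birth_def
    by (intro cf.C_Least tm_unbounded cf.dec_rules C_tsel cf.C_comp[OF C_S])
  then show ?thesis unfolding lbl_def
    by (intro C_tsel cf.C_comp[OF C_S] cf.C_id; assumption)
qed

abbreviation "lab d \<equiv> vl (lbl d)"

lemma lab_inj: "lab d = lab d' \<Longrightarrow> d = d'"
proof -
  assume eq: "lab d = lab d'"
  obtain t t' where t: "d < tm (S t)" "d' < tm (S t')" using tm_unbounded by blast
  have "d < tm (S (max t t'))" "d' < tm (S (max t t'))"
    using t tm_mono[of t "max t t'"] tm_mono[of t' "max t t'"] by simp_all
  then show ?thesis using st.lab_inj[of d "max t t'" d'] lbl_eq eq by simp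
qed

lemma final_facts:
  assumes "final t n" "i < n"
  shows "i < K t" "tg (S t) i = img i" "img i < tm (S t)" "w t i = vl (v i)" "cs t i = c i" "tv (S t) (img i) = lbl (img i)"
proof -
  show K: "i < K t" using assms unfolding final_def by (meson order_refl order_less_le_trans)
  show i: "tg (S t) i = img i" by (rule img_eq[OF assms])
  show m: "img i < tm (S t)" using st.g_less[of i t] K st.k_le[of t] i by simp
  show "w t i = vl (v i)" "cs t i = c i" using final_exact[OF assms(1) order_refl assms(2)] by simp_all
  show "tv (S t) (img i) = lbl (img i)" by (rule lbl_eq[OF m])
qed

lemma img_less_iff: "lab (img i) < lab (img j) \<longleftrightarrow> rk i < rk j"
proof -
  obtain t where t: "final t (Suc (max i j))" using ex_final by blast
  have ij: "i < Suc (max i j)" "j < Suc (max i j)" by simp_all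
  note i = final_facts[OF t ij(1)] and j = final_facts[OF t ij(2)]
  show ?thesis using st.g_less_iff_n[of i t j] i j st.k_le[of t] by simp
qed

lemma img_inj: "img i = img j \<Longrightarrow> i = j"
  using img_less_iff[of i j] img_less_iff[of j i] v_inj[of i j] by fastforce

text \<open>By the invariant \<open>d\<close> is in the image of the current map. Lying inside a
  class, it is the image of a number below \<open>max i j\<close>, and these images are
  final.\<close>

lemma trapped:
  assumes "final t k" "i < k" "j < k" "c i = c j" "d < tm (S t)" "lab (img i) < lab d" "lab d < lab (img j)"
  shows "d \<in> range img"
proof -
  note i = final_facts[OF assms(1,2)] and j = final_facts[OF assms(1,3)]
  have "cs (Suc t) i = cs (Suc t) j"
    using final_exact(2)[OF assms(1) _ assms(2), of "Suc t"] final_exact(2)[OF assms(1) _ assms(3), of "Suc t"]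
      assms(4) by simp
  then obtain l where l: "l < K t" "tg (S t) l = d"
    using st.no_trap[OF i(1) j(1) assms(5)] i j assms(6,7) lbl_eq[OF assms(5)] by auto
  have n: "i < tn (S t)" "j < tn (S t)" "l < tn (S t)" using i(1) j(1) l(1) st.k_le[of t] by simp_all
  have "w t i < w t l" "w t l < w t j"
    using st.g_less_iff_n[OF n(1,3)] st.g_less_iff_n[OF n(3,2)] l(2) i j assms(6,7) lbl_eq[OF assms(5)] by simp_all
  then have "l < max i j" using okD(7)[OF st.okn n(1,2,3)] i(5) j(5) assms(4) by simp
  then have "l < k" using assms(2,3) by simp
  then have "img l = d" using img_eq[OF assms(1)] l(2) by simp
  then show ?thesis by blast
qed

text \<open>Let \<open>d\<close> be the least number outside the range, and let \<open>i\<close>,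
  \<open>j\<close> be its neighbours among the first \<open>n0\<close> final images. They are in
  different classes, since nothing stays trapped inside a class. By density there are
  representatives strictly between them; let \<open>k\<close> be the least one. When
  \<open>k\<close> is mapped for the last time, all earlier elements between \<open>i\<close> and
  \<open>j\<close> belong to the classes of these two, so that their images are on the right side of
  \<open>d\<close>. Hence \<open>d\<close> is spare, and it is the least spare element because all
  smaller numbers are in use. So \<open>k\<close> is mapped to \<open>d\<close>.\<close>

lemma surj_img: "d \<in> range img"
proof (induction d rule: less_induct)
  case (less d)
  show ?case
  proof (rule ccontr)
    assume d: "d \<notin> range img"
    have "\<forall>d'. \<exists>i. d' < d \<longrightarrow> img i = d'" using less by blast
    then obtain pre where pre: "\<And>d'. d' < d \<Longrightarrow> img (pre d') = d'" by metis
    obtain sd where sd: "d < tm (S sd)" using tm_unbounded by blast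
    \<comment> \<open>Exceeds the preimages of all numbers below \<open>d\<close>, and also the
      length of the map at stage \<open>sd\<close>. The latter ensures that a position from
      \<open>n0\<close> on is filled for the last time only when \<open>d\<close> exists.\<close>
    define n0 where "n0 = Suc (Suc (tn (S sd) + (\<Sum>d'<d. pre d')))"
    have pre_n0: "pre d' < n0" if "d' < d" for d'
      using member_le_sum[of d' "{..<d}" pre] that unfolding n0_def by simp
    have n0: "2 \<le> n0" "tn (S sd) < n0" unfolding n0_def by simp_all
    have ne: "lab d \<noteq> lab (img i)" for i using lab_inj[of d "img i"] d by auto
    obtain t0 where t0: "final t0 n0" "sd \<le> t0" using ex_final final_mono[of _ n0 _ n0] by (metis max.cobounded1 max.cobounded2 order_refl)
    have dm: "d < tm (S t0)" using sd tm_mono[OF t0(2)] by simp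
    have img01: "img 0 = 0" "img 1 = 1"
      using final_facts(2)[OF t0(1), of 0] final_facts(2)[OF t0(1), of 1] st.g01[of t0] n0(1) by simp_all
    have "lab 0 \<le> lab d" "lab d \<le> lab 1"
      using st.lab_ends[OF dm] lbl_eq[OF dm] lbl_eq[of 0 t0] lbl_eq[of 1 t0] st.m2[of t0] by simp_all
    then have "lab (img 0) < lab d" "lab d < lab (img 1)" using ne[of 0] ne[of 1] img01 by simp_all
    note d01 = this
    obtain i where i: "i < n0" "lab (img i) < lab d"
        "\<And>l. l < n0 \<Longrightarrow> lab (img l) < lab d \<Longrightarrow> lab (img l) \<le> lab (img i)"
      using neighbour_below[of 0 n0 "\<lambda>l. lab (img l)" "lab d"] n0(1) d01(1) by auto
    obtain j where j: "j < n0" "lab d < lab (img j)"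
        "\<And>l. l < n0 \<Longrightarrow> lab d < lab (img l) \<Longrightarrow> lab (img j) \<le> lab (img l)"
      using neighbour_above[of 1 n0 "lab d" "\<lambda>l. lab (img l)"] n0(1) d01(2) by auto
    have old: "rk l \<le> rk i \<or> rk j \<le> rk l" if "l < n0" for l
      using i(3)[OF that] j(3)[OF that] ne[of l] img_less_iff[of i l] img_less_iff[of l j] by force
    have ij: "rk i < rk j" using img_less_iff[of i j] i(2) j(2) by simp
    have cij: "c i \<noteq> c j" using trapped[OF t0(1) i(1) j(1) _ dm i(2) j(2)] d by blast
    let ?G = "\<lambda>k. c k = k \<and> rk i < rk k \<and> rk k < rk j"
    \<comment> \<open>If the representative \<open>c l\<close> were not strictly between
      \<open>i\<close> and \<open>j\<close>, then by convexity the class of \<open>l\<close> would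
      contain \<open>i\<close> or \<open>j\<close>.\<close>
    have rep: "?G (c l)" if l: "rk i < rk l" "rk l < rk j" "c l \<noteq> c i" "c l \<noteq> c j" for l
    proof (intro conjI)
      show "c (c l) = c l" by (rule c_idem)
      show "rk i < rk (c l)"
      proof (rule ccontr)
        assume "\<not> rk i < rk (c l)"
        then consider "c l = i" | "rk (c l) < rk i" using v_inj[of "c l" i] by fastforce
        then show False
          using c_idem[of l] l(3) c_convex[of "c l" l i] l(1) by cases auto
      qed
      show "rk (c l) < rk j"
      proof (rule ccontr)
        assume "\<not> rk (c l) < rk j"
        then consider "c l = j" | "rk j < rk (c l)" using v_inj[of "c l" j] by fastforce
        then show False
          using c_idem[of l] l(4) c_convex[of l "c l" j] l(2) by cases auto
      qed
    qed
    have "\<exists>k. ?G k" using c_dense[OF ij cij] rep by blast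
    then obtain k where k: "c k = k" "rk i < rk k" "rk k < rk j" and k_least: "\<And>l. ?G l \<Longrightarrow> k \<le> l"
      using LeastI_ex[of ?G] Least_le[of ?G] by blast
    have kn0: "n0 \<le> k" using old[of k] k by force
    then have k2: "2 \<le> k" using n0(1) by simp
    define t where "t = fill k"
    have K: "K t = k" and fin: "final t k" and fin': "final (Suc t) (Suc k)"
      using fill[OF k2] unfolding t_def by auto
    have "sd \<le> t"
    proof (rule ccontr)
      assume "\<not> sd \<le> t"
      then have "Suc k \<le> K sd" using fin' unfolding final_def by simp
      then show False using st.k_le[of sd] n0(2) kn0 by simp
    qed
    then have dmt: "d < tm (S t)" using sd tm_mono by (meson order_less_le_trans)
    have ex: "w (Suc t) l = rk l" "cs (Suc t) l = c l" if "l \<le> k" for l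
      using final_exact[OF fin' order_refl, of l] that by simp_all
    have img_t: "tg (S t) l = img l" "tv (S t) (img l) = lbl (img l)" if "l < k" for l
      using final_facts[OF fin that] by simp_all
    have near: "c l = c i \<or> c l = c j" if l: "l < k" "rk i < rk l" "rk l < rk j" for l
      using rep[OF l(2,3)] k_least[of "c l"] c_le[of l] l(1) by force
    have "fitting (Suc t) (S t) k (tv (S t) d)"
      unfolding fitting_def
    proof (intro allI impI conjI)
      fix l assume l: "l < k"
      have ik: "i < k" "j < k" using i(1) j(1) kn0 by simp_all
      {
        assume "w (Suc t) l < w (Suc t) k"
        then have lk: "rk l < rk k" using ex[of l] ex[of k] l by simp
        have "lab (img l) < lab d"
        proof (rule ccontr)
          assume "\<not> lab (img l) < lab d"
          then have dl: "lab d < lab (img l)" using ne[of l] by simp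
          then have il: "rk i < rk l" using img_less_iff[of i l] i(2) by simp
          from near[OF l il] k(3) lk consider "c l = c i" | "c l = c j" by fastforce
          then show False
          proof cases
            case 1
            then show ?thesis using trapped[OF fin ik(1) l _ dmt i(2) dl] d by simp
          next
            case 2
            then have "c k = c j" using c_convex[of l j k] lk k(3) by simp
            then show ?thesis using k(1) c_le[of j] ik(2) by simp
          qed
        qed
        then show "vl (tv (S t) (tg (S t) l)) < vl (tv (S t) d)"
          using img_t[OF l] lbl_eq[OF dmt] by simp
      next
        assume "w (Suc t) k < w (Suc t) l"
        then have lk: "rk k < rk l" using ex[of l] ex[of k] l by simp
        have "lab d < lab (img l)"
        proof (rule ccontr)
          assume "\<not> lab d < lab (img l)"
          then have dl: "lab (img l) < lab d" using ne[of l] by simp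
          then have lj: "rk l < rk j" using img_less_iff[of l j] j(2) by simp
          from near[OF l _ lj] k(2) lk consider "c l = c i" | "c l = c j" by fastforce
          then show False
          proof cases
            case 1
            then have "c k = c i" using c_convex[of i l k] lk k(2) by simp
            then show ?thesis using k(1) c_le[of i] ik(1) by simp
          next
            case 2
            then show ?thesis using trapped[OF fin l ik(2) _ dmt dl j(2)] d by simp
          qed
        qed
        then show "vl (tv (S t) d) < vl (tv (S t) (tg (S t) l))"
          using img_t[OF l] lbl_eq[OF dmt] by simp
      }
    qed
    then have le: "spare (Suc t) (S t) k \<le> d"
      using img_t(1) d by (intro spare_le) auto
    then have sm: "spare (Suc t) (S t) k < tm (S t)" using dmt by simp
    have "spare (Suc t) (S t) k = d"
    proof (rule ccontr)
      assume "spare (Suc t) (S t) k \<noteq> d"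
      then have lt: "spare (Suc t) (S t) k < d" using le by simp
      have "pre (spare (Suc t) (S t) k) < k" using pre_n0[OF lt] kn0 by simp
      then have "tg (S t) (pre (spare (Suc t) (S t) k)) = spare (Suc t) (S t) k"
        using img_t(1) pre[OF lt] by simp
      then show False using spareD[OF sm] \<open>pre (spare (Suc t) (S t) k) < k\<close> by blast
    qed
    moreover have "tg (S (Suc t)) k = spare (Suc t) (S t) k"
    proof (rule st.step2_cases[OF step_S[of t]], goal_cases)
      case 1
      then show ?case using K by simp
    next
      case 2
      then show ?case using K k(1) ex[of k] sm by simp
    next
      case 3
      then have "tn (S (Suc t)) = k" using K by simp
      moreover have "Suc k \<le> K (Suc t)" using fin' unfolding final_def by simp
      ultimately show ?case using K_le_tn(1)[of t] by simp
    qed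
    ultimately have "img k = d" using img_eq[OF fin', of k] by simp
    then show False using d by blast
  qed
qed

text \<open>Elements without a preimage count as separated from all others. This remains correct
  when they are reused, since they come back as the only mapped member of a class.\<close>

definition split_at :: "nat \<Rightarrow> nat \<Rightarrow> nat \<Rightarrow> bool" where
  "split_at d d' t \<longleftrightarrow> d \<noteq> d' \<and> d < tm (S t) \<and> d' < tm (S t) \<and>
    \<not> (\<exists>i<tn (S t). \<exists>j<tn (S t). tg (S t) i = d \<and> tg (S t) j = d' \<and> cs t i = cs t j)"

lemma dec_split: "cf.dec (\<lambda>z. split_at (pi1 z) (pi1 (pi2 z)) (pi2 (pi2 z)))"
  unfolding split_at_def by (intro dec_rules2 cf.C_comp[OF C_S])

text \<open>Classes are only joined by new elements, so that a split is permanent.\<close>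

lemma split_Suc:
  assumes "split_at d d' t"
  shows "split_at d d' (Suc t)"
proof -
  note a = assms[unfolded split_at_def]
  have m: "d < tm (S (Suc t))" "d' < tm (S (Suc t))" using a tm_Suc[of t] by simp_all
  have False if ij: "i < tn (S (Suc t))" "j < tn (S (Suc t))" "tg (S (Suc t)) i = d" "tg (S (Suc t)) j = d'"
    "cs (Suc t) i = cs (Suc t) j" for i j
  proof -
    have ok: "ok (Suc t) (tn (S (Suc t)))" by (rule st.okn)
    have old: "tg (S (Suc t)) l = tg (S t) l" "cs (Suc t) l = cs t l" "l < tn (S t)" if "l < K t" for l
      using st.step2_old(2)[OF step_S that] st.ub(2)[OF that] st.k_le[of t] that by simp_all
    \<comment> \<open>In the case of reuse \<open>K t\<close> represents its class, but the
      representative of the class of \<open>l\<close> is at most \<open>l < K t\<close>.\<close>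
    have new: "tg (S (Suc t)) (K t) = tm (S t)" if "K t < tn (S (Suc t))" "l < K t" "cs (Suc t) (K t) = cs (Suc t) l" for l
    proof (rule st.step2_cases[OF step_S[of t]], goal_cases)
      case 1
      have "cs (Suc t) l \<le> l" using okD(2)[OF ok, of l l] that by simp
      then show ?case using 1(4) that by simp
    qed (use that in simp_all)
    have "i \<le> K t" "j \<le> K t" using ij(1,2) tn_Suc[of t] by auto
    moreover have "i \<noteq> j" using ij(3,4) a by auto
    ultimately consider "i < K t" "j < K t" | "i = K t" "j < K t" | "i < K t" "j = K t" by linarith
    then show False
    proof cases
      case 1
      then show ?thesis using a ij old by metis
    next
      case 2
      then show ?thesis using new[of j] ij a by simp
    next
      case 3
      then show ?thesis using new[of i] ij a by simp
    qed
  qed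
  then show ?thesis unfolding split_at_def using m a by blast
qed

lemma split_mono:
  assumes "split_at d d' t" "t \<le> t'"
  shows "split_at d d' t'"
  using assms(2) by (induction t' rule: dec_induct) (simp_all add: assms(1) split_Suc)

text \<open>As soon as both elements have their final preimages, \<open>split_at\<close> agrees with
  the classes. A split recorded earlier persists until then.\<close>

lemma nonblock_iff: "\<not> blk lab d d' \<longleftrightarrow> (\<exists>t. split_at d d' t)"
proof -
  obtain i j where i: "d = img i" and j: "d' = img j" using surj_img by blast
  have bij: "bij img" unfolding bij_def inj_def surj_def using img_inj surj_img by blast
  have b: "blk lab d d' \<longleftrightarrow> c i = c j"
    unfolding i j using blk_iso[OF bij, of lab rk] img_less_iff blk_iff by simp
  obtain t where t: "final t (Suc (max i j))" using ex_final by blast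
  have ij: "i < Suc (max i j)" "j < Suc (max i j)" by simp_all
  have *: "split_at d d' t' \<longleftrightarrow> c i \<noteq> c j" if t': "t \<le> t'" for t'
  proof -
    have fin: "final t' (Suc (max i j))" using final_mono[OF t t'] by simp
    note fi = final_facts[OF fin ij(1)] and fj = final_facts[OF fin ij(2)]
    have n: "i < tn (S t')" "j < tn (S t')" using fi(1) fj(1) st.k_le[of t'] by simp_all
    have "(\<exists>i'<tn (S t'). \<exists>j'<tn (S t'). tg (S t') i' = d \<and> tg (S t') j' = d' \<and> cs t' i' = cs t' j')
        \<longleftrightarrow> c i = c j" (is "?L \<longleftrightarrow> _")
    proof
      assume ?L
      then obtain i' j' where *: "i' < tn (S t')" "j' < tn (S t')" "tg (S t') i' = d" "tg (S t') j' = d'"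
        "cs t' i' = cs t' j'" by blast
      have "i' = i" "j' = j" using tg_inj[OF *(1) n(1)] tg_inj[OF *(2) n(2)] * fi(2) fj(2) i j by simp_all
      then show "c i = c j" using *(5) fi(5) fj(5) by simp
    next
      assume "c i = c j"
      then show ?L using n fi(2,5) fj(2,5) i j by metis
    qed
    moreover have "d < tm (S t')" "d' < tm (S t')" using fi(3) fj(3) i j by simp_all
    moreover have "c i \<noteq> c j \<Longrightarrow> d \<noteq> d'" using i j img_inj by auto
    ultimately show ?thesis unfolding split_at_def by blast
  qed
  have "split_at d d' (max t u)" if "split_at d d' u" for u using split_mono[OF that] by simp
  then show ?thesis using *[OF order_refl] *[of "max t _"] b by (metis max.cobounded1)
qed

end

theorem (in block_presentation) ex_computable_copy:
  assumes "limit_fun v" "limit_fun c"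
  shows "\<exists>l f P. computable_fun l \<and> inj (\<lambda>i. vl (l i)) \<and> bij f \<and>
    (\<forall>i j. vl (l (f i)) < vl (l (f j)) \<longleftrightarrow> vl (v i) < vl (v j)) \<and>
    cf.dec (\<lambda>z. P (pi1 z) (pi1 (pi2 z)) (pi2 (pi2 z))) \<and>
    (\<forall>x y. \<not> blk (\<lambda>i. vl (l i)) x y \<longleftrightarrow> (\<exists>s. P x y s))"
proof -
  obtain vs' where vs': "computable_fun (\<lambda>z. vs' (pi1 z) (pi2 z))" "\<forall>x. \<forall>\<^sub>F s in sequentially. vs' s x = v x"
    using assms(1) unfolding limit_fun_def by blast
  obtain cs' where cs': "computable_fun (\<lambda>z. cs' (pi1 z) (pi2 z))" "\<forall>x. \<forall>\<^sub>F s in sequentially. cs' s x = c x"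
    using assms(2) unfolding limit_fun_def by blast
  have lim: "\<forall>\<^sub>F s in sequentially. vs' s x = v x \<and> cs' s x = c x" for x
    using vs'(2) cs'(2) by (simp add: eventually_conj_iff)
  then have "\<forall>\<^sub>F s in sequentially. \<forall>x\<in>{..<2}. vs' s x = v x \<and> cs' s x = c x"
    by (intro eventually_ball_finite) auto
  then obtain s0 where s0: "\<And>s x. s0 \<le> s \<Longrightarrow> x < 2 \<Longrightarrow> vs' s x = v x \<and> cs' s x = c x"
    unfolding eventually_sequentially by auto
  \<comment> \<open>The shift of stages makes the approximations of both end elements exact from the
    beginning.\<close>
  let ?vs = "\<lambda>s. vs' (s + s0)" and ?cs = "\<lambda>s. cs' (s + s0)"
  interpret approx_presentation v c ?vs ?cs
  proof
    show "computable_fun (\<lambda>z. ?vs (pi1 z) (pi2 z))"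
      by (rule cf.C_comp2[OF vs'(1)]) (intro cf.dec_rules)+
    show "computable_fun (\<lambda>z. ?cs (pi1 z) (pi2 z))"
      by (rule cf.C_comp2[OF cs'(1)]) (intro cf.dec_rules)+
    show "\<forall>\<^sub>F s in sequentially. ?vs s i = v i \<and> ?cs s i = c i" for i
      using lim[of i] by (subst eventually_sequentially_seg)
    show "?vs s i = v i \<and> ?cs s i = c i" if "i < 2" for s i using s0 that by simp
  qed
  obtain \<tau> where \<tau>: "tsound 0 \<tau>" "tn \<tau> = 2" using ex_tinitial by blast
  have ex: "\<exists>s'. step2 t s s'" if "tsound t s" for t s
  proof -
    interpret fold_stage v c ?vs ?cs t s "keep t s" by unfold_locales (simp_all add: that)
    show ?thesis by (rule ex_step2)
  qed
  have pres: "tsound (Suc t) s'" if "tsound t s" "step2 t s s'" for t s s'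
  proof -
    interpret fold_stage v c ?vs ?cs t s "keep t s" by unfold_locales (simp_all add: that)
    show ?thesis by (rule tsound_step2[OF that(2)])
  qed
  obtain S where S: "computable_fun S" "S 0 = \<tau>" "\<And>t. tsound t (S t)" "\<And>t. step2 t (S t) (S (Suc t))"
    by (rule cf.least_run[of step2 tsound \<tau>]) (use dec_step2 \<tau> ex pres in blast)+
  interpret run: fold_run v c ?vs ?cs S by unfold_locales (use S \<tau> in simp_all)
  have "inj (\<lambda>i. vl (run.lbl i))" using run.lab_inj by (auto intro: injI)
  moreover have "bij run.img" unfolding bij_def inj_def surj_def using run.img_inj run.surj_img by blast
  ultimately show ?thesis
    using run.computable_lbl run.img_less_iff run.dec_split run.nonblock_iff by blast
qed

section \<open>Orders with a copy of the required kind\<close>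

definition computable_less :: "(nat \<Rightarrow> real) \<Rightarrow> bool" where
  "computable_less r \<longleftrightarrow> inj r \<and> cf.dec (\<lambda>z. r (pi1 z) < r (pi2 z))"

text \<open>Enumerability is expressed as projection of a decidable \<open>P\<close>, a form that is
  easily composed with computable maps when end points are removed or added.\<close>

definition has_copy :: "(nat \<Rightarrow> real) \<Rightarrow> bool" where
  "has_copy r \<longleftrightarrow> (\<exists>r' f P. computable_less r' \<and> bij f \<and> (\<forall>i j. r' (f i) < r' (f j) \<longleftrightarrow> r i < r j) \<and>
    cf.dec (\<lambda>z. P (pi1 z) (pi1 (pi2 z)) (pi2 (pi2 z))) \<and> (\<forall>x y. \<not> blk r' x y \<longleftrightarrow> (\<exists>s. P x y s)))"

lemma has_copyE:
  assumes "has_copy r"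
  obtains r' f P where "computable_less r'" "bij f" "\<And>i j. r' (f i) < r' (f j) \<longleftrightarrow> r i < r j"
    "cf.dec (\<lambda>z. P (pi1 z) (pi1 (pi2 z)) (pi2 (pi2 z)))" "\<And>x y. \<not> blk r' x y \<longleftrightarrow> (\<exists>s. P x y s)"
  using assms unfolding has_copy_def by auto

lemma has_copyI:
  assumes "computable_less r'" "bij f" "\<And>i j. r' (f i) < r' (f j) \<longleftrightarrow> r i < r j"
    "cf.dec (\<lambda>z. P (pi1 z) (pi1 (pi2 z)) (pi2 (pi2 z)))" "\<And>x y. \<not> blk r' x y \<longleftrightarrow> (\<exists>s. P x y s)"
  shows "has_copy r"
  unfolding has_copy_def using assms by blast

lemma dec_rank_less:
  "computable_less r \<Longrightarrow> computable_fun f \<Longrightarrow> computable_fun g \<Longrightarrow> cf.dec (\<lambda>x. r (f x) < r (g x))"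
  unfolding computable_less_def by (rule cf.dec_comp2[of "\<lambda>x y. r x < r y"]) simp_all

lemma has_copy_bounded:
  assumes r: "computable_less r" and "rich r"
    and ends: "\<And>x. r a \<le> r x" "\<And>x. r x \<le> r b" "\<not> blk r a b"
  shows "has_copy r"
proof -
  interpret ranked r using r unfolding computable_less_def by unfold_locales simp
  \<comment> \<open>The decidable matrix of \<open>E\<close> as a universal statement, with
    non-strict comparisons written as negated strict ones.\<close>
  let ?P = "\<lambda>z y. pi1 (pi2 z) = pi2 (pi2 z) \<or> \<not> ((\<not> r y < r (pi1 (pi2 z)) \<and> \<not> r (pi2 (pi2 z)) < r y) \<or>
    (\<not> r y < r (pi2 (pi2 z)) \<and> \<not> r (pi1 (pi2 z)) < r y)) \<or> y < pi1 z"
  have "cf.dec (\<lambda>z. ?P (pi1 z) (pi2 z))" by (intro cf.dec_rules dec_rank_less[OF r])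
  then have "lf.dec (\<lambda>z. \<forall>y. ?P z y)" by (rule limit_dec_all)
  moreover have "(\<forall>y. ?P z y) \<longleftrightarrow> E (pi1 z) (pi1 (pi2 z)) (pi2 (pi2 z))" for z
    unfolding E_def subset_eq Ball_def in_cint_iff not_less lessThan_iff by blast
  ultimately have dec_E: "lf.dec (\<lambda>z. E (pi1 z) (pi1 (pi2 z)) (pi2 (pi2 z)))" by simp
  have "lf.dec (\<lambda>z. r (pi1 z) < r (pi2 z))"
    using r unfolding computable_less_def by (simp add: computable_dec_imp_limit)
  then interpret unfold_classes limit_fun r a b
    by unfold_locales (use dec_E ends assms(2) in auto)
  obtain v c f where vc: "limit_fun v" "limit_fun c" "block_presentation v c" and f: "bij f"
    "\<And>i j. vl (v i) < vl (v j) \<longleftrightarrow> r (f i) < r (f j)"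
    using ex_block_presentation by blast
  interpret block_presentation v c by (rule vc(3))
  obtain l g P where l: "computable_fun l" "inj (\<lambda>i. vl (l i))" and g: "bij g"
    "\<And>i j. vl (l (g i)) < vl (l (g j)) \<longleftrightarrow> vl (v i) < vl (v j)"
    and P: "cf.dec (\<lambda>z. P (pi1 z) (pi1 (pi2 z)) (pi2 (pi2 z)))"
    "\<And>x y. \<not> blk (\<lambda>i. vl (l i)) x y \<longleftrightarrow> (\<exists>s. P x y s)"
    using ex_computable_copy[OF vc(1,2)] by auto
  show ?thesis
  proof (rule has_copyI[OF _ _ _ P])
    show "computable_less (\<lambda>i. vl (l i))"
      unfolding computable_less_def using l(2) by (auto intro!: cf.dec_rules cf.C_comp[OF l(1)])
    show "bij (\<lambda>i. g (the_inv f i))"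
      using bij_comp[OF bij_betw_the_inv_into[OF f(1)] g(1)] unfolding comp_def .
    have "f (the_inv f i) = i" for i using f(1) by (simp add: f_the_inv_into_f_bij_betw)
    then show "vl (l (g (the_inv f i))) < vl (l (g (the_inv f j))) \<longleftrightarrow> r i < r j" for i j
      using g(2) f(2) by simp
  qed
qed

subsection \<open>Removing the assumption on end points\<close>

lemma blk_sub:
  assumes "inj e" "cint r (e x) (e y) \<subseteq> range e"
  shows "blk (\<lambda>i. r (e i)) x y \<longleftrightarrow> blk r (e x) (e y)"
proof -
  have "cint r (e x) (e y) = e ` cint (\<lambda>i. r (e i)) x y"
  proof (intro set_eqI iffI)
    fix z assume z: "z \<in> cint r (e x) (e y)"
    then obtain i where i: "z = e i" using assms(2) by auto
    then have "i \<in> cint (\<lambda>i. r (e i)) x y" using z by (simp add: in_cint_iff)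
    then show "z \<in> e ` cint (\<lambda>i. r (e i)) x y" using i by blast
  qed (auto simp: in_cint_iff)
  moreover have "inj_on e (cint (\<lambda>i. r (e i)) x y)" using assms(1) by (meson inj_on_subset subset_UNIV)
  ultimately show ?thesis unfolding blk_def by (simp add: finite_image_iff)
qed

lemma blk_neg: "blk (\<lambda>i. - r i) x y \<longleftrightarrow> blk r x y"
proof -
  have "cint (\<lambda>i. - r i) x y = cint r x y" by (auto simp: cint_def)
  then show ?thesis by (simp add: blk_def)
qed

lemma rich_neg: "rich r \<Longrightarrow> rich (\<lambda>i. - r i)"
proof -
  assume rich: "rich r"
  have cint: "cint (\<lambda>i. - r i) x y = cint r x y" for x y by (auto simp: cint_def)
  show ?thesis
    unfolding rich_def blk_neg cint
  proof (intro allI impI)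
    fix x y :: nat and k assume xy: "- r x < - r y" "\<not> blk r x y"
    then have "r y < r x" "\<not> blk r y x" by (simp_all add: blk_commute)
    from rich[unfolded rich_def, rule_format, OF this, of k]
    show "\<exists>S. finite S \<and> k \<le> card S \<and> (\<forall>s\<in>S. - r x < - r s \<and> - r s < - r y \<and> \<not> blk r x s \<and> \<not> blk r s y) \<and>
        (\<forall>s\<in>S. \<forall>s'\<in>S. cint r s s' \<subseteq> S)"
      by (auto simp: blk_commute)
  qed
qed

lemma computable_less_neg: "computable_less r \<Longrightarrow> computable_less (\<lambda>i. - r i)"
  unfolding computable_less_def using cf.dec_comp[of "\<lambda>z. r (pi1 z) < r (pi2 z)" "\<lambda>z. pr (pi2 z) (pi1 z)"]
  by (auto simp: inj_def cf.C_pr cf.C_pi1 cf.C_pi2 cf.C_id)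

lemma has_copy_neg: "has_copy r \<Longrightarrow> has_copy (\<lambda>i. - r i)"
proof (erule has_copyE)
  fix r' f P assume a: "computable_less r'" "bij f" "\<And>i j. r' (f i) < r' (f j) \<longleftrightarrow> r i < r j"
    "cf.dec (\<lambda>z. P (pi1 z) (pi1 (pi2 z)) (pi2 (pi2 z)))" "\<And>x y. \<not> blk r' x y \<longleftrightarrow> (\<exists>s. P x y s)"
  show ?thesis
    by (rule has_copyI[OF computable_less_neg[OF a(1)] a(2) _ a(4)]) (simp_all add: a(3,5) blk_neg)
qed

text \<open>If there is no first block, a new first element is a block of its own and richness is
  preserved. In the copy this element is dropped again by closing the gap in the numbering. The
  exponential frees the rank 0.\<close>

lemma prepend_first:
  fixes r :: "nat \<Rightarrow> real"
  assumes r: "computable_less r" and rich: "rich r"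
    and open_end: "\<And>x. \<exists>y. r y < r x \<and> \<not> blk r y x"
  defines "r' \<equiv> \<lambda>i. case i of 0 \<Rightarrow> 0 | Suc j \<Rightarrow> exp (r j)"
  shows "computable_less r'" "rich r'" "\<And>x. r' 0 \<le> r' x" "has_copy r' \<Longrightarrow> has_copy r"
    "blk r' (Suc x) (Suc y) \<longleftrightarrow> blk r x y"
proof -
  have r'_simps: "r' 0 = 0" "r' (Suc j) = exp (r j)" for j by (simp_all add: r'_def)
  have inj: "inj r" using r unfolding computable_less_def by simp
  have blk_exp: "blk (\<lambda>i. exp (r i)) x y \<longleftrightarrow> blk r x y" for x y
    unfolding blk_def cint_def by simp
  have range: "cint r' (Suc x) (Suc y) \<subseteq> range Suc" for x y
  proof
    fix z assume "z \<in> cint r' (Suc x) (Suc y)"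
    then show "z \<in> range Suc" by (cases z) (auto simp: in_cint_iff r'_simps not_le)
  qed
  show blk: "blk r' (Suc x) (Suc y) \<longleftrightarrow> blk r x y" for x y
    using blk_sub[OF _ range[of x y]] blk_exp[of x y] by (simp add: r'_simps)
  show le: "r' 0 \<le> r' x" for x by (cases x) (simp_all add: r'_simps)
  have less_iff: "r' i < r' j \<longleftrightarrow> i = 0 \<and> j \<noteq> 0 \<or> i \<noteq> 0 \<and> j \<noteq> 0 \<and> r (i - 1) < r (j - 1)" for i j
    by (cases i; cases j) (simp_all add: r'_simps not_less)
  show c: "computable_less r'"
    unfolding computable_less_def
  proof
    show "inj r'"
    proof (rule injI)
      fix i j assume "r' i = r' j"
      then show "i = j" using injD[OF inj] by (cases i; cases j) (auto simp: r'_simps)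
    qed
    show "cf.dec (\<lambda>z. r' (pi1 z) < r' (pi2 z))"
      unfolding less_iff by (intro cf.dec_rules dec_rank_less[OF r] cf.C_pred)
  qed
  have nblk0: "\<not> blk r' 0 (Suc x)" for x
  proof
    assume b: "blk r' 0 (Suc x)"
    obtain y where y: "r y < r x" "\<not> blk r y x" using open_end by blast
    then have "Suc y \<in> cint r' (Suc x) 0" by (simp add: in_cint_iff r'_simps)
    then show False using blk_mono[of r' "Suc x" 0 "Suc y"] b y(2) blk blk_commute by blast
  qed
  show "rich r'"
    unfolding rich_def
  proof (intro allI impI)
    fix x y k assume xy: "r' x < r' y" "\<not> blk r' x y"
    obtain y0 where y0: "y = Suc y0" using xy(1) le[of x] by (cases y) (auto simp: not_less)
    \<comment> \<open>In an interval that starts at the new element, this element is replaced by an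
      old one in a block before that of \<open>y\<close>.\<close>
    obtain x0 where x0: "r x0 < r y0" "\<not> blk r x0 y0" "r' x \<le> r' (Suc x0)"
        "\<And>s. \<not> blk r x0 s \<Longrightarrow> \<not> blk r' x (Suc s)"
    proof (cases x)
      case 0
      obtain x0 where "r x0 < r y0" "\<not> blk r x0 y0" using open_end by blast
      then show thesis using that[of x0] le 0 nblk0 by simp
    next
      case (Suc x0)
      then show thesis using that[of x0] xy y0 blk by (simp add: r'_simps)
    qed
    obtain S where S: "finite S" "k \<le> card S" "\<And>s. s \<in> S \<Longrightarrow> r x0 < r s \<and> r s < r y0 \<and> \<not> blk r x0 s \<and> \<not> blk r s y0"
        "\<And>s s'. s \<in> S \<Longrightarrow> s' \<in> S \<Longrightarrow> cint r s s' \<subseteq> S"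
      using rich[unfolded rich_def, rule_format, OF x0(1,2), of k] by blast
    have "cint r' (Suc s) (Suc s') \<subseteq> Suc ` S" if "s \<in> S" "s' \<in> S" for s s'
    proof
      fix z assume z: "z \<in> cint r' (Suc s) (Suc s')"
      then obtain w where w: "z = Suc w" using range by blast
      then have "w \<in> cint r s s'" using z by (simp add: in_cint_iff r'_simps)
      then show "z \<in> Suc ` S" using S(4)[OF that] w by blast
    qed
    moreover have "r' x < r' (Suc s)" "r' (Suc s) < r' y" "\<not> blk r' x (Suc s)" "\<not> blk r' (Suc s) y"
      if "s \<in> S" for s
    proof -
      have "exp (r x0) < exp (r s)" using S(3)[OF that] by simp
      then show "r' x < r' (Suc s)" using x0(3) unfolding r'_simps by linarith
      show "r' (Suc s) < r' y" "\<not> blk r' x (Suc s)" "\<not> blk r' (Suc s) y"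
        using S(3)[OF that] x0(4)[of s] y0 blk by (simp_all add: r'_simps)
    qed
    ultimately show "\<exists>S. finite S \<and> k \<le> card S \<and> (\<forall>s\<in>S. r' x < r' s \<and> r' s < r' y \<and> \<not> blk r' x s \<and> \<not> blk r' s y) \<and>
        (\<forall>s\<in>S. \<forall>s'\<in>S. cint r' s s' \<subseteq> S)"
      using S(1,2) by (intro exI[of _ "Suc ` S"]) (auto simp: card_image)
  qed
  show "has_copy r" if "has_copy r'"
    using that
  proof (rule has_copyE)
    fix q f P assume q: "computable_less q" and f: "bij f" "\<And>i j. q (f i) < q (f j) \<longleftrightarrow> r' i < r' j"
      and P: "cf.dec (\<lambda>z. P (pi1 z) (pi1 (pi2 z)) (pi2 (pi2 z)))" "\<And>x y. \<not> blk q x y \<longleftrightarrow> (\<exists>s. P x y s)"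
    let ?m = "f 0"
    \<comment> \<open>\<open>?e\<close> enumerates the numbers other than \<open>?m\<close>, and
      \<open>?g\<close> is its inverse.\<close>
    let ?e = "\<lambda>n. if n < ?m then n else Suc n"
    let ?g = "\<lambda>n. if n < ?m then n else n - 1"
    have f_ne: "f (Suc i) \<noteq> ?m" for i using f(1) by (metis bij_pointE nat.distinct(1))
    have eg: "?e (?g n) = n" if "n \<noteq> ?m" for n using that by auto
    have ge: "?g (?e n) = n" for n by simp
    have e_inj: "inj ?e" by (rule inj_on_inverseI[of _ ?g]) (rule ge)
    have e_ne: "?e n \<noteq> ?m" for n by simp
    have q_min: "q ?m < q (?e n)" for n
    proof -
      obtain i where i: "?e n = f i" using f(1) by (metis bij_pointE)
      then have "i \<noteq> 0" using e_ne by metis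
      then show ?thesis unfolding i f(2) using less_iff[of 0 i] by simp
    qed
    have range_e: "cint q (?e x) (?e y) \<subseteq> range ?e" for x y
    proof
      fix z assume "z \<in> cint q (?e x) (?e y)"
      then have "q ?m < q z" using q_min[of x] q_min[of y] unfolding in_cint_iff by linarith
      then have "z \<noteq> ?m" by auto
      then show "z \<in> range ?e" by (intro range_eqI[of _ ?e "?g z"] eg[symmetric])
    qed
    have Ce: "computable_fun (\<lambda>x. ?e (h x))" if "computable_fun h" for h
      using that by (intro cf.C_if cf.dec_rules)
    show ?thesis
    proof (rule has_copyI)
      show "computable_less (\<lambda>n. q (?e n))"
        unfolding computable_less_def
      proof
        have "inj q" using q unfolding computable_less_def by simp
        then have "inj (q \<circ> ?e)" using e_inj by (rule inj_compose)
        then show "inj (\<lambda>n. q (?e n))" unfolding comp_def .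
        show "cf.dec (\<lambda>z. q (?e (pi1 z)) < q (?e (pi2 z)))"
          by (rule dec_rank_less[OF q Ce Ce]) (intro cf.dec_rules)+
      qed
      show "bij (\<lambda>i. ?g (f (Suc i)))"
      proof (rule bijI)
        show "inj (\<lambda>i. ?g (f (Suc i)))"
        proof (rule injI)
          fix i j assume "?g (f (Suc i)) = ?g (f (Suc j))"
          then have "?e (?g (f (Suc i))) = ?e (?g (f (Suc j)))" by (rule arg_cong)
          then have "f (Suc i) = f (Suc j)" unfolding eg[OF f_ne] .
          then show "i = j" using injD[OF bij_is_inj[OF f(1)]] by blast
        qed
        show "surj (\<lambda>i. ?g (f (Suc i)))"
          unfolding surj_def
        proof
          fix y
          obtain j where j: "?e y = f j" using f(1) by (metis bij_pointE)
          have "j \<noteq> 0" using e_ne[of y] j by (intro notI) simp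
          then obtain i where i: "j = Suc i" by (cases j) auto
          have "y = ?g (f (Suc i))" unfolding i[symmetric] j[symmetric] using ge[of y] by simp
          then show "\<exists>x. y = ?g (f (Suc x))" ..
        qed
      qed
      show "q (?e (?g (f (Suc i)))) < q (?e (?g (f (Suc j)))) \<longleftrightarrow> r i < r j" for i j
        unfolding eg[OF f_ne] f(2) by (simp add: r'_simps)
      show "cf.dec (\<lambda>z. P (?e (pi1 z)) (?e (pi1 (pi2 z))) (pi2 (pi2 z)))"
        by (rule cf.dec_comp3[OF P(1) Ce Ce]) (intro cf.dec_rules)+
      show "\<not> blk (\<lambda>n. q (?e n)) x y \<longleftrightarrow> (\<exists>s. P (?e x) (?e y) s)" for x y
        using blk_sub[OF e_inj range_e] P(2) by simp
    qed
  qed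
qed

lemma computable_enumerate:
  assumes D: "infinite D" and dec: "cf.dec (\<lambda>x. x \<in> D)"
  shows "computable_fun (enumerate D)"
proof -
  let ?P = "\<lambda>(t::nat) s s'. s' \<in> D \<and> s < s' \<and> (\<forall>y<s'. \<not> (y \<in> D \<and> s < y))"
  have dec': "cf.dec (\<lambda>x. f x \<in> D)" if "computable_fun f" for f by (rule cf.dec_comp[OF dec that])
  have dP: "cf.dec (\<lambda>z. ?P (pi1 z) (pi1 (pi2 z)) (pi2 (pi2 z)))"
    by (intro cf.dec_rules dec')
  have P_iff: "?P t s s' \<longleftrightarrow> s' = (LEAST y. y \<in> D \<and> s < y)" for t s s' :: nat
  proof
    assume "?P t s s'"
    then show "s' = (LEAST y. y \<in> D \<and> s < y)"
      by (intro Least_equality[symmetric]) (auto simp: not_less[symmetric])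
  next
    assume s': "s' = (LEAST y. y \<in> D \<and> s < y)"
    have "\<exists>y. y \<in> D \<and> s < y" using D by (metis infinite_nat_iff_unbounded)
    then have "s' \<in> D \<and> s < s'" unfolding s' by (rule LeastI_ex)
    moreover have "\<not> (y \<in> D \<and> s < y)" if "y < s'" for y using that not_less_Least unfolding s' by blast
    ultimately show "?P t s s'" by blast
  qed
  obtain S where S: "computable_fun S" "S 0 = enumerate D 0" "\<And>t. True" "\<And>t. ?P t (S t) (S (Suc t))"
    by (rule cf.least_run[of ?P "\<lambda>_ _. True" "enumerate D 0"]) (use dP P_iff in blast)+
  have "S t = enumerate D t" for t
  proof (induction t)
    case (Suc t)
    have "S (Suc t) = (LEAST y. y \<in> D \<and> S t < y)" using S(4) P_iff by blast
    then show ?case using Suc enumerate_Suc''[OF D] by simp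
  qed (rule S(2))
  then have "S = enumerate D" by (rule ext)
  then show ?thesis using S(1) by simp
qed

lemma computable_half:
  assumes "computable_fun f"
  shows "computable_fun (\<lambda>x. f x div 2)" "cf.dec (\<lambda>x. even (f x))"
proof -
  have half: "x div 2 = (LEAST k. x < Suc (Suc (k + k)))" for x :: nat
    by (rule Least_equality[symmetric]) auto
  have "x < Suc (Suc (x + x))" for x by simp
  then have "computable_fun (\<lambda>x. x div 2)"
    unfolding half by (intro cf.C_Least cf.dec_rules exI)
  from cf.C_comp[OF this assms] show C: "computable_fun (\<lambda>x. f x div 2)" .
  have "even x \<longleftrightarrow> x = x div 2 + x div 2" for x :: nat by presburger
  then show "cf.dec (\<lambda>x. even (f x))" using cf.dec_eq[OF assms cf.C_add[OF C C]] by simp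
qed

text \<open>Below \<open>c\<close> all intervals are finite and there is no first element, so this
  part has the order type of the negative integers and belongs to the block of \<open>c\<close>. It
  is enough to copy the rest \<open>D\<close>, which is computable with \<open>c\<close> as a
  parameter, and to put the negative integers in front of the copy.\<close>

lemma drop_initial:
  fixes r :: "nat \<Rightarrow> real"
  assumes r: "computable_less r" and rich: "rich r"
    and below: "\<forall>y. r y < r c \<longrightarrow> blk r y c" and no_first: "\<And>x. \<exists>y. r y < r x"
    and nb: "\<not> blk r c d"
  defines "D \<equiv> {z. r c \<le> r z}"
  defines "r' \<equiv> \<lambda>i. r (enumerate D i)"
  shows "computable_less r'" "rich r'" "\<exists>a. \<forall>x. r' a \<le> r' x" "has_copy r' \<Longrightarrow> has_copy r"
    "\<exists>x y. \<not> blk r' x y" "\<And>b. (\<And>x. r x \<le> r b) \<Longrightarrow> \<exists>b'. \<forall>x. r' x \<le> r' b'"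
proof -
  let ?e = "enumerate D"
  note c = below[rule_format]
  interpret ranked r using r unfolding computable_less_def by unfold_locales simp
  have cd: "r c < r d"
  proof (rule ccontr)
    assume "\<not> r c < r d"
    moreover have "c \<noteq> d" using nb by auto
    ultimately have "blk r d c" using c[of d] r_eq[of c d] by linarith
    then show False using nb blk_commute by blast
  qed
  have "infinite (cint r c d)" using nb unfolding blk_def .
  moreover have "cint r c d \<subseteq> D" unfolding D_def using cd by (auto simp: in_cint_iff)
  ultimately have infD: "infinite D" using finite_subset by blast
  have range_e: "range ?e = D" by (rule range_enumerate[OF infD])
  have inj_e: "inj ?e" using strict_mono_enumerate[OF infD] by (rule strict_mono_imp_inj_on)
  have "cf.dec (\<lambda>x. \<not> r x < r c)" by (intro cf.dec_rules dec_rank_less[OF r])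
  then have Ce: "computable_fun ?e" by (intro computable_enumerate infD) (simp add: D_def not_less)
  define ei where "ei = inv_into UNIV ?e"
  have ei: "?e (ei z) = z" if "z \<in> D" for z unfolding ei_def using that range_e by (simp add: f_inv_into_f)
  have ei': "ei (?e i) = i" for i unfolding ei_def using inj_e by (simp add: inv_f_f)
  have eD: "?e i \<in> D" for i using range_e by blast
  have cD: "c \<in> D" unfolding D_def by simp
  have dD: "d \<in> D" unfolding D_def using cd by simp
  have blk': "blk r' x y \<longleftrightarrow> blk r (?e x) (?e y)" for x y
    unfolding r'_def
  proof (rule blk_sub[OF inj_e])
    show "cint r (?e x) (?e y) \<subseteq> range ?e"
      unfolding range_e using eD[of x] eD[of y] unfolding D_def by (auto simp: in_cint_iff)
  qed
  show r': "computable_less r'"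
    unfolding computable_less_def
  proof
    have "inj (r \<circ> ?e)" using inj inj_e by (rule inj_compose)
    then show "inj r'" unfolding r'_def comp_def .
    show "cf.dec (\<lambda>z. r' (pi1 z) < r' (pi2 z))"
      unfolding r'_def by (intro dec_rank_less[OF r] cf.C_comp[OF Ce] cf.dec_rules)
  qed
  have first: "r' (ei c) \<le> r' x" for x unfolding r'_def ei[OF cD] using eD[of x] unfolding D_def by simp
  then show "\<exists>a. \<forall>x. r' a \<le> r' x" by blast
  have "\<not> blk r' (ei c) (ei d)" unfolding blk' ei[OF cD] ei[OF dD] by (rule nb)
  then show "\<exists>x y. \<not> blk r' x y" by blast
  show "\<exists>b'. \<forall>x. r' x \<le> r' b'" if "\<And>x. r x \<le> r b" for b
    using ei[of b] that unfolding r'_def D_def by (metis mem_Collect_eq)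
  show "rich r'"
    unfolding rich_def
  proof (intro allI impI)
    fix x y k assume xy: "r' x < r' y" "\<not> blk r' x y"
    have "r (?e x) < r (?e y)" "\<not> blk r (?e x) (?e y)" using xy blk' unfolding r'_def by simp_all
    then obtain S where S: "finite S" "k \<le> card S"
        "\<And>s. s \<in> S \<Longrightarrow> r (?e x) < r s \<and> r s < r (?e y) \<and> \<not> blk r (?e x) s \<and> \<not> blk r s (?e y)"
        "\<And>s s'. s \<in> S \<Longrightarrow> s' \<in> S \<Longrightarrow> cint r s s' \<subseteq> S"
      using rich[unfolded rich_def, rule_format, of "?e x" "?e y" k] by blast
    have SD: "s \<in> D" if "s \<in> S" for s using S(3)[OF that] eD[of x] unfolding D_def by simp
    have "inj_on ei S" using ei SD by (metis inj_on_inverseI)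
    then have "k \<le> card (ei ` S)" using S(2) by (simp add: card_image)
    moreover have "cint r' (ei s) (ei s') \<subseteq> ei ` S" if "s \<in> S" "s' \<in> S" for s s'
    proof
      fix z assume "z \<in> cint r' (ei s) (ei s')"
      then have "?e z \<in> cint r s s'" unfolding in_cint_iff r'_def ei[OF SD[OF that(1)]] ei[OF SD[OF that(2)]] .
      then have "?e z \<in> S" using S(4)[OF that] by blast
      then show "z \<in> ei ` S" using ei'[of z] by (metis imageI)
    qed
    moreover have "r' x < r' (ei s) \<and> r' (ei s) < r' y \<and> \<not> blk r' x (ei s) \<and> \<not> blk r' (ei s) y" if "s \<in> S" for s
      using S(3)[OF that] unfolding blk' ei[OF SD[OF that]] unfolding r'_def ei[OF SD[OF that]] .
    ultimately show "\<exists>S. finite S \<and> k \<le> card S \<and> (\<forall>s\<in>S. r' x < r' s \<and> r' s < r' y \<and> \<not> blk r' x s \<and> \<not> blk r' s y) \<and>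
        (\<forall>s\<in>S. \<forall>s'\<in>S. cint r' s s' \<subseteq> S)"
      using S(1) by (intro exI[of _ "ei ` S"]) auto
  qed
  define U where "U y = {z. r y < r z \<and> r z < r c}" for y
  \<comment> \<open>Counting the elements strictly between \<open>y\<close> and \<open>c\<close>
    numbers the part below \<open>c\<close> downwards.\<close>
  define h where "h y = card (U y)" for y
  have finU: "finite (U y)" for y
  proof (cases "r y < r c")
    case True
    have "U y \<subseteq> cint r y c" unfolding U_def by (auto simp: in_cint_iff)
    then show ?thesis using c[OF True] unfolding blk_def by (rule finite_subset)
  next
    case False
    then have "U y = {}" unfolding U_def by auto
    then show ?thesis by simp
  qed
  have h_less: "h y' < h y" if "r y < r y'" "r y' < r c" for y y'
    unfolding h_def by (rule psubset_card_mono[OF finU]) (use that in \<open>auto simp: U_def\<close>)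
  have h_iff: "h y' < h y \<longleftrightarrow> r y < r y'" if "r y < r c" "r y' < r c" for y y'
    using h_less[of y y'] h_less[of y' y] that r_eq[of y y'] by (metis less_asym' less_irrefl linorder_neqE_linordered_idom)
  have pred: "\<exists>y. r y < r u \<and> (\<forall>z. r z < r u \<longrightarrow> r z \<le> r y)" if "r u \<le> r c" for u
  proof -
    obtain z0 where z0: "r z0 < r u" using no_first by blast
    let ?A = "{z. r z0 \<le> r z \<and> r z < r u}"
    have "?A \<subseteq> insert z0 (U z0)" unfolding U_def using that by (auto simp: order_le_less[of "r z0"])
    then have "finite ?A" using finU[of z0] finite_subset by blast
    then obtain y where y: "y \<in> ?A" "\<And>z. z \<in> ?A \<Longrightarrow> - r y \<le> - r z"
      using finite_ex_min[of ?A "\<lambda>z. - r z"] z0 by auto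
    have "r z \<le> r y" if "r z < r u" for z
      using y(1) y(2)[of z] that by (cases "r z0 \<le> r z") auto
    then show ?thesis using y(1) by blast
  qed
  have h_surj: "\<exists>y. r y < r c \<and> h y = n" for n
  proof (induction n)
    case 0
    obtain y where y: "r y < r c" "\<forall>z. r z < r c \<longrightarrow> r z \<le> r y" using pred by blast
    then have "U y = {}" unfolding U_def by force
    then show ?case using y(1) unfolding h_def by (intro exI[of _ y]) simp
  next
    case (Suc n)
    then obtain u where u: "r u < r c" "h u = n" by blast
    obtain y where y: "r y < r u" "\<forall>z. r z < r u \<longrightarrow> r z \<le> r y" using pred[of u] u(1) by auto
    have "U y = insert u (U u)"
    proof (intro set_eqI iffI)
      fix z assume z: "z \<in> U y"
      then have "\<not> r z < r u" using y(2) unfolding U_def by force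
      then have "r u < r z \<or> z = u" using r_eq[of z u] by linarith
      then show "z \<in> insert u (U u)" using z unfolding U_def by auto
    qed (use y(1) u(1) in \<open>auto simp: U_def\<close>)
    moreover have "u \<notin> U u" unfolding U_def by simp
    ultimately have "h y = Suc n" unfolding h_def using finU[of u] u(2) h_def by simp
    then show ?case using y(1) u(1) by (intro exI[of _ y]) simp
  qed
  show "has_copy r" if "has_copy r'"
    using that
  proof (rule has_copyE)
    fix q f P assume q: "computable_less q" and f: "bij f" "\<And>i j. q (f i) < q (f j) \<longleftrightarrow> r' i < r' j"
      and P: "cf.dec (\<lambda>z. P (pi1 z) (pi1 (pi2 z)) (pi2 (pi2 z)))" "\<And>x y. \<not> blk q x y \<longleftrightarrow> (\<exists>s. P x y s)"
    have q_inj: "q i = q j \<longleftrightarrow> i = j" for i j using q unfolding computable_less_def by (auto dest: injD)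
    define m0 where "m0 = f (ei c)"
    have q_min: "q m0 \<le> q i" for i
    proof -
      obtain j where "i = f j" using f(1) by (metis bij_pointE)
      then show ?thesis using f(2)[of j "ei c"] first[of j] unfolding m0_def by simp
    qed
    \<comment> \<open>Even numbers carry the part below \<open>c\<close>, going down from rank 0,
      and odd numbers carry the copy of \<open>D\<close>, with ranks made positive by the
      exponential.\<close>
    define r3 where "r3 n = (if even n then - real (n div 2) else exp (q (n div 2)))" for n :: nat
    have r3_even: "r3 (2 * k) = - real k" and r3_odd: "r3 (Suc (2 * k)) = exp (q k)" for k
      by (simp_all add: r3_def)
    have r3_pos: "0 < r3 n \<longleftrightarrow> odd n" for n by (simp add: r3_def)
    have less3: "r3 i < r3 j \<longleftrightarrow> (if even i then (if even j then j div 2 < i div 2 else True)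
        else (if even j then False else q (i div 2) < q (j div 2)))" for i j
    proof -
      have "- real k < exp x" "\<not> exp x < - real k" for k x
        using exp_gt_zero[of x] of_nat_0_le_iff[of k] by (smt (verit))+
      then show ?thesis by (simp add: r3_def)
    qed
    have inj3: "inj r3"
    proof (rule injI)
      fix i j assume eq: "r3 i = r3 j"
      then have "even i \<longleftrightarrow> even j" using r3_pos by metis
      then show "i = j" using eq q_inj unfolding r3_def
        by (cases "even i") (auto elim!: evenE oddE)
    qed
    interpret r3: ranked r3 by unfold_locales (rule inj3)
    have c3: "computable_less r3"
      unfolding computable_less_def less3
      by (intro conjI inj3 cf.dec_rules cf.dec_const computable_half dec_rank_less[OF q])
    have odd_blk: "blk r3 (Suc (2 * i)) (Suc (2 * j)) \<longleftrightarrow> blk q i j" for i j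
    proof -
      have "cint r3 (Suc (2 * i)) (Suc (2 * j)) \<subseteq> range (\<lambda>k. Suc (2 * k))"
      proof
        fix z assume z: "z \<in> cint r3 (Suc (2 * i)) (Suc (2 * j))"
        have "0 < r3 (Suc (2 * i))" "0 < r3 (Suc (2 * j))" unfolding r3_odd by simp_all
        then have "0 < r3 z" using z unfolding in_cint_iff by linarith
        then obtain k where "z = 2 * k + 1" unfolding r3_pos by (auto elim: oddE)
        then show "z \<in> range (\<lambda>k. Suc (2 * k))" by simp
      qed
      moreover have "inj (\<lambda>k::nat. Suc (2 * k))" by (rule injI) simp
      ultimately have "blk (\<lambda>k. r3 (Suc (2 * k))) i j \<longleftrightarrow> blk r3 (Suc (2 * i)) (Suc (2 * j))"
        by (intro blk_sub)
      then show ?thesis unfolding r3_odd by (simp add: blk_def cint_def)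
    qed
    have even_blk: "blk r3 (2 * k) (Suc (2 * m0))" for k
    proof -
      have "cint r3 (2 * k) (Suc (2 * m0)) \<subseteq> insert (Suc (2 * m0)) {..2 * k}"
      proof
        fix z assume z: "z \<in> cint r3 (2 * k) (Suc (2 * m0))"
        have "r3 (2 * k) < r3 (Suc (2 * m0))" unfolding less3 by simp
        then have z: "r3 (2 * k) \<le> r3 z" "r3 z \<le> r3 (Suc (2 * m0))" using z unfolding in_cint_iff by linarith+
        show "z \<in> insert (Suc (2 * m0)) {..2 * k}"
        proof (cases "even z")
          case True
          then obtain l where l: "z = 2 * l" by (rule evenE)
          then show ?thesis using z(1) unfolding l r3_even by simp
        next
          case False
          then obtain l where l: "z = Suc (2 * l)" by (auto elim: oddE)
          then have "q l \<le> q m0" using z(2) unfolding l r3_odd by simp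
          then have "l = m0" using q_min[of l] q_inj by (metis order_antisym)
          then show ?thesis using l by simp
        qed
      qed
      then show ?thesis unfolding blk_def by (rule finite_subset) simp
    qed
    \<comment> \<open>All even numbers are in the block of the first element \<open>m0\<close> of
      the copy, so they are replaced by \<open>m0\<close> before a question about blocks is
      asked.\<close>
    define e3 where "e3 n = (if even n then m0 else n div 2)" for n :: nat
    have to_odd: "blk r3 n (Suc (2 * e3 n))" for n
    proof (cases "even n")
      case True
      then show ?thesis using even_blk[of "n div 2"] by (simp add: e3_def)
    next
      case False
      then show ?thesis by (simp add: e3_def)
    qed
    have blk3: "blk r3 x y \<longleftrightarrow> blk q (e3 x) (e3 y)" for x y
      unfolding odd_blk[symmetric] using to_odd[of x] to_odd[of y] blk_trans[of r3] blk_commute[of r3] by meson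
    have Ce3: "computable_fun (\<lambda>x. e3 (g x))" if "computable_fun g" for g
      unfolding e3_def using that by (intro cf.C_if cf.C_const computable_half)
    define f3 where "f3 x = (if r x < r c then 2 * h x else Suc (2 * f (ei x)))" for x
    have f3_D: "x \<in> D" if "\<not> r x < r c" for x using that unfolding D_def by simp
    have f3_less: "r3 (f3 x) < r3 (f3 y) \<longleftrightarrow> r x < r y" for x y
    proof -
      consider "r x < r c" "r y < r c" | "r x < r c" "\<not> r y < r c" | "\<not> r x < r c" "r y < r c"
        | "\<not> r x < r c" "\<not> r y < r c" by blast
      then show ?thesis
      proof cases
        case 1
        then show ?thesis unfolding less3 f3_def using h_iff[of x y] by simp
      next
        case 4
        then show ?thesis unfolding less3 f3_def using ei[OF f3_D[of x]] ei[OF f3_D[of y]]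
          by (simp add: f(2) r'_def)
      qed (unfold less3 f3_def, auto)
    qed
    have "bij f3"
    proof (rule bijI)
      show "inj f3"
      proof (rule injI)
        fix x y assume "f3 x = f3 y"
        then show "x = y" using f3_less[of x y] f3_less[of y x] r_eq[of x y] by (metis less_irrefl linorder_neqE_linordered_idom)
      qed
      show "surj f3"
        unfolding surj_def
      proof
        fix n
        show "\<exists>x. n = f3 x"
        proof (cases "even n")
          case True
          then obtain k where k: "n = 2 * k" by (rule evenE)
          obtain y where "r y < r c" "h y = k" using h_surj by blast
          then show ?thesis using k by (intro exI[of _ y]) (simp add: f3_def)
        next
          case False
          then obtain k where k: "n = Suc (2 * k)" by (auto elim: oddE)
          obtain i where "k = f i" using f(1) by (metis bij_pointE)
          moreover have "\<not> r (?e i) < r c" using eD[of i] unfolding D_def by simp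
          ultimately show ?thesis using k ei' by (intro exI[of _ "?e i"]) (simp add: f3_def)
        qed
      qed
    qed
    then show ?thesis
    proof (rule has_copyI[OF c3 _ f3_less])
      show "cf.dec (\<lambda>z. P (e3 (pi1 z)) (e3 (pi1 (pi2 z))) (pi2 (pi2 z)))"
        by (rule cf.dec_comp3[OF P(1) Ce3 Ce3]) (intro cf.dec_rules)+
      show "\<not> blk r3 x y \<longleftrightarrow> (\<exists>s. P (e3 x) (e3 y) s)" for x y unfolding blk3 by (rule P(2))
    qed
  qed
qed

text \<open>Either there is a first element, or there is no first block, or the first block has no
  first element. The preservation of last elements allows the lemma to be applied a second time, to
  the reversed order.\<close>

lemma with_first:
  assumes r: "computable_less r" "rich r" and nb: "\<not> blk r x y"
  obtains r' a where "computable_less r'" "rich r'" "\<forall>x. r' a \<le> r' x" "\<exists>x y. \<not> blk r' x y"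
    "has_copy r' \<longrightarrow> has_copy r" "\<forall>b. (\<forall>x. r x \<le> r b) \<longrightarrow> (\<exists>b'. \<forall>x. r' x \<le> r' b')"
proof -
  consider (first) a where "\<And>x. r a \<le> r x" | (op) "\<And>x. \<exists>y. r y < r x \<and> \<not> blk r y x"
    | (block) c where "\<forall>y. r y < r c \<longrightarrow> blk r y c" "\<And>x. \<exists>y. r y < r x"
    by (meson not_le)
  then show thesis
  proof cases
    case first
    then show thesis using that[of r a] r nb by blast
  next
    case op
    let ?r = "\<lambda>i. case i of 0 \<Rightarrow> 0 | Suc j \<Rightarrow> exp (r j)"
    note p = prepend_first[OF r op]
    have "\<exists>b'. \<forall>x. ?r x \<le> ?r b'" if "\<forall>x. r x \<le> r b" for b
    proof (intro exI[of _ "Suc b"] allI)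
      show "?r x \<le> ?r (Suc b)" for x using that by (cases x) simp_all
    qed
    moreover have "\<not> blk ?r (Suc x) (Suc y)" using p(5) nb by simp
    ultimately show thesis using that[of ?r 0] p(1-4) by blast
  next
    case block
    have "\<exists>d. \<not> blk r c d" using nb blk_trans[of r x c y] blk_commute by blast
    then obtain d where d: "\<not> blk r c d" by blast
    note p = drop_initial[OF r block d]
    obtain a where "\<And>x. r (enumerate {z. r c \<le> r z} a) \<le> r (enumerate {z. r c \<le> r z} x)" using p(3) by blast
    then show thesis using that[of "\<lambda>i. r (enumerate {z. r c \<le> r z} i)" a] p(1,2,4,5,6) by blast
  qed
qed

theorem ex_copy:
  assumes r: "computable_less r" "rich r" and nb: "\<not> blk r x y"
  shows "has_copy r"
proof -
  obtain r1 a where r1: "computable_less r1" "rich r1" "\<forall>x. r1 a \<le> r1 x" "\<exists>x y. \<not> blk r1 x y"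
    "has_copy r1 \<longrightarrow> has_copy r"
    by (rule with_first[OF r nb]) (rule that)
  then obtain x1 y1 where nb1: "\<not> blk (\<lambda>i. - r1 i) x1 y1" unfolding blk_neg by blast
  \<comment> \<open>After negation of the ranks \<open>a\<close> is a last element, and the final
    clause turns it into a last element of \<open>r2\<close>.\<close>
  obtain r2 b where r2: "computable_less r2" "rich r2" "\<forall>x. r2 b \<le> r2 x" "\<exists>x y. \<not> blk r2 x y"
    "has_copy r2 \<longrightarrow> has_copy (\<lambda>i. - r1 i)"
    "\<forall>b. (\<forall>x. - r1 x \<le> - r1 b) \<longrightarrow> (\<exists>b'. \<forall>x. r2 x \<le> r2 b')"
    by (rule with_first[OF computable_less_neg[OF r1(1)] rich_neg[OF r1(2)] nb1]) (rule that)
  have "\<forall>x. - r1 x \<le> - r1 a" using r1(3) by simp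
  then obtain a' where a': "\<And>x. r2 x \<le> r2 a'" using r2(6) by blast
  obtain x2 y2 where "\<not> blk r2 x2 y2" using r2(4) by blast
  have "\<not> blk r2 b a'"
  proof
    assume ba: "blk r2 b a'"
    have "x2 \<in> cint r2 b a'" "y2 \<in> cint r2 b a'" using r2(3) a' by (simp_all add: in_cint_iff)
    then have "blk r2 b x2" "blk r2 b y2" using blk_mono[OF ba] by blast+
    then show False using \<open>\<not> blk r2 x2 y2\<close> blk_trans[of r2 x2 b y2] blk_commute by blast
  qed
  then have "has_copy r2" using has_copy_bounded[OF r2(1,2)] r2(3) a' by blast
  then have "has_copy (\<lambda>i. - r1 i)" using r2(5) by blast
  then have "has_copy (\<lambda>i. - (- r1 i))" by (rule has_copy_neg)
  then show ?thesis using r1(5) by simp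
qed

subsection \<open>Order relations and rank functions\<close>

definition le_rel :: "(nat \<Rightarrow> real) \<Rightarrow> nat rel" where
  "le_rel r = {(x, y). r x \<le> r y}"

lemma le_rel_iff [simp]: "(x, y) \<in> le_rel r \<longleftrightarrow> r x \<le> r y"
  by (simp add: le_rel_def)

lemma linear_order_le_rel: "inj r \<Longrightarrow> linear_order (le_rel r)"
  unfolding linear_order_on_def partial_order_on_def preorder_on_def refl_on_def trans_def antisym_def total_on_def
  by (auto dest: injD)

lemma Field_le_rel [simp]: "Field (le_rel r) = UNIV"
  by (auto simp: Field_def le_rel_def)

text \<open>Each element is ranked by the total weight of its strict predecessors, where
  \<open>n\<close> has weight \<open>(1/2)^n\<close>. From \<open>x\<close> to a larger element the
  rank grows at least by the weight of \<open>x\<close>.\<close>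

lemma ex_rank:
  fixes L :: "nat rel"
  assumes "linear_order L"
  shows "\<exists>r. inj r \<and> L = le_rel r"
proof -
  have tot: "(x, y) \<in> L \<or> (y, x) \<in> L" for x y
    using assms unfolding linear_order_on_def partial_order_on_def preorder_on_def total_on_def refl_on_def
    by (cases "x = y") auto
  have tr: "(x, y) \<in> L \<Longrightarrow> (y, z) \<in> L \<Longrightarrow> (x, z) \<in> L" for x y z
    using assms unfolding linear_order_on_def partial_order_on_def preorder_on_def by (blast dest: transD)
  have as: "(x, y) \<in> L \<Longrightarrow> (y, x) \<in> L \<Longrightarrow> x = y" for x y
    using assms unfolding linear_order_on_def partial_order_on_def by (blast dest: antisymD)
  let ?f = "\<lambda>x n. if (n, x) \<in> L \<and> n \<noteq> x then (1/2)^n else (0::real)"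
  define r where "r x = (\<Sum>n. ?f x n)" for x
  have geo: "summable (\<lambda>n. (1/2::real)^n)" by (rule summable_geometric) simp
  have sum: "summable (?f x)" for x by (rule summable_comparison_test'[OF geo, of 0]) simp
  have less: "r x < r y" if xy: "(x, y) \<in> L" "x \<noteq> y" for x y
  proof -
    let ?g = "\<lambda>n. if n = x then (1/2::real)^x else 0"
    have g: "?g sums (1/2)^x" using sums_single[of x "\<lambda>_. (1/2::real)^x"] by simp
    have "?f x n + ?g n \<le> ?f y n" for n using xy tr[of n x y] as[of x y] by auto
    then have "(\<Sum>n. ?f x n + ?g n) \<le> (\<Sum>n. ?f y n)"
      by (intro suminf_le sum summable_add sums_summable[OF g])
    then have "r x + (1/2)^x \<le> r y"
      unfolding r_def using suminf_add[OF sum[of x] sums_summable[OF g]] sums_unique[OF g] by simp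
    moreover have "0 < (1/2::real)^x" by simp
    ultimately show ?thesis by linarith
  qed
  have "inj r"
  proof (rule injI)
    fix x y assume "r x = r y"
    then show "x = y" using less[of x y] less[of y x] tot[of x y] by force
  qed
  moreover have "(x, y) \<in> L \<longleftrightarrow> r x \<le> r y" for x y
    using less[of x y] less[of y x] tot[of x y] by force
  then have "L = le_rel r" by auto
  ultimately show ?thesis by blast
qed

lemma nonblock_le_rel: "(x, y) \<in> nonblock_rel (le_rel r) \<longleftrightarrow> \<not> blk r x y"
  by (simp add: nonblock_rel_def block_rel_def closed_interval_def blk_def cint_def Un_def)

section \<open>Condensation of a convex union of blocks\<close>

context ranked
begin

definition B :: "nat \<Rightarrow> nat set" where "B z = {w. blk r z w}"

lemma B_eq_iff: "B a = B b \<longleftrightarrow> blk r a b"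
proof
  assume "B a = B b"
  then have "b \<in> B a" unfolding B_def by simp
  then show "blk r a b" unfolding B_def by simp
next
  assume ab: "blk r a b"
  then show "B a = B b" unfolding B_def using blk_trans[of r] blk_commute[of r] by blast
qed

lemma in_B [simp]: "a \<in> B a"
  unfolding B_def by simp

context
  fixes I :: "nat set"
  assumes convex: "\<And>x y. x \<in> I \<Longrightarrow> y \<in> I \<Longrightarrow> cint r x y \<subseteq> I"
    and closed: "\<And>x. x \<in> I \<Longrightarrow> B x \<subseteq> I"
begin

lemma Field_Restr_le: "Field (Restr (le_rel r) I) = I"
  by (auto simp: Field_def)

lemma closed_interval_Restr: "x \<in> I \<Longrightarrow> y \<in> I \<Longrightarrow> closed_interval (Restr (le_rel r) I) x y = cint r x y"
  using convex[of x y] unfolding closed_interval_def in_cint_iff cint_def by auto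

lemma blocks_Restr: "blocks (Restr (le_rel r) I) = B ` I"
proof -
  have "block_rel (Restr (le_rel r) I) `` {x} = B x" if "x \<in> I" for x
    using that closed[OF that] closed_interval_Restr[OF that]
    unfolding block_rel_def Field_Restr_le B_def blk_def by auto
  then show ?thesis unfolding blocks_def Field_Restr_le quotient_def by auto
qed

text \<open>The order of blocks is defined by the existence of suitable members; as blocks are
  convex, any two members decide it.\<close>

lemma condensation_Restr:
  assumes "a \<in> I" "b \<in> I"
  shows "(B a, B b) \<in> condensation (Restr (le_rel r) I) \<longleftrightarrow> r a \<le> r b \<or> B a = B b"
proof
  assume "(B a, B b) \<in> condensation (Restr (le_rel r) I)"
  then obtain x y where xy: "x \<in> B a" "y \<in> B b" "r x \<le> r y" unfolding condensation_def by auto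
  show "r a \<le> r b \<or> B a = B b"
  proof (rule disjCI)
    assume ne: "B a \<noteq> B b"
    have ax: "blk r a x" and yb: "blk r b y" using xy unfolding B_def by auto
    show "r a \<le> r b"
    proof (rule ccontr)
      assume ba: "\<not> r a \<le> r b"
      show False
      proof (cases "r b < r x")
        case False
        then have "b \<in> cint r a x" using ba by (simp add: in_cint_iff)
        then show ?thesis using blk_mono[OF ax] ne B_eq_iff by blast
      next
        case True
        then have "x \<in> cint r b y" using xy(3) by (simp add: in_cint_iff)
        then have "blk r b x" using blk_mono[OF yb] by blast
        then show ?thesis using ax ne B_eq_iff blk_trans[of r a x b] blk_commute[of r] by blast
      qed
    qed
  qed
next
  assume "r a \<le> r b \<or> B a = B b"
  then show "(B a, B b) \<in> condensation (Restr (le_rel r) I)"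
  proof
    assume "r a \<le> r b"
    then have "(a, b) \<in> Restr (le_rel r) I" using assms by simp
    then show ?thesis unfolding condensation_def blocks_Restr using assms in_B by blast
  next
    assume eq: "B a = B b"
    have "(a, a) \<in> Restr (le_rel r) I" using assms by simp
    then show ?thesis unfolding condensation_def blocks_Restr eq[symmetric] using assms in_B by blast
  qed
qed

lemma Field_condensation_Restr: "Field (condensation (Restr (le_rel r) I)) = B ` I"
proof
  show "Field (condensation (Restr (le_rel r) I)) \<subseteq> B ` I"
    unfolding Field_def condensation_def blocks_Restr by auto
  show "B ` I \<subseteq> Field (condensation (Restr (le_rel r) I))"
    using condensation_Restr unfolding Field_def by blast
qed

end

end

subsection \<open>Dense condensation types\<close>

text \<open>An order isomorphism from the rationals onto the rationals strictly between 0 and 1;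
  both branches would give 1/2 at 0.\<close>

definition chi :: "rat \<Rightarrow> rat" where
  "chi y = (if y \<le> 0 then 1 / (2 - y) else 1 - 1 / (2 + y))"

lemma chi_bounds: "0 < chi y" "chi y < 1"
  unfolding chi_def by (auto simp: field_simps)

lemma chi_less:
  assumes "x < y" shows "chi x < chi y"
proof -
  consider "y \<le> 0" | "x \<le> 0" "0 < y" | "0 < x" using assms by linarith
  then show ?thesis
  proof cases
    case 1
    then show ?thesis using assms unfolding chi_def by (simp add: frac_less2)
  next
    case 2
    have "1 / (2 - x) \<le> 1 / 2" using 2(1) by (intro divide_left_mono) auto
    moreover have "1 / (2 + y) < 1 / 2" using 2(2) by (intro divide_strict_left_mono) auto
    moreover have "chi x = 1 / (2 - x)" "chi y = 1 - 1 / (2 + y)" using 2 by (simp_all add: chi_def)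
    ultimately show ?thesis by linarith
  next
    case 3
    then show ?thesis using assms unfolding chi_def by (simp add: frac_less2)
  qed
qed

lemma chi_le_iff: "chi x \<le> chi y \<longleftrightarrow> x \<le> y"
  using chi_less[of x y] chi_less[of y x] by (cases x y rule: linorder_cases) auto

lemma chi_surj:
  assumes "0 < t" "t < 1" shows "\<exists>y. chi y = t"
proof (cases "t \<le> 1 / 2")
  case True
  have "2 - 1 / t \<le> 0" using True assms by (simp add: field_simps)
  then show ?thesis using assms by (intro exI[of _ "2 - 1 / t"]) (simp add: chi_def)
next
  case False
  have "0 < 1 / (1 - t) - 2" using False assms by (simp add: field_simps)
  then show ?thesis using assms by (intro exI[of _ "1 / (1 - t) - 2"]) (simp add: chi_def)
qed

lemma order_sum_iff:
  "(Inl a, Inl a') \<in> order_sum r s \<longleftrightarrow> (a, a') \<in> r"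
  "(Inr b, Inr b') \<in> order_sum r s \<longleftrightarrow> (b, b') \<in> s"
  "(Inl a, Inr b) \<in> order_sum r s \<longleftrightarrow> a \<in> Field r \<and> b \<in> Field s"
  "(Inr b, Inl a) \<notin> order_sum r s"
  by (auto simp: order_sum_def)

text \<open>Treats the four types alike: \<open>chi\<close> sends \<eta> onto the open unit
  interval, and the end points, if there are any, go to 0 and 1.\<close>

lemma dense_type_embedding:
  assumes "dense_condensation_type L"
  shows "\<exists>h. (\<forall>X\<in>Field (condensation L). \<forall>Y\<in>Field (condensation L).
      (X, Y) \<in> condensation L \<longleftrightarrow> h X \<le> (h Y :: rat)) \<and>
    {0<..<1} \<subseteq> h ` Field (condensation L) \<and> h ` Field (condensation L) \<subseteq> {0..1}"
proof -
  let ?C = "condensation L"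
  have transport: ?thesis
    if iso: "same_order_type ?C T" and g: "\<And>a b. (a, b) \<in> T \<longleftrightarrow> g a \<le> (g b :: rat)"
      "\<And>t. 0 < t \<Longrightarrow> t < 1 \<Longrightarrow> \<exists>a. g a = t" "\<And>a. 0 \<le> g a \<and> g a \<le> 1" for T :: "'t rel" and g
  proof -
    obtain f where f: "bij_betw f (Field ?C) (Field T)"
      "\<forall>X\<in>Field ?C. \<forall>Y\<in>Field ?C. (X, Y) \<in> ?C \<longleftrightarrow> (f X, f Y) \<in> T"
      using iso unfolding same_order_type_def iso_iff2 by blast
    have "Field T = UNIV" using g(1) unfolding Field_def by auto
    then have im: "f ` Field ?C = UNIV" using f(1) unfolding bij_betw_def by simp
    have "{0<..<1} \<subseteq> (g \<circ> f) ` Field ?C"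
    proof
      fix t :: rat assume "t \<in> {0<..<1}"
      then obtain a where "g a = t" using g(2)[of t] by auto
      moreover obtain X where "X \<in> Field ?C" "f X = a" using im by (metis UNIV_I imageE)
      ultimately show "t \<in> (g \<circ> f) ` Field ?C" by auto
    qed
    moreover have "(g \<circ> f) ` Field ?C \<subseteq> {0..1}" using g(3) by auto
    ultimately show ?thesis using f(2) g(1) by (intro exI[of _ "g \<circ> f"]) simp
  qed
  have c: "0 \<le> chi y" "chi y \<le> 1" "\<not> chi y \<le> 0" "\<not> 1 \<le> chi y" for y
    using chi_bounds[of y] by simp_all
  have eta: "(a, b) \<in> eta \<longleftrightarrow> chi a \<le> chi b" for a b by (simp add: eta_def chi_le_iff)
  have F: "Field eta = UNIV" "Field order_one = UNIV"
    by (auto simp: Field_def eta_def order_one_def)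
  have one: "(a, b) \<in> order_one" for a b by (cases a; cases b) (simp add: order_one_def)
  let ?g1 = "case_sum (\<lambda>_. 0) chi" and ?g2 = "case_sum chi (\<lambda>_. 1)"
  have g1: "(a, b) \<in> order_sum order_one eta \<longleftrightarrow> ?g1 a \<le> ?g1 b" for a b
    using c by (cases a; cases b) (simp_all add: order_sum_iff one eta F)
  have F1: "Field (order_sum order_one eta) = UNIV" using g1 unfolding Field_def by auto
  from assms show ?thesis unfolding dense_condensation_type_def
  proof (elim disjE)
    assume "same_order_type ?C eta"
    then show ?thesis by (rule transport[OF _ eta]) (use chi_surj c in auto)
  next
    assume "same_order_type ?C (order_sum order_one eta)"
    then show ?thesis
    proof (rule transport[OF _ g1])
      show "\<exists>a. ?g1 a = t" if "0 < t" "t < 1" for t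
        using chi_surj[OF that] by (metis sum.case(2))
      show "0 \<le> ?g1 a \<and> ?g1 a \<le> 1" for a using c by (cases a) auto
    qed
  next
    assume "same_order_type ?C (order_sum eta order_one)"
    then show ?thesis
    proof (rule transport)
      show "(a, b) \<in> order_sum eta order_one \<longleftrightarrow> ?g2 a \<le> ?g2 b" for a b
        using c by (cases a; cases b) (simp_all add: order_sum_iff one eta F)
      show "\<exists>a. ?g2 a = t" if "0 < t" "t < 1" for t
        using chi_surj[OF that] by (metis sum.case(1))
      show "0 \<le> ?g2 a \<and> ?g2 a \<le> 1" for a using c by (cases a) auto
    qed
  next
    let ?g4 = "case_sum (case_sum (\<lambda>_. 0) chi) (\<lambda>_. 1)"
    assume "same_order_type ?C (order_sum (order_sum order_one eta) order_one)"
    then show ?thesis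
    proof (rule transport)
      have c1: "?g1 a \<le> 1" "\<not> 1 \<le> ?g1 a" for a using c by (cases a; simp)+
      show "(a, b) \<in> order_sum (order_sum order_one eta) order_one \<longleftrightarrow> ?g4 a \<le> ?g4 b" for a b
        by (cases a; cases b) (simp_all only: order_sum_iff one g1 F F1 sum.case c1 order_refl UNIV_I simp_thms)
      show "\<exists>a. ?g4 a = t" if "0 < t" "t < 1" for t
        using chi_surj[OF that] by (metis sum.case)
      show "0 \<le> ?g4 a \<and> ?g4 a \<le> 1" for a using c by (cases a) (auto split: sum.split)
    qed
  qed
qed

text \<open>\<open>H\<close> is the position of a block in the unit interval. If there were no run
  of length \<open>k\<close> between \<open>x\<close> and \<open>y\<close>, all blocks strictly
  between them would have fewer than \<open>k\<close> elements, since \<open>k\<close> elements of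
  one block span a finite convex set. These blocks, rescaled, are ordered like the rationals, so
  that their union would be an infinite, strongly \<eta>-like interval.\<close>

lemma (in ranked) rich_from_type:
  assumes dense: "dense_condensation_type (le_rel r)"
    and no: "\<not> (\<exists>I. is_interval_of I (le_rel r) \<and> infinite I \<and> strongly_eta_like (Restr (le_rel r) I))"
  shows "rich r" "\<exists>x y. \<not> blk r x y"
proof -
  have R: "Restr (le_rel r) UNIV = le_rel r" by simp
  have F: "Field (condensation (le_rel r)) = range B"
    using Field_condensation_Restr[of UNIV] by simp
  have cond: "(B a, B b) \<in> condensation (le_rel r) \<longleftrightarrow> r a \<le> r b \<or> B a = B b" for a b
    using condensation_Restr[of UNIV a b] by simp
  obtain h where h': "(\<forall>X\<in>range B. \<forall>Y\<in>range B. (X, Y) \<in> condensation (le_rel r) \<longleftrightarrow> h X \<le> (h Y :: rat)) \<and>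
      {0<..<1} \<subseteq> h ` range B \<and> h ` range B \<subseteq> {0..1}"
    by (rule exE[OF dense_type_embedding[OF dense, unfolded F]]) (rule that)
  note h = h'[THEN conjunct1] h'[THEN conjunct2, THEN conjunct1] h'[THEN conjunct2, THEN conjunct2]
  define H where "H z = h (B z)" for z
  have H_le: "H a \<le> H b \<longleftrightarrow> r a \<le> r b \<or> blk r a b" for a b
    unfolding H_def h(1)[rule_format, OF rangeI rangeI, symmetric] cond B_eq_iff ..
  have H_eq: "H a = H b \<longleftrightarrow> blk r a b" for a b
    using H_le[of a b] H_le[of b a] blk_commute[of r a b] r_eq[of a b] by force
  have H_less: "H a < H b \<longleftrightarrow> r a < r b \<and> \<not> blk r a b" for a b
    using H_le[of b a] blk_commute[of r a b] by force
  have H_surj: "\<exists>z. H z = t" if "0 < t" "t < 1" for t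
  proof -
    have "t \<in> h ` range B" using h(2) that by auto
    then show ?thesis unfolding H_def by auto
  qed
  have "h (B z) \<in> {0..1}" for z using h(3) by blast
  then have H_bounds: "0 \<le> H z" "H z \<le> 1" for z unfolding H_def by simp_all
  obtain z1 z2 where "H z1 = 1/3" "H z2 = 2/3" using H_surj[of "1/3"] H_surj[of "2/3"] by auto
  then have "\<not> blk r z1 z2" using H_eq[of z1 z2] by simp
  then show "\<exists>x y. \<not> blk r x y" by blast
  show "rich r"
    unfolding rich_def
  proof (intro allI impI)
    fix x y k assume xy: "r x < r y" "\<not> blk r x y"
    let ?Q = "\<lambda>S. finite S \<and> k \<le> card S \<and> (\<forall>s\<in>S. r x < r s \<and> r s < r y \<and> \<not> blk r x s \<and> \<not> blk r s y) \<and>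
        (\<forall>s\<in>S. \<forall>s'\<in>S. cint r s s' \<subseteq> S)"
    show "\<exists>S. ?Q S"
    proof (rule ccontr)
      assume nS: "\<not> ?thesis"
      define I where "I = {z. H x < H z \<and> H z < H y}"
      have convex: "cint r a b \<subseteq> I" if "a \<in> I" "b \<in> I" for a b
      proof
        fix z assume "z \<in> cint r a b"
        then have "H a \<le> H z \<and> H z \<le> H b \<or> H b \<le> H z \<and> H z \<le> H a" unfolding in_cint_iff H_le by blast
        then show "z \<in> I" using that unfolding I_def by auto
      qed
      have closed: "B a \<subseteq> I" if "a \<in> I" for a
      proof
        fix z assume "z \<in> B a"
        then have "H z = H a" unfolding H_eq B_def using blk_commute by blast
        then show "z \<in> I" using that unfolding I_def by simp
      qed
      have Hxy: "H x < H y" using xy H_less by simp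
      have small: "finite (B z) \<and> card (B z) < k" if z: "z \<in> I" for z
      proof (rule ccontr)
        assume "\<not> ?thesis"
        then have "infinite (B z) \<or> k \<le> card (B z)" by auto
        then obtain T where T: "T \<subseteq> B z" "finite T" "card T = k"
          using infinite_arbitrarily_large[of "B z" k] obtain_subset_with_card_n[of k "B z"] by metis
        \<comment> \<open>The convex hull of \<open>T\<close>; it is finite because \<open>T\<close>
          is contained in one block.\<close>
        define S where "S = {w. \<exists>t\<in>T. \<exists>t'\<in>T. r t \<le> r w \<and> r w \<le> r t'}"
        have tt: "blk r t t'" if "t \<in> T" "t' \<in> T" for t t'
          using T(1) that blk_trans[of r t z t'] blk_commute[of r] unfolding B_def by blast
        have "S \<subseteq> (\<Union>t\<in>T. \<Union>t'\<in>T. cint r t t')" unfolding S_def cint_def by blast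
        moreover have "finite (\<Union>t\<in>T. \<Union>t'\<in>T. cint r t t')" using T(2) tt unfolding blk_def by blast
        ultimately have finS: "finite S" using finite_subset by blast
        have TS: "T \<subseteq> S" unfolding S_def by auto
        have SI: "w \<in> I" if w: "w \<in> S" for w
        proof -
          obtain t t' where t: "t \<in> T" "t' \<in> T" "w \<in> cint r t t'" using w unfolding S_def in_cint_iff by blast
          have "t \<in> I" "t' \<in> I" using t T(1) closed[OF z] by auto
          then show ?thesis using convex t(3) by blast
        qed
        have "?Q S"
        proof (intro conjI ballI)
          show "finite S" by (rule finS)
          show "k \<le> card S" using card_mono[OF finS TS] T(3) by simp
          fix s assume s: "s \<in> S"
          have "H x < H s" "H s < H y" using SI[OF s] unfolding I_def by auto
          then show "r x < r s" "r s < r y" "\<not> blk r x s" "\<not> blk r s y" unfolding H_less by auto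
          fix s' assume s': "s' \<in> S"
          show "cint r s s' \<subseteq> S"
          proof
            fix w assume "w \<in> cint r s s'"
            moreover obtain t1 t1' where "t1 \<in> T" "t1' \<in> T" "r t1 \<le> r s" "r s \<le> r t1'"
              using s unfolding S_def by blast
            moreover obtain t2 t2' where "t2 \<in> T" "t2' \<in> T" "r t2 \<le> r s'" "r s' \<le> r t2'"
              using s' unfolding S_def by blast
            ultimately show "w \<in> S" unfolding S_def in_cint_iff by (auto intro: order_trans)
          qed
        qed
        then show False using nS by blast
      qed
      have "is_interval_of I (le_rel r)"
        unfolding is_interval_of_def
      proof (intro conjI ballI allI impI)
        show "I \<subseteq> Field (le_rel r)" by simp
        fix a b z assume "a \<in> I" "b \<in> I" "(a, z) \<in> le_rel r" "(z, b) \<in> le_rel r"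
        then show "z \<in> I" using convex[of a b] by (auto simp: in_cint_iff)
      qed
      moreover have "strongly_eta_like (Restr (le_rel r) I)"
        unfolding strongly_eta_like_def
      proof (intro conjI exI[of _ k])
        show "\<forall>X\<in>blocks (Restr (le_rel r) I). finite X \<and> card X < k"
          using blocks_Restr[OF convex closed] small by auto
        let ?C = "condensation (Restr (le_rel r) I)"
        have FC: "Field ?C = B ` I" by (rule Field_condensation_Restr[OF convex closed])
        have dpos: "0 < H y - H x" using Hxy by simp
        \<comment> \<open>Inverse to \<open>chi\<close> followed by the affine map of the unit
          interval onto the interval from \<open>H x\<close> to \<open>H y\<close>. Composed with
          \<open>h\<close>, it is the isomorphism onto the rationals.\<close>
        define G where "G t = (SOME u. H x + (H y - H x) * chi u = t)" for t
        have G: "H x + (H y - H x) * chi (G t) = t" if "H x < t" "t < H y" for t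
        proof -
          have "0 < (t - H x) / (H y - H x)" "(t - H x) / (H y - H x) < 1"
            using that dpos by (simp_all add: divide_simps)
          then obtain u where "chi u = (t - H x) / (H y - H x)" using chi_surj by blast
          then have "H x + (H y - H x) * chi u = t" using dpos by simp
          then show ?thesis unfolding G_def by (rule someI)
        qed
        have G_le: "G s \<le> G t \<longleftrightarrow> s \<le> t" if "H x < s" "s < H y" "H x < t" "t < H y" for s t
        proof -
          have "s \<le> t \<longleftrightarrow> (H y - H x) * chi (G s) \<le> (H y - H x) * chi (G t)"
            using G[OF that(1,2)] G[OF that(3,4)] by linarith
          also have "\<dots> \<longleftrightarrow> chi (G s) \<le> chi (G t)" using dpos by simp
          finally show ?thesis using chi_le_iff by simp
        qed
        have hB: "h (B z) = H z" for z by (simp add: H_def)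
        have iff: "(X, Y) \<in> ?C \<longleftrightarrow> (G (h X), G (h Y)) \<in> eta" if XY: "X \<in> B ` I" "Y \<in> B ` I" for X Y
        proof -
          obtain a b where ab: "X = B a" "Y = B b" "a \<in> I" "b \<in> I" using XY by blast
          have "(X, Y) \<in> ?C \<longleftrightarrow> H a \<le> H b"
            unfolding ab H_le using condensation_Restr[OF convex closed ab(3,4)] B_eq_iff by blast
          then show ?thesis
            unfolding ab eta_def hB using G_le[of "H a" "H b"] ab(3,4) unfolding I_def by simp
        qed
        have "bij_betw (\<lambda>X. G (h X)) (B ` I) UNIV"
          unfolding bij_betw_def
        proof
          show "inj_on (\<lambda>X. G (h X)) (B ` I)"
          proof (rule inj_onI)
            fix X Y assume "X \<in> B ` I" "Y \<in> B ` I" and eq: "G (h X) = G (h Y)"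
            then obtain a b where ab: "X = B a" "Y = B b" "a \<in> I" "b \<in> I" by blast
            have bounds: "H x < H a" "H a < H y" "H x < H b" "H b < H y" using ab(3,4) unfolding I_def by simp_all
            have "G (H a) = G (H b)" using eq unfolding ab(1,2) hB .
            then have "H a = H b" using G_le[OF bounds] G_le[OF bounds(3,4,1,2)] by simp
            then show "X = Y" unfolding ab using H_eq B_eq_iff by blast
          qed
          show "(\<lambda>X. G (h X)) ` (B ` I) = UNIV"
          proof (intro set_eqI iffI UNIV_I)
            fix u :: rat
            let ?t = "H x + (H y - H x) * chi u"
            have t: "H x < ?t" using dpos chi_bounds(1)[of u] by simp
            have "(H y - H x) * chi u < (H y - H x) * 1" using dpos chi_bounds(2)[of u] by (intro mult_strict_left_mono)
            then have t': "?t < H y" by simp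
            have "0 < ?t" "?t < 1" using t t' H_bounds[of x] H_bounds[of y] by linarith+
            then obtain z where z: "H z = ?t" using H_surj by blast
            have "z \<in> I" unfolding I_def using z t t' by simp
            moreover have "chi (G (H z)) = chi u"
              using G[of "H z"] z t t' dpos by simp
            then have "u = G (h (B z))" using chi_le_iff[of u "G (H z)"] chi_le_iff[of "G (H z)" u] hB by simp
            ultimately show "u \<in> (\<lambda>X. G (h X)) ` (B ` I)" by blast
          qed
        qed
        moreover have "Field eta = UNIV" by (auto simp: Field_def eta_def)
        ultimately show "same_order_type ?C eta"
          unfolding same_order_type_def iso_iff2 FC using iff by (intro exI[of _ "\<lambda>X. G (h X)"]) simp
      qed
      moreover have "infinite I"
      proof
        assume "finite I"
        have "(H ` I) = {H x<..<H y}"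
        proof (intro set_eqI iffI)
          fix t assume t: "t \<in> {H x<..<H y}"
          then have "0 < t" "t < 1" using H_bounds[of x] H_bounds[of y] by auto
          then obtain z where "H z = t" using H_surj by blast
          then show "t \<in> H ` I" unfolding I_def using t by auto
        qed (auto simp: I_def)
        then show False using finite_imageI[OF \<open>finite I\<close>, of H] infinite_Ioo[OF Hxy] by simp
      qed
      ultimately show False using no by blast
    qed
  qed
qed

theorem theorem1:
  fixes L :: "nat rel"
  assumes "computable_linear_order L"
    and "dense_condensation_type L"
    and "\<not> (\<exists>I. is_interval_of I L \<and> infinite I \<and> strongly_eta_like (Restr L I))"
  shows "\<exists>M :: nat rel. computable_linear_order M \<and> same_order_type L M \<and> ce_rel (nonblock_rel M)"
proof -
  obtain r where r: "inj r" "L = le_rel r"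
    using assms(1) ex_rank unfolding computable_linear_order_def by blast
  interpret ranked r by unfold_locales (rule r(1))
  have strict: "(x, y) \<in> le_rel q - Id \<longleftrightarrow> q x < q y" if "inj q" for q :: "nat \<Rightarrow> real" and x y
    using injD[OF that, of x y] by (auto simp: order_le_less)
  have less: "computable_less r"
    using assms(1) r strict[OF r(1)]
    unfolding computable_less_def computable_linear_order_def computable_rel_iff by simp
  obtain x y where "\<not> blk r x y" using rich_from_type(2) assms(2,3) r(2) by blast
  then have "has_copy r" using ex_copy[OF less] rich_from_type(1) assms(2,3) r(2) by blast
  then obtain r' f P where r': "computable_less r'" and f: "bij f" "\<And>i j. r' (f i) < r' (f j) \<longleftrightarrow> r i < r j"
    and P: "cf.dec (\<lambda>z. P (pi1 z) (pi1 (pi2 z)) (pi2 (pi2 z)))" "\<And>x y. \<not> blk r' x y \<longleftrightarrow> (\<exists>s. P x y s)"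
    unfolding has_copy_def by blast
  have inj: "inj r'" using r' unfolding computable_less_def by simp
  have "computable_linear_order (le_rel r')"
    using r' strict[OF inj] linear_order_le_rel[OF inj]
    unfolding computable_less_def computable_linear_order_def computable_rel_iff by simp
  moreover have "r' (f i) \<le> r' (f j) \<longleftrightarrow> r i \<le> r j" for i j
    using f(2)[of j i] by (simp add: not_less[symmetric])
  then have "same_order_type L (le_rel r')"
    unfolding same_order_type_def iso_iff2 r(2) using f(1) by (intro exI[of _ f]) simp
  moreover have "ce_rel (nonblock_rel (le_rel r'))"
    by (rule ce_relI[OF P(1)]) (simp add: nonblock_le_rel P(2))
  ultimately show ?thesis by blast
qed

end
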